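(* Let $(M,g)$ be a compact Riemannian manifold, possibly with nonempty boundary, with $\dim M\ge3$. Let $\{\mu_\varepsilon\}\subset\mathcal{M}_c(M)$ be a sequence with $\mu_\varepsilon\to\mu$ weakly$^*$ and $\lambda_k(\mu_\varepsilon)\ge c>0$ for some fixed $k$ and some constant $c$ independent of $\varepsilon$. Then $\mu$ has no atoms, i.e. $\mu\in\mathcal{M}_c(M)$.
   Context: $\mathcal{M}_c(M)$ is the space of nonnegative continuous (i.e. atomless) Radon measures on $M$; weak$^*$ convergence is tested against continuous functions on $M$. For a nonnegative Radon measure $\mu$, $$\lambda_k(\mu)=\inf_{F_{k+1}}\sup_{\phi\in F_{k+1}\setminus\{0\}}\frac{\int_M|d\phi|_g^2dv_g}{\int_M\phi^2d\mu}\in[0,\infty],$$ with $F_{k+1}$ ranging over $(k+1)$-dimensional subspaces of $C^\infty(M)$ (quotient $+\infty$ if the denominator vanishes). *)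

theory Defs
  imports "HOL-Analysis.Analysis" "HOL-Library.Function_Algebras"
begin

subsection \<open>Smooth maps between coordinate spaces\<close>

fun Ck_on :: "nat \<Rightarrow> 'b::real_normed_vector set \<Rightarrow> ('b \<Rightarrow> 'c::real_normed_vector) \<Rightarrow> bool" where
  "Ck_on 0 S f \<longleftrightarrow> continuous_on S f"
| "Ck_on (Suc k) S f \<longleftrightarrow> (\<forall>x\<in>S. f differentiable (at x)) \<and>
     (\<forall>v. Ck_on k S (\<lambda>x. frechet_derivative f (at x) v))"

text \<open>On a set that need not be open, such as a relatively open subset of a closed half-space,
  smooth means: locally the restriction of a smooth map on an open set.\<close>

definition smooth_map_on :: "'b::real_normed_vector set \<Rightarrow> ('b \<Rightarrow> 'c::real_normed_vector) \<Rightarrow> bool" where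
  "smooth_map_on S f \<longleftrightarrow> (\<forall>x\<in>S. \<exists>W h. open W \<and> x \<in> W \<and> (\<forall>k. Ck_on k W h) \<and>
     (\<forall>y\<in>S \<inter> W. h y = f y))"


subsection \<open>Riemannian manifolds, possibly with boundary\<close>

text \<open>The underlying space of the manifold is the whole type \<open>'a\<close> (Hausdorff and second countable by
  its type class); the dimension is \<open>CARD('n)\<close>. A chart is a pair of its domain and its
  coordinate map, whose values outside the domain are irrelevant.\<close>

type_synonym ('a, 'n) chart = "'a set \<times> ('a \<Rightarrow> real^'n)"

definition chart_image :: "('a, 'n::finite) chart \<Rightarrow> (real^'n) set" where
  "chart_image c = snd c ` fst c"

definition chart_inv :: "('a, 'n::finite) chart \<Rightarrow> real^'n \<Rightarrow> 'a" where
  "chart_inv c = inv_into (fst c) (snd c)"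

text \<open>A chart maps homeomorphically onto a relatively open subset of a closed coordinate half-space.
  Interior charts are included: their image avoids the bounding hyperplane.\<close>

definition is_chart :: "('a::topological_space, 'n::finite) chart \<Rightarrow> bool" where
  "is_chart c \<longleftrightarrow> open (fst c) \<and>
     (\<exists>i. openin (top_of_set {x. 0 \<le> x $ i}) (chart_image c)) \<and>
     homeomorphism (fst c) (chart_image c) (snd c) (chart_inv c)"

definition overlap :: "('a, 'n::finite) chart \<Rightarrow> ('a, 'n) chart \<Rightarrow> (real^'n) set" where
  "overlap c d = snd c ` (fst c \<inter> fst d)"

definition transition :: "('a, 'n::finite) chart \<Rightarrow> ('a, 'n) chart \<Rightarrow> real^'n \<Rightarrow> real^'n" where
  "transition c d = snd d \<circ> chart_inv c"

definition smooth_atlas :: "('a::topological_space, 'n::finite) chart set \<Rightarrow> bool" where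
  "smooth_atlas A \<longleftrightarrow> (\<forall>c\<in>A. is_chart c) \<and> (\<Union>c\<in>A. fst c) = UNIV \<and>
     (\<forall>c\<in>A. \<forall>d\<in>A. smooth_map_on (overlap c d) (transition c d))"

text \<open>A Riemannian metric is given by its component matrices \<open>g c x = (g\<^sub>i\<^sub>j(x))\<close> in every chart
  \<open>c\<close>, which obey the transformation law of a covariant 2-tensor. At boundary points
  the derivatives are taken within the image of the chart; they are still unique there.\<close>

definition riemannian_metric ::
    "('a::topological_space, 'n::finite) chart set \<Rightarrow> (('a, 'n) chart \<Rightarrow> real^'n \<Rightarrow> real^'n^'n) \<Rightarrow> bool" where
  "riemannian_metric A g \<longleftrightarrow>
     (\<forall>c\<in>A. smooth_map_on (chart_image c) (g c) \<and>
        (\<forall>x\<in>chart_image c. transpose (g c x) = g c x \<and> (\<forall>v. v \<noteq> 0 \<longrightarrow> v \<bullet> (g c x *v v) > 0))) \<and>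
     (\<forall>c\<in>A. \<forall>d\<in>A. \<forall>x\<in>overlap c d.
        let J = matrix (frechet_derivative (transition c d) (at x within overlap c d))
        in g c x = transpose J ** g d (transition c d x) ** J)"

definition riemannian_manifold ::
    "('a::{t2_space, second_countable_topology}, 'n::finite) chart set \<Rightarrow>
     (('a, 'n) chart \<Rightarrow> real^'n \<Rightarrow> real^'n^'n) \<Rightarrow> bool" where
  "riemannian_manifold A g \<longleftrightarrow> smooth_atlas A \<and> riemannian_metric A g"

text \<open>\<open>dv\<^sub>g = sqrt (det (g\<^sub>i\<^sub>j)) dx\<close> in every chart; this determines the Borel measure uniquely.\<close>

definition riemannian_volume ::
    "('a::topological_space, 'n::finite) chart set \<Rightarrow> (('a, 'n) chart \<Rightarrow> real^'n \<Rightarrow> real^'n^'n) \<Rightarrow>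
     'a measure" where
  "riemannian_volume A g = (THE \<nu>. sets \<nu> = sets borel \<and>
     (\<forall>c\<in>A. \<forall>B\<in>sets borel. B \<subseteq> fst c \<longrightarrow>
        emeasure \<nu> B = (\<integral>\<^sup>+x\<in>snd c ` B. ennreal (sqrt (det (g c x))) \<partial>lborel)))"

definition smooth_functions :: "('a, 'n::finite) chart set \<Rightarrow> ('a \<Rightarrow> real) set" where
  "smooth_functions A = {f. \<forall>c\<in>A. smooth_map_on (chart_image c) (f \<circ> chart_inv c)}"

text \<open>\<open>|df|\<^sup>2\<^sub>g = g\<^sup>i\<^sup>j \<partial>\<^sub>i f \<partial>\<^sub>j f\<close>, computed in some chart around \<open>p\<close>; by the
  transformation law the value does not depend on the chart.\<close>

definition partials :: "('a, 'n::finite) chart \<Rightarrow> ('a \<Rightarrow> real) \<Rightarrow> 'a \<Rightarrow> real^'n" where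
  "partials c f p =
     (\<chi> i. frechet_derivative (f \<circ> chart_inv c) (at (snd c p) within chart_image c) (axis i 1))"

definition differential_norm_sq ::
    "('a, 'n::finite) chart set \<Rightarrow> (('a, 'n) chart \<Rightarrow> real^'n \<Rightarrow> real^'n^'n) \<Rightarrow>
     ('a \<Rightarrow> real) \<Rightarrow> 'a \<Rightarrow> real" where
  "differential_norm_sq A g f p =
     (let c = (SOME c. c \<in> A \<and> p \<in> fst c)
      in partials c f p \<bullet> (matrix_inv (g c (snd c p)) *v partials c f p))"


subsection \<open>Radon measures on a compact space\<close>

definition radon_measure :: "'a::topological_space measure \<Rightarrow> bool" where
  "radon_measure \<mu> \<longleftrightarrow> sets \<mu> = sets borel \<and> (\<forall>K. compact K \<longrightarrow> emeasure \<mu> K < \<infinity>) \<and>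
     (\<forall>B\<in>sets borel. emeasure \<mu> B = (SUP K\<in>{K. compact K \<and> K \<in> sets borel \<and> K \<subseteq> B}. emeasure \<mu> K))"

definition continuous_radon_measures :: "'a::topological_space measure set" where
  "continuous_radon_measures = {\<mu>. radon_measure \<mu> \<and> (\<forall>p. emeasure \<mu> {p} = 0)}"

definition weak_star_conv :: "(nat \<Rightarrow> 'a::topological_space measure) \<Rightarrow> 'a measure \<Rightarrow> bool" where
  "weak_star_conv \<mu>s \<mu> \<longleftrightarrow> (\<forall>f :: 'a \<Rightarrow> real. continuous_on UNIV f \<longrightarrow>
     (\<lambda>n. integral\<^sup>L (\<mu>s n) f) \<longlonglongrightarrow> integral\<^sup>L \<mu> f)"


subsection \<open>Variational eigenvalues of a measure\<close>

interpretation real_fun: vector_space "\<lambda>(a::real) (f::'a \<Rightarrow> real) x. a * f x"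
  by unfold_locales (auto simp: fun_eq_iff algebra_simps)

text \<open>The case distinction is needed because \<open>0 / 0 = 0\<close> in \<^typ>\<open>ennreal\<close>.\<close>

definition rayleigh_quotient ::
    "('a::topological_space, 'n::finite) chart set \<Rightarrow> (('a, 'n) chart \<Rightarrow> real^'n \<Rightarrow> real^'n^'n) \<Rightarrow>
     'a measure \<Rightarrow> ('a \<Rightarrow> real) \<Rightarrow> ennreal" where
  "rayleigh_quotient A g \<mu> f =
     (let E = (\<integral>\<^sup>+p. ennreal (differential_norm_sq A g f p) \<partial>riemannian_volume A g);
          N = (\<integral>\<^sup>+p. ennreal ((f p)\<^sup>2) \<partial>\<mu>)
      in if N = 0 then \<infinity> else E / N)"

definition measure_eigenvalue ::
    "('a::topological_space, 'n::finite) chart set \<Rightarrow> (('a, 'n) chart \<Rightarrow> real^'n \<Rightarrow> real^'n^'n) \<Rightarrow>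
     nat \<Rightarrow> 'a measure \<Rightarrow> ennreal" where
  "measure_eigenvalue A g k \<mu> =
     (INF F\<in>{F. real_fun.subspace F \<and> F \<subseteq> smooth_functions A \<and> real_fun.dim F = k + 1}.
        SUP f\<in>F - {0}. rayleigh_quotient A g \<mu> f)"

end

theory Submission
  imports Defs
begin

text \<open>
  Suppose that \<open>\<mu>\<close> has an atom at \<open>p\<close> of mass \<open>m\<close>. By weak* convergence, the atomless measures \<open>\<mu>\<^sub>\<epsilon>\<close> put
  mass at least \<open>m/2\<close> into any given small ball \<open>B(p, R)\<close> when \<open>\<epsilon>\<close> is far enough along the sequence. It
  therefore suffices to show that an atomless measure with mass \<open>m/2\<close> in \<open>B(p, R)\<close> has
  \<open>\<lambda>\<^sub>k < c\<close> as soon as \<open>R\<close> is small, uniformly in the measure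
  (\<open>cutoff_detecting_concentration\<close>). For this one needs \<open>k + 1\<close> functions with disjoint
  supports, each of which sees a fixed fraction of the mass and has small energy: on their span the
  Rayleigh quotient is small (\<open>measure_eigenvalue_le\<close>).

  In dimension \<open>n \<ge> 3\<close> a cutoff at scale \<open>r\<close> costs energy of order \<open>r\<^sup>n\<^sup>-\<^sup>2\<close>, which is at most \<open>R\<close> for all
  \<open>r \<le> R \<le> 1\<close> (\<open>gradient_bound_energy\<close>). Hence the scales of the functions do not matter, and it
  remains to share out the mass among balls. This is done greedily (\<open>select_balls\<close>): take a ball
  of the smallest radius \<open>r = R/2\<^sup>l\<close> for which some ball carries mass \<open>\<delta>\<close>, a fixed small fraction of the
  total mass; such a radius exists because there are no atoms. Since balls of radius \<open>r/2\<close> carry less than \<open>\<delta>\<close>, the ball with radius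
  \<open>4r\<close> carries only a bounded multiple of \<open>\<delta>\<close>; discard it and repeat with the rest of the measure. A bump
  at each ball, cut off near the earlier balls, gives the functions (\<open>test_family_from_balls\<close>).

  The passage between the manifold and its charts rests on two facts. The squared norm of a
  differential may be computed in any chart (\<open>differential_norm_sq_chart\<close>), where at boundary
  points derivatives within a half-space are unique. And the Riemannian volume, which is given by a
  definite description, exists and is unique (\<open>volume_characterization_ex1\<close>), by the change of
  variables formula on overlaps of charts. On a fixed compact set of coordinates, energies are thus
  bounded by a constant times Euclidean ones (\<open>chart_lift_energy\<close>).
\<close>

section \<open>Calculus of C^k maps and a smooth bump function\<close>

lemma Ck_on_subset: "Ck_on k S f \<Longrightarrow> T \<subseteq> S \<Longrightarrow> Ck_on k T f"
  by (induction k arbitrary: f) (auto intro: continuous_on_subset)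

lemma frechet_derivative_eqI: "(f has_derivative f') (at x) \<Longrightarrow> frechet_derivative f (at x) = f'"
  by (metis frechet_derivative_at)

text \<open>The class depends only on the germs of a map at the points of an open set. This is what allows
  derivatives to be computed by rules and then compared with the \<^const>\<open>frechet_derivative\<close> in the
  recursive definition.\<close>

lemma Ck_on_cong:
  assumes "open S" "\<And>x. x \<in> S \<Longrightarrow> f x = g x" "Ck_on k S f"
  shows "Ck_on k S g"
  using assms(2,3)
proof (induction k arbitrary: f g)
  case 0
  then show ?case by (auto cong: continuous_on_cong)
next
  case (Suc k)
  have *: "(g has_derivative frechet_derivative f (at x)) (at x)" if "x \<in> S" for x
  proof (rule has_derivative_transform_within_open[OF _ \<open>open S\<close> that])
    show "(f has_derivative frechet_derivative f (at x)) (at x)"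
      using Suc.prems(2) that frechet_derivative_works by auto
  qed (use Suc in auto)
  have "Ck_on k S (\<lambda>x. frechet_derivative g (at x) v)" for v
    by (rule Suc.IH[of "\<lambda>x. frechet_derivative f (at x) v"])
      (use Suc.prems frechet_derivative_eqI[OF *] in auto)
  then show ?case using * by (auto simp: differentiable_def)
qed

lemma Ck_on_SucI:
  assumes "open S" "\<And>x. x \<in> S \<Longrightarrow> (f has_derivative f' x) (at x)" "\<And>v. Ck_on k S (\<lambda>x. f' x v)"
  shows "Ck_on (Suc k) S f"
proof -
  have "Ck_on k S (\<lambda>x. frechet_derivative f (at x) v)" for v
    by (rule Ck_on_cong[OF assms(1) _ assms(3)[of v]]) (simp add: frechet_derivative_eqI[OF assms(2)])
  then show ?thesis using assms by (auto simp: differentiable_def)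
qed

lemma Ck_on_Suc_derivative:
  assumes "Ck_on (Suc k) S f" "x \<in> S"
  shows "(f has_derivative frechet_derivative f (at x)) (at x)"
  using assms frechet_derivative_works by auto

lemma Ck_on_Suc_imp: "Ck_on (Suc k) S f \<Longrightarrow> Ck_on k S f"
proof (induction k arbitrary: f)
  case 0
  then show ?case
    by (auto intro!: differentiable_imp_continuous_on simp: differentiable_on_def differentiable_at_withinI)
next
  case (Suc k)
  then show ?case by (subst Ck_on.simps) (auto simp del: Ck_on.simps(2) simp: Ck_on.simps(2)[of "Suc k"])
qed

lemma Ck_on_const: "open S \<Longrightarrow> Ck_on k S (\<lambda>x. c)"
proof (induction k arbitrary: c)
  case (Suc k)
  show ?case by (rule Ck_on_SucI[where f'="\<lambda>x v. 0"]) (use Suc in auto)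
qed auto

lemma Ck_on_bounded_linear:
  assumes "open S" "bounded_linear L"
  shows "Ck_on k S L"
proof (cases k)
  case 0 then show ?thesis using assms by (simp add: linear_continuous_on)
next
  case (Suc m)
  show ?thesis unfolding Suc
    by (rule Ck_on_SucI[where f'="\<lambda>x v. L v"])
      (use assms Ck_on_const in \<open>auto intro: bounded_linear_imp_has_derivative\<close>)
qed

lemma Ck_on_bounded_linear_compose:
  assumes "open S" "bounded_linear L" "Ck_on k S f"
  shows "Ck_on k S (\<lambda>x. L (f x))"
  using assms(3)
proof (induction k arbitrary: f)
  case 0 then show ?case using assms(2) by (simp add: bounded_linear.continuous_on)
next
  case (Suc k)
  show ?case
  proof (rule Ck_on_SucI[where f'="\<lambda>x v. L (frechet_derivative f (at x) v)", OF assms(1)])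
    show "((\<lambda>x. L (f x)) has_derivative (\<lambda>v. L (frechet_derivative f (at x) v))) (at x)" if "x \<in> S" for x
      using bounded_linear.has_derivative[OF assms(2) Ck_on_Suc_derivative[OF Suc.prems that]] .
    show "Ck_on k S (\<lambda>x. L (frechet_derivative f (at x) v))" for v
      by (rule Suc.IH) (use Suc.prems in auto)
  qed
qed

lemma Ck_on_add:
  assumes "open S" "Ck_on k S f" "Ck_on k S g"
  shows "Ck_on k S (\<lambda>x. f x + g x)"
  using assms(2,3)
proof (induction k arbitrary: f g)
  case 0 then show ?case by (auto intro: continuous_on_add)
next
  case (Suc k)
  show ?case
    by (rule Ck_on_SucI[where f'="\<lambda>x v. frechet_derivative f (at x) v + frechet_derivative g (at x) v", OF assms(1)])
      (use Suc.prems in \<open>auto intro!: Suc.IH has_derivative_add simp: frechet_derivative_works[symmetric]\<close>)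
qed

lemma Ck_on_mult:
  fixes f g :: "'b::real_normed_vector \<Rightarrow> real"
  assumes "open S" "Ck_on k S f" "Ck_on k S g"
  shows "Ck_on k S (\<lambda>x. f x * g x)"
  using assms(2,3)
proof (induction k arbitrary: f g)
  case 0 then show ?case by (auto intro: continuous_on_mult)
next
  case (Suc k)
  show ?case
  proof (rule Ck_on_SucI[where f'="\<lambda>x v. f x * frechet_derivative g (at x) v + frechet_derivative f (at x) v * g x", OF assms(1)])
    show "((\<lambda>x. f x * g x) has_derivative
          (\<lambda>v. f x * frechet_derivative g (at x) v + frechet_derivative f (at x) v * g x)) (at x)" if "x \<in> S" for x
      by (rule has_derivative_mult) (use that Suc.prems Ck_on_Suc_derivative in blast)+
    show "Ck_on k S (\<lambda>x. f x * frechet_derivative g (at x) v + frechet_derivative f (at x) v * g x)" for v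
      by (intro Ck_on_add assms(1) Suc.IH Ck_on_Suc_imp[OF Suc.prems(1)] Ck_on_Suc_imp[OF Suc.prems(2)])
        (use Suc.prems in auto)
  qed
qed

lemma Ck_on_sum:
  assumes "open S" "finite I" "\<And>i. i \<in> I \<Longrightarrow> Ck_on k S (f i)"
  shows "Ck_on k S (\<lambda>x. \<Sum>i\<in>I. f i x)"
  using assms(2,3) by (induction I) (auto intro: Ck_on_add Ck_on_const assms(1))

lemma Ck_on_prod:
  fixes f :: "'i \<Rightarrow> 'b::real_normed_vector \<Rightarrow> real"
  assumes "open S" "finite I" "\<And>i. i \<in> I \<Longrightarrow> Ck_on k S (f i)"
  shows "Ck_on k S (\<lambda>x. \<Prod>i\<in>I. f i x)"
  using assms(2,3) by (induction I) (auto intro: Ck_on_mult Ck_on_const assms(1))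

text \<open>The chain rule expresses the derivative of the composite as a sum over a basis of products of
  maps of one order of smoothness less, which the induction hypothesis covers, because the outer
  derivative is again composed with the same inner map.\<close>

lemma Ck_on_compose:
  fixes h :: "'b::real_normed_vector \<Rightarrow> 'c::euclidean_space" and f :: "'c \<Rightarrow> real"
  assumes "open S" "Ck_on k S h" "Ck_on k U f" "h ` S \<subseteq> U"
  shows "Ck_on k S (\<lambda>x. f (h x))"
  using assms(2,3)
proof (induction k arbitrary: f)
  case 0 then show ?case using assms(4) by (auto intro: continuous_on_compose2)
next
  case (Suc k)
  let ?f' = "\<lambda>x v. \<Sum>b\<in>Basis. (frechet_derivative h (at x) v \<bullet> b) * frechet_derivative f (at (h x)) b"
  show ?case
  proof (rule Ck_on_SucI[where f'="?f'", OF assms(1)])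
    show "((\<lambda>x. f (h x)) has_derivative ?f' x) (at x)" if "x \<in> S" for x
    proof -
      have h: "(h has_derivative frechet_derivative h (at x)) (at x)"
        using Ck_on_Suc_derivative[OF Suc.prems(1) that] .
      have f: "(f has_derivative frechet_derivative f (at (h x))) (at (h x))"
        by (rule Ck_on_Suc_derivative[OF Suc.prems(2)]) (use that assms(4) in auto)
      interpret linear "frechet_derivative f (at (h x))"
        using f by (rule has_derivative_linear)
      have "?f' x = (\<lambda>v. frechet_derivative f (at (h x)) (frechet_derivative h (at x) v))"
      proof
        fix v
        have "frechet_derivative f (at (h x)) (\<Sum>b\<in>Basis. (frechet_derivative h (at x) v \<bullet> b) *\<^sub>R b) = ?f' x v"
          by (simp add: sum scale)
        then show "?f' x v = frechet_derivative f (at (h x)) (frechet_derivative h (at x) v)"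
          by (simp add: euclidean_representation)
      qed
      then show ?thesis using has_derivative_compose[OF h f] by simp
    qed
    show "Ck_on k S (\<lambda>x. ?f' x v)" for v
    proof (intro Ck_on_sum Ck_on_mult assms(1) finite_Basis)
      fix b :: 'c
      show "Ck_on k S (\<lambda>x. frechet_derivative h (at x) v \<bullet> b)"
        by (rule Ck_on_bounded_linear_compose[OF assms(1) bounded_linear_inner_left]) (use Suc.prems in auto)
      show "Ck_on k S (\<lambda>x. frechet_derivative f (at (h x)) b)"
        by (rule Suc.IH) (use Suc.prems Ck_on_Suc_imp[OF Suc.prems(1)] in auto)
    qed
  qed
qed

text \<open>The derivative of \<open>1/f\<close> is \<open>-f'/f\<^sup>2\<close>, so each derivative costs one order of \<open>f\<close> only.\<close>

lemma Ck_on_inverse: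
  fixes f :: "'b::real_normed_vector \<Rightarrow> real"
  assumes "open S" "Ck_on k S f" "\<And>x. x \<in> S \<Longrightarrow> f x \<noteq> 0"
  shows "Ck_on k S (\<lambda>x. inverse (f x))"
  using assms(2)
proof (induction k)
  case 0 then show ?case using assms(3) by (auto intro: continuous_on_inverse)
next
  case (Suc k)
  let ?f' = "\<lambda>x v. (-1) * (inverse (f x) * frechet_derivative f (at x) v * inverse (f x))"
  show ?case
  proof (rule Ck_on_SucI[where f'="?f'", OF assms(1)])
    show "((\<lambda>x. inverse (f x)) has_derivative ?f' x) (at x)" if "x \<in> S" for x
      using Deriv.has_derivative_inverse[OF _ Ck_on_Suc_derivative[OF Suc.prems that]] assms(3)[OF that] by auto
    show "Ck_on k S (\<lambda>x. ?f' x v)" for v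
      by (intro Ck_on_mult Ck_on_const assms(1) Suc.IH Ck_on_Suc_imp[OF Suc.prems]) (use Suc.prems in auto)
  qed
qed

text \<open>The functions \<open>t\<^sup>-\<^sup>m exp(-1/t)\<close>, extended by zero to \<open>t \<le> 0\<close>. For \<open>m = 0\<close> this is the classical
  smooth function that is flat at the origin; the other exponents make the family closed under
  differentiation.\<close>

definition flat_exp :: "nat \<Rightarrow> real \<Rightarrow> real" where
  "flat_exp m t = (if t > 0 then inverse t ^ m * exp (- inverse t) else 0)"

lemma tendsto_flat_exp: "((\<lambda>t. flat_exp m t) \<longlongrightarrow> 0) (at 0)"
proof -
  have "((\<lambda>x. x ^ m / exp x) \<longlongrightarrow> (0::real)) at_top" by (rule tendsto_power_div_exp_0)
  then have "((\<lambda>t. inverse t ^ m / exp (inverse t)) \<longlongrightarrow> (0::real)) (at_right 0)"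
    by (rule filterlim_compose[OF _ filterlim_inverse_at_top_right])
  then have R: "(flat_exp m \<longlongrightarrow> 0) (at_right 0)"
    by (rule Lim_transform_eventually)
      (auto simp: eventually_at_filter flat_exp_def exp_minus divide_inverse)
  have L: "(flat_exp m \<longlongrightarrow> 0) (at_left 0)"
    by (rule tendsto_eventually) (auto simp: eventually_at_filter flat_exp_def)
  show ?thesis using R L by (simp add: filterlim_split_at)
qed

text \<open>At the origin the difference quotient of the function with exponent \<open>m\<close> is the function with
  exponent \<open>m + 1\<close>, which tends to zero since the exponential beats every power.\<close>

lemma has_derivative_flat_exp:
  "(flat_exp m has_derivative (\<lambda>v. v * (flat_exp (m + 2) t + (- real m) * flat_exp (m + 1) t))) (at t)"
proof -
  consider "t < 0" | "t = 0" | "t > 0" by linarith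
  then have "(flat_exp m has_field_derivative (flat_exp (m + 2) t + (- real m) * flat_exp (m + 1) t)) (at t)"
  proof cases
    case 1
    have "((\<lambda>_. 0::real) has_field_derivative 0) (at t)" by simp
    then have "(flat_exp m has_field_derivative 0) (at t)"
      by (rule has_field_derivative_transform_within_open[of _ _ _ "{..<0}"]) (use 1 in \<open>auto simp: flat_exp_def\<close>)
    then show ?thesis using 1 by (simp add: flat_exp_def)
  next
    case 2
    have "((\<lambda>h. flat_exp m h / h) \<longlongrightarrow> 0) (at 0)"
    proof (rule Lim_transform_eventually[OF tendsto_flat_exp[of "m+1"]])
      show "\<forall>\<^sub>F h in at 0. flat_exp (m + 1) h = flat_exp m h / h"
        by (auto simp: eventually_at_filter flat_exp_def field_simps)
    qed
    then show ?thesis using 2 by (simp add: DERIV_def flat_exp_def)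
  next
    case 3
    have pw: "((\<lambda>t. inverse t ^ m) has_field_derivative (- real m * inverse t ^ (m + 1))) (at t)"
    proof (cases m)
      case (Suc j)
      have "((\<lambda>t. inverse t ^ Suc j) has_field_derivative
          real (Suc j) * (- (inverse t * 1 * inverse t) * inverse t ^ (Suc j - Suc 0))) (at t)"
        by (rule DERIV_power, rule DERIV_inverse'[OF DERIV_ident]) (use 3 in simp)
      then show ?thesis unfolding Suc by (rule DERIV_cong) (simp add: algebra_simps)
    qed simp
    have "((\<lambda>t. exp (- inverse t)) has_field_derivative exp (- inverse t) * (inverse t)\<^sup>2) (at t)"
      using 3 by (auto intro!: derivative_eq_intros simp: power2_eq_square)
    from DERIV_mult[OF pw this]
    have "((\<lambda>t. inverse t ^ m * exp (- inverse t)) has_field_derivative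
        (flat_exp (m + 2) t + (- real m) * flat_exp (m + 1) t)) (at t)"
    proof (rule DERIV_cong)
      have "- real m * u ^ (m + 1) * E + E * u\<^sup>2 * u ^ m = u ^ (m + 2) * E + - real m * (u ^ (m + 1) * E)"
        for u E :: real by (simp add: power_add power2_eq_square)
      then show "- real m * inverse t ^ (m + 1) * exp (- inverse t) + exp (- inverse t) * (inverse t)\<^sup>2 * inverse t ^ m =
          flat_exp (m + 2) t + - real m * flat_exp (m + 1) t"
        unfolding flat_exp_def using 3 by (simp only: if_True)
    qed
    then show ?thesis
      by (rule has_field_derivative_transform_within_open[of _ _ _ "{0<..}"]) (use 3 in \<open>auto simp: flat_exp_def\<close>)
  qed
  then show ?thesis unfolding has_field_derivative_def
    by (rule has_derivative_eq_rhs) (rule ext, rule mult.commute)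
qed

lemma Ck_on_flat_exp: "Ck_on k UNIV (flat_exp m)"
proof (induction k arbitrary: m)
  case 0
  show ?case using has_derivative_flat_exp[THEN has_derivative_continuous]
    by (simp add: continuous_at_imp_continuous_on)
next
  case (Suc k)
  show ?case
    by (rule Ck_on_SucI[OF _ has_derivative_flat_exp])
      (intro Ck_on_mult Ck_on_add Ck_on_const Suc.IH open_UNIV)+
qed

text \<open>With \<open>a = exp(-1/(4 - |x|\<^sup>2)\<^sub>+)\<close> and \<open>b = exp(-1/(|x|\<^sup>2 - 1)\<^sub>+)\<close> the quotient \<open>a / (a + b)\<close> equals 1 on the unit
  ball and 0 outside the ball of radius 2. The gradient is continuous and vanishes off a compact set,
  which gives the constant \<open>L\<close>.\<close>

lemma exists_smooth_bump:
  obtains \<eta> :: "'b::euclidean_space \<Rightarrow> real" and L :: real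
  where "\<And>k. Ck_on k UNIV \<eta>" "\<And>x. 0 \<le> \<eta> x" "\<And>x. \<eta> x \<le> 1"
    "\<And>x. norm x \<le> 1 \<Longrightarrow> \<eta> x = 1" "\<And>x. norm x \<ge> 2 \<Longrightarrow> \<eta> x = 0"
    "0 < L" "\<And>x v. \<bar>frechet_derivative \<eta> (at x) v\<bar> \<le> L * norm v"
    "\<And>x. norm x > 2 \<Longrightarrow> frechet_derivative \<eta> (at x) = (\<lambda>v. 0)"
proof -
  define a :: "'b \<Rightarrow> real" where "a x = flat_exp 0 (4 - x \<bullet> x)" for x
  define b :: "'b \<Rightarrow> real" where "b x = flat_exp 0 (x \<bullet> x - 1)" for x
  define \<eta> where "\<eta> x = a x * inverse (a x + b x)" for x
  have sq: "Ck_on k UNIV (\<lambda>x::'b. x \<bullet> x)" for k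
  proof -
    have "Ck_on k UNIV (\<lambda>x::'b. \<Sum>i\<in>Basis. (x \<bullet> i) * (x \<bullet> i))"
      by (intro Ck_on_sum Ck_on_mult Ck_on_bounded_linear bounded_linear_inner_left) auto
    then show ?thesis by (simp add: euclidean_inner[symmetric])
  qed
  have Ca: "Ck_on k UNIV a" for k
  proof -
    have "Ck_on k UNIV (\<lambda>x::'b. 4 + (-1) * (x \<bullet> x))"
      by (intro Ck_on_add Ck_on_mult Ck_on_const sq) auto
    from Ck_on_compose[OF open_UNIV this Ck_on_flat_exp] show ?thesis by (simp add: a_def[abs_def])
  qed
  have Cb: "Ck_on k UNIV b" for k
  proof -
    have "Ck_on k UNIV (\<lambda>x::'b. (x \<bullet> x) + (-1))"
      by (intro Ck_on_add Ck_on_mult Ck_on_const sq) auto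
    from Ck_on_compose[OF open_UNIV this Ck_on_flat_exp] show ?thesis by (simp add: b_def[abs_def])
  qed
  have nn: "0 \<le> a x" "0 \<le> b x" for x by (auto simp: a_def b_def flat_exp_def)
  have pos: "0 < a x + b x" for x
  proof (cases "x \<bullet> x < 4")
    case True then have "0 < a x" by (auto simp: a_def flat_exp_def)
    then show ?thesis using nn[of x] by linarith
  next
    case False then have "0 < b x" by (auto simp: b_def flat_exp_def)
    then show ?thesis using nn[of x] by linarith
  qed
  have C\<eta>: "Ck_on k UNIV \<eta>" for k
    unfolding \<eta>_def[abs_def]
    by (intro Ck_on_mult Ck_on_inverse Ck_on_add Ca Cb open_UNIV) (use pos in \<open>metis less_irrefl\<close>)
  have zero: "\<eta> x = 0" if "norm x \<ge> 2" for x
  proof -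
    have "x \<bullet> x \<ge> 2^2" unfolding power2_norm_eq_inner[symmetric] using that by (intro power_mono) auto
    then show ?thesis by (auto simp: \<eta>_def a_def flat_exp_def)
  qed
  have one: "\<eta> x = 1" if "norm x \<le> 1" for x
  proof -
    have "x \<bullet> x \<le> 1^2" unfolding power2_norm_eq_inner[symmetric] using that by (intro power_mono) auto
    then have "b x = 0" by (auto simp: b_def flat_exp_def)
    then show ?thesis using pos[of x] by (auto simp: \<eta>_def)
  qed
  have der: "(\<eta> has_derivative frechet_derivative \<eta> (at x)) (at x)" for x
    using Ck_on_Suc_derivative[OF C\<eta>[of "Suc 0"]] by simp
  have far: "frechet_derivative \<eta> (at x) = (\<lambda>v. 0)" if "norm x > 2" for x
  proof (rule frechet_derivative_eqI)
    have "((\<lambda>_. 0::real) has_derivative (\<lambda>v. 0)) (at x)" by simp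
    moreover have "open (- cball (0::'b) 2)" by (simp add: open_Compl)
    ultimately show "(\<eta> has_derivative (\<lambda>v. 0)) (at x)"
      by (rule has_derivative_transform_within_open) (use that zero in auto)
  qed
  have "\<exists>B. \<forall>x\<in>cball (0::'b) 2. \<bar>frechet_derivative \<eta> (at x) i\<bar> \<le> B" for i
  proof -
    have "continuous_on (cball 0 2) (\<lambda>x. frechet_derivative \<eta> (at x) i)"
      by (rule continuous_on_subset[of UNIV]) (use C\<eta>[of "Suc 0"] in auto)
    then have "bounded ((\<lambda>x. frechet_derivative \<eta> (at x) i) ` cball 0 2)"
      by (intro compact_imp_bounded compact_continuous_image) auto
    then show ?thesis by (auto simp: bounded_iff)
  qed
  then obtain B where B: "\<And>i x. x \<in> cball (0::'b) 2 \<Longrightarrow> \<bar>frechet_derivative \<eta> (at x) i\<bar> \<le> B i" by metis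
  define L where "L = (\<Sum>i\<in>(Basis::'b set). \<bar>B i\<bar>) + 1"
  have L: "0 < L" unfolding L_def by (simp add: add_nonneg_pos sum_nonneg)
  have "\<bar>frechet_derivative \<eta> (at x) v\<bar> \<le> L * norm v" for x v
  proof (cases "norm x > 2")
    case True then show ?thesis using far[OF True] L by simp
  next
    case False
    interpret linear "frechet_derivative \<eta> (at x)" using der by (rule has_derivative_linear)
    have "frechet_derivative \<eta> (at x) v = frechet_derivative \<eta> (at x) (\<Sum>i\<in>Basis. (v \<bullet> i) *\<^sub>R i)"
      by (simp add: euclidean_representation)
    also have "\<dots> = (\<Sum>i\<in>Basis. (v \<bullet> i) * frechet_derivative \<eta> (at x) i)" by (simp add: sum scale)
    also have "\<bar>\<dots>\<bar> \<le> (\<Sum>i\<in>Basis. norm v * \<bar>B i\<bar>)"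
    proof (rule order_trans[OF sum_abs sum_mono])
      fix i :: 'b assume i: "i \<in> Basis"
      have "\<bar>v \<bullet> i\<bar> \<le> norm v" using Basis_le_norm[OF i] .
      moreover have "\<bar>frechet_derivative \<eta> (at x) i\<bar> \<le> \<bar>B i\<bar>" using B[of x i] False by auto
      ultimately show "\<bar>v \<bullet> i * frechet_derivative \<eta> (at x) i\<bar> \<le> norm v * \<bar>B i\<bar>"
        unfolding abs_mult by (intro mult_mono) auto
    qed
    also have "\<dots> \<le> L * norm v" by (simp add: L_def sum_distrib_left[symmetric] algebra_simps)
    finally show ?thesis .
  qed
  note bound = this
  show ?thesis
  proof (rule that[of \<eta> L])
    show "0 \<le> \<eta> x" for x using nn[of x] pos[of x] by (auto simp: \<eta>_def)
    show "\<eta> x \<le> 1" for x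
      unfolding \<eta>_def divide_inverse[symmetric] using nn[of x] pos[of x] by simp
    show "Ck_on k UNIV \<eta>" for k by (rule C\<eta>)
    show "norm x \<le> 1 \<Longrightarrow> \<eta> x = 1" "2 \<le> norm x \<Longrightarrow> \<eta> x = 0" for x by (rule one zero; assumption)+
    show "0 < L" by (rule L)
    show "\<bar>frechet_derivative \<eta> (at x) v\<bar> \<le> L * norm v" for x v by (rule bound)
    show "2 < norm x \<Longrightarrow> frechet_derivative \<eta> (at x) = (\<lambda>v. 0)" for x by (rule far)
  qed
qed

section \<open>Change of variables for maps between subsets of coordinate space\<close>

text \<open>A well-ordered copy of a finite index type. Change of variables by the determinant is first obtained
  for coordinates with a well-ordered index type; permuting coordinates carries it over to any finite
  index type.\<close>

typedef ('n::finite) ord_index = "{..<CARD('n)}"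
  by (rule exI[of _ 0]) simp

lemma card_ord_index: "finite (UNIV :: 'n::finite ord_index set)" "CARD('n::finite ord_index) = CARD('n)"
proof -
  interpret type_definition "Rep_ord_index :: 'n ord_index \<Rightarrow> nat" Abs_ord_index "{..<CARD('n)}"
    by (rule type_definition_ord_index)
  show "finite (UNIV :: 'n::finite ord_index set)" unfolding univ by simp
  show "CARD('n::finite ord_index) = CARD('n)" by (simp add: card)
qed

instance ord_index :: (finite) finite
  by standard (rule card_ord_index(1))

instantiation ord_index :: (finite) wellorder
begin

definition less_eq_ord_index :: "'a ord_index \<Rightarrow> 'a ord_index \<Rightarrow> bool" where
  "less_eq_ord_index i j \<longleftrightarrow> Rep_ord_index i \<le> Rep_ord_index j"

definition less_ord_index :: "'a ord_index \<Rightarrow> 'a ord_index \<Rightarrow> bool" where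
  "less_ord_index i j \<longleftrightarrow> Rep_ord_index i < Rep_ord_index j"

instance
proof
  fix i j k :: "'a ord_index"
  show "i < j \<longleftrightarrow> i \<le> j \<and> \<not> j \<le> i" "i \<le> i" "i \<le> j \<or> j \<le> i"
    unfolding less_eq_ord_index_def less_ord_index_def by linarith+
  show "i \<le> k" if "i \<le> j" "j \<le> k"
    using that unfolding less_eq_ord_index_def by linarith
  show "i = j" if "i \<le> j" "j \<le> i"
    using that unfolding less_eq_ord_index_def by (intro Rep_ord_index_inject[THEN iffD1]) linarith
next
  fix P :: "'a ord_index \<Rightarrow> bool" and a
  assume step: "\<And>i. (\<And>j. j < i \<Longrightarrow> P j) \<Longrightarrow> P i"
  show "P a"
  proof (induction "Rep_ord_index a" arbitrary: a rule: less_induct)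
    case less
    show ?case by (rule step, rule less) (simp add: less_ord_index_def)
  qed
qed

end

text \<open>Conjugation by the bijection matches the permutations of the two index sets and preserves signs,
  so the two Leibniz sums agree term by term.\<close>

lemma det_reindex:
  fixes A :: "real^'n::finite^'n" and e :: "'m::finite \<Rightarrow> 'n"
  assumes "bij e"
  shows "det (\<chi> i j. A $ e i $ e j) = det A"
proof -
  let ?c = "map_permutation UNIV e"
  have c: "?c p = e \<circ> p \<circ> inv e" for p
    using assms by (auto simp: map_permutation_def restrict_id_def bij_is_surj fun_eq_iff)
  have inv: "inv e (e i) = i" "e (inv e k) = k" for i k
    using assms by (simp_all add: bij_is_inj bij_is_surj surj_f_inv_f)
  have "bij_betw ?c {p. p permutes UNIV} {p. p permutes UNIV}"
  proof (rule bij_betw_byWitness[where f' = "map_permutation UNIV (inv e)"])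
    have ie: "inv (inv e) = e" using assms by (rule inv_inv_eq)
    have c': "map_permutation UNIV (inv e) q = inv e \<circ> q \<circ> e" for q
      using bij_imp_bij_inv[OF assms] ie by (auto simp: map_permutation_def restrict_id_def bij_is_surj fun_eq_iff)
    show "\<forall>p\<in>{p. p permutes UNIV}. map_permutation UNIV (inv e) (?c p) = p"
      "\<forall>q\<in>{p. p permutes UNIV}. ?c (map_permutation UNIV (inv e) q) = q"
      by (auto simp: c c' inv fun_eq_iff)
    show "?c ` {p. p permutes UNIV} \<subseteq> {p. p permutes UNIV}"
      using map_permutation_permutes[OF assms] by blast
    show "map_permutation UNIV (inv e) ` {p. p permutes UNIV} \<subseteq> {p. p permutes UNIV}"
      using map_permutation_permutes[OF bij_imp_bij_inv[OF assms]] by blast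
  qed
  then have "det A = (\<Sum>p\<in>{p. p permutes UNIV}. of_int (sign (?c p)) * (\<Prod>k\<in>UNIV. A $ k $ ?c p k))"
    unfolding det_def by (rule sum.reindex_bij_betw[symmetric])
  also have "\<dots> = (\<Sum>p\<in>{p. p permutes UNIV}. of_int (sign p) * (\<Prod>i\<in>UNIV. A $ e i $ e (p i)))"
  proof (rule sum.cong[OF refl])
    fix p :: "'m \<Rightarrow> 'm" assume p: "p \<in> {p. p permutes UNIV}"
    have "sign (?c p) = sign p"
      using p assms by (intro sign_map_permutation) (auto simp: bij_is_inj)
    moreover have "(\<Prod>k\<in>UNIV. A $ k $ ?c p k) = (\<Prod>i\<in>UNIV. A $ e i $ e (p i))"
      using prod.reindex_bij_betw[OF assms, of "\<lambda>k. A $ k $ ?c p k"] by (simp add: c inv)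
    ultimately show "of_int (sign (?c p)) * (\<Prod>k\<in>UNIV. A $ k $ ?c p k) =
        of_int (sign p) * (\<Prod>i\<in>UNIV. A $ e i $ e (p i))" by simp
  qed
  also have "\<dots> = det (\<chi> i j. A $ e i $ e j)" by (simp add: det_def)
  finally show ?thesis by simp
qed

definition reindex :: "('m \<Rightarrow> 'n) \<Rightarrow> real^'n::finite \<Rightarrow> real^'m::finite" where
  "reindex e x = (\<chi> i. x $ e i)"

lemma linear_reindex: "linear (reindex e)"
  by (auto simp: reindex_def linear_iff vec_eq_iff)

text \<open>Permuting coordinates maps boxes to boxes with the same side lengths.\<close>

lemma distr_reindex_lborel:
  fixes e :: "'m::finite \<Rightarrow> 'n::finite"
  assumes "bij e"
  shows "distr lborel borel (reindex e) = (lborel :: (real^'m) measure)"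
proof (rule lborel_eqI[symmetric])
  have lin: "bounded_linear (reindex e)" using linear_reindex by (simp add: linear_linear)
  then have m: "reindex e \<in> lborel \<rightarrow>\<^sub>M borel"
    by (simp add: borel_measurable_continuous_onI linear_continuous_on)
  show "sets (distr lborel borel (reindex e)) = sets borel" by simp
  fix l u :: "real^'m" assume le: "\<And>b. b \<in> Basis \<Longrightarrow> l \<bullet> b \<le> u \<bullet> b"
  then have le': "l $ i \<le> u $ i" for i by (simp add: axis_in_Basis_iff cart_eq_inner_axis)
  have inv: "inv e (e i) = i" "e (inv e k) = k" for i k
    using assms by (simp_all add: bij_is_inj bij_is_surj surj_f_inv_f)
  let ?l = "reindex (inv e) l" and ?u = "reindex (inv e) u"
  have "reindex e -` box l u = box ?l ?u"
    by (auto simp: mem_box_cart reindex_def) (metis inv)+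
  then have "emeasure (distr lborel borel (reindex e)) (box l u) = emeasure lborel (box ?l ?u)"
    using m by (simp add: emeasure_distr)
  also have "\<dots> = ennreal (\<Prod>b\<in>Basis. (?u - ?l) \<bullet> b)"
    by (rule emeasure_lborel_box) (auto simp: Basis_vec_def inner_axis reindex_def le')
  also have "(\<Prod>b\<in>Basis. (?u - ?l) \<bullet> b) = (\<Prod>k\<in>UNIV. (u - l) $ inv e k)"
    by (simp add: Basis_vec_def prod.UNION_disjoint[OF _ _ ] axis_eq_axis inner_axis reindex_def UNION_singleton_eq_range prod.reindex inj_on_def)
  also have "\<dots> = (\<Prod>i\<in>UNIV. (u - l) $ i)"
    using prod.reindex_bij_betw[OF bij_imp_bij_inv[OF assms], of "\<lambda>i. (u - l) $ i"] by simp
  also have "\<dots> = (\<Prod>b\<in>Basis. (u - l) \<bullet> b)"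
    by (simp add: Basis_vec_def axis_eq_axis inner_axis UNION_singleton_eq_range prod.reindex inj_on_def)
  finally show "emeasure (distr lborel borel (reindex e)) (box l u) = (\<Prod>b\<in>Basis. (u - l) \<bullet> b)" .
qed

text \<open>For images of finite measure this is the change of variables formula for Henstock-Kurzweil integrals.
  The measurable function \<open>w\<close> that represents the Jacobian on \<open>S\<close> makes both sides infinite together
  in the remaining case.\<close>

lemma emeasure_injective_image_wellorder:
  fixes f :: "real^'n::{finite,wellorder} \<Rightarrow> real^'n::_"
  assumes S: "S \<in> sets borel" and fS: "f ` S \<in> sets borel" and inj: "inj_on f S"
    and der: "\<And>x. x \<in> S \<Longrightarrow> (f has_derivative f' x) (at x within S)"
    and w: "w \<in> borel_measurable borel"
    and det: "\<And>x. x \<in> S \<Longrightarrow> \<bar>det (matrix (f' x))\<bar> = w x"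
  shows "emeasure lborel (f ` S) = (\<integral>\<^sup>+x\<in>S. ennreal (w x) \<partial>lborel)"
proof -
  let ?h = "\<lambda>x. indicator S x * w x"
  have SL: "S \<in> sets lebesgue" using S by simp
  have hi: "((\<lambda>x. \<bar>det (matrix (f' x))\<bar>) has_integral m) S \<longleftrightarrow> (?h has_integral m) UNIV" for m
  proof -
    have "((\<lambda>x. \<bar>det (matrix (f' x))\<bar>) has_integral m) S \<longleftrightarrow> (w has_integral m) S"
      by (intro has_integral_cong det)
    also have "\<dots> \<longleftrightarrow> ((\<lambda>x. if x \<in> S then w x else 0) has_integral m) UNIV"
      by (rule has_integral_restrict_UNIV[symmetric])
    also have "(\<lambda>x. if x \<in> S then w x else 0) = ?h" by (auto simp: fun_eq_iff)
    finally show ?thesis .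
  qed
  have hm: "?h \<in> borel_measurable borel" using S w by measurable
  have h0: "0 \<le> ?h x" for x using det[of x] by (cases "x \<in> S") (auto simp: indicator_def)
  have eq: "(\<integral>\<^sup>+x\<in>S. ennreal (w x) \<partial>lborel) = (\<integral>\<^sup>+x. ennreal (?h x) \<partial>lborel)"
    by (rule nn_integral_cong) (auto simp: indicator_def)
  show ?thesis
  proof (cases "f ` S \<in> lmeasurable")
    case True
    then have "(?h has_integral measure lebesgue (f ` S)) UNIV"
      using has_measure_differentiable_image[OF SL der inj] hi by blast
    then have "(\<integral>\<^sup>+x. ennreal (?h x) \<partial>lborel) = ennreal (measure lebesgue (f ` S))"
      by (rule nn_integral_has_integral_lborel[OF hm h0])
    also have "\<dots> = emeasure lebesgue (f ` S)"
      by (rule emeasure_eq_measure2[OF True, symmetric])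
    finally show ?thesis using eq fS by simp
  next
    case False
    have "emeasure lborel (f ` S) = \<infinity>"
      using False fS by (simp add: fmeasurable_def) (metis top.not_eq_extremum)
    moreover have "(\<integral>\<^sup>+x. ennreal (?h x) \<partial>lborel) = \<infinity>"
    proof (rule ccontr)
      assume "(\<integral>\<^sup>+x. ennreal (?h x) \<partial>lborel) \<noteq> \<infinity>"
      then have "integrable lborel ?h"
        using hm h0 by (intro integrableI_nonneg) (auto simp: less_top)
      then have "(?h has_integral (integral\<^sup>L lborel ?h)) UNIV" by (rule has_integral_integral_lborel)
      then show False
        using has_measure_differentiable_image[OF SL der inj] hi False by blast
    qed
    ultimately show ?thesis by (simp only: eq)
  qed
qed

text \<open>The previous formula, conjugated with a permutation of coordinates, which changes neither volumes
  nor the determinant.\<close>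

lemma emeasure_injective_image:
  fixes f :: "real^'n::finite \<Rightarrow> real^'n::_"
  assumes S: "S \<in> sets borel" and fS: "f ` S \<in> sets borel" and inj: "inj_on f S"
    and der: "\<And>x. x \<in> S \<Longrightarrow> (f has_derivative f' x) (at x within S)"
    and w: "w \<in> borel_measurable borel"
    and det: "\<And>x. x \<in> S \<Longrightarrow> \<bar>det (matrix (f' x))\<bar> = w x"
  shows "emeasure lborel (f ` S) = (\<integral>\<^sup>+x\<in>S. ennreal (w x) \<partial>lborel)"
proof -
  obtain e :: "'n ord_index \<Rightarrow> 'n" where e: "bij e"
    using finite_same_card_bij[of "UNIV :: 'n ord_index set" "UNIV :: 'n set"] card_ord_index(2) by auto
  have inv: "inv e (e i) = i" "e (inv e k) = k" for i k
    using e by (simp_all add: bij_is_inj bij_is_surj surj_f_inv_f)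
  have e': "bij (inv e)" using e by (rule bij_imp_bij_inv)
  let ?P = "reindex e :: real^'n \<Rightarrow> real^'n ord_index" and ?Q = "reindex (inv e) :: real^'n ord_index \<Rightarrow> real^'n"
  have QP: "?Q (?P x) = x" and PQ: "?P (?Q y) = y" for x y
    by (auto simp: reindex_def inv vec_eq_iff)
  have bl: "bounded_linear ?P" "bounded_linear ?Q" using linear_reindex by (auto simp: linear_linear)
  have Pm: "?P \<in> borel \<rightarrow>\<^sub>M borel" and Qm: "?Q \<in> borel \<rightarrow>\<^sub>M borel"
    using bl by (simp_all add: borel_measurable_continuous_onI linear_continuous_on)
  have PB: "?P ` B = ?Q -` B" for B
  proof safe
    fix y assume "?Q y \<in> B" then have "?P (?Q y) \<in> ?P ` B" by blast
    then show "y \<in> ?P ` B" by (simp add: PQ)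
  qed (simp add: QP)
  have Pb: "?P ` B \<in> sets borel" if "B \<in> sets borel" for B
    unfolding PB using measurable_sets[OF Qm that] by simp
  have PS: "emeasure lborel (?P ` B) = emeasure lborel B" if "B \<in> sets borel" for B
  proof -
    have "emeasure lborel B = emeasure (distr lborel borel ?Q) B" using distr_reindex_lborel[OF e'] by simp
    then show ?thesis using that Qm by (simp add: emeasure_distr PB)
  qed
  let ?f = "\<lambda>y. ?P (f (?Q y))" and ?f' = "\<lambda>y v. ?P (f' (?Q y) (?Q v))"
  have im: "?f ` (?P ` S) = ?P ` (f ` S)" by (simp add: image_image QP)
  have "emeasure lborel (f ` S) = emeasure lborel (?f ` (?P ` S))" using PS[OF fS] im by simp
  also have "\<dots> = (\<integral>\<^sup>+y\<in>?P ` S. ennreal (w (?Q y)) \<partial>lborel)"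
  proof (rule emeasure_injective_image_wellorder[where f' = ?f'])
    show "?P ` S \<in> sets borel" "?f ` (?P ` S) \<in> sets borel" unfolding im using Pb S fS by auto
    show "inj_on ?f (?P ` S)"
    proof (rule inj_onI)
      fix y z assume *: "y \<in> ?P ` S" "z \<in> ?P ` S" "?f y = ?f z"
      then have "?Q (?f y) = ?Q (?f z)" by simp
      then have "f (?Q y) = f (?Q z)" by (simp only: QP)
      moreover have "?Q y \<in> S" "?Q z \<in> S" using *(1,2) unfolding PB by simp_all
      ultimately have "?Q y = ?Q z" using inj by (blast dest: inj_onD)
      then have "?P (?Q y) = ?P (?Q z)" by simp
      then show "y = z" by (simp only: PQ)
    qed
    show "(\<lambda>y. w (?Q y)) \<in> borel_measurable borel" using w Qm by measurable
    fix y assume y: "y \<in> ?P ` S"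
    then have Qy: "?Q y \<in> S" by (auto simp: QP)
    have "((\<lambda>y. f (?Q y)) has_derivative (\<lambda>v. f' (?Q y) (?Q v))) (at y within ?P ` S)"
    proof (rule has_derivative_in_compose2[where g'=f' and t=S])
      show "(f has_derivative f' x) (at x within S)" if "x \<in> S" for x using der that .
      show "(?Q has_derivative ?Q) (at y within ?P ` S)" by (rule bounded_linear_imp_has_derivative[OF bl(2)])
    qed (use y in \<open>auto simp: QP\<close>)
    then show "(?f has_derivative ?f' y) (at y within ?P ` S)"
      by (rule bounded_linear.has_derivative[OF bl(1)])
    have "matrix (?f' y) = (\<chi> i j. matrix (f' (?Q y)) $ e i $ e j)"
    proof -
      have "?Q (axis j 1) = axis (e j) 1" for j
        by (auto simp: reindex_def axis_def vec_eq_iff inv)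
      then show ?thesis by (simp add: matrix_def reindex_def vec_eq_iff)
    qed
    then show "\<bar>det (matrix (?f' y))\<bar> = w (?Q y)" using det[OF Qy] det_reindex[OF e] by simp
  qed
  also have "\<dots> = (\<integral>\<^sup>+y. ennreal (w (?Q y)) * indicator S (?Q y) \<partial>lborel)"
    by (rule nn_integral_cong) (simp add: PB indicator_def)
  also have "\<dots> = (\<integral>\<^sup>+x. ennreal (w x) * indicator S x \<partial>distr lborel borel ?Q)"
    using S w Qm by (subst nn_integral_distr) auto
  finally show ?thesis using distr_reindex_lborel[OF e'] by simp
qed

section \<open>Charts and the norm of a differential\<close>

text \<open>The possible images of charts of a manifold with boundary, and of the overlaps of such charts.\<close>

definition half_space_open :: "(real^'n::finite) set \<Rightarrow> bool" where
  "half_space_open S \<longleftrightarrow> (\<exists>i. openin (top_of_set {x. 0 \<le> x $ i}) S)"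

lemma half_space_open_imp_borel:
  fixes S :: "(real^'n::finite) set"
  assumes "half_space_open S"
  shows "S \<in> sets borel"
proof -
  obtain i U where U: "open U" "S = {x. 0 \<le> x $ i} \<inter> U"
    using assms unfolding half_space_open_def openin_open by blast
  have "closed {x::real^'n. 0 \<le> x $ i}" by (intro closed_Collect_le continuous_intros)
  then show ?thesis using U by auto
qed

lemma half_space_open_openin:
  "half_space_open S \<Longrightarrow> openin (top_of_set S) T \<Longrightarrow> half_space_open T"
  unfolding half_space_open_def using openin_trans by blast

text \<open>Also at a boundary point one can move a little in every positive coordinate direction without
  leaving the set, and those directions determine a linear map.\<close>

lemma has_derivative_unique_half_space:
  fixes f :: "real^'n::finite \<Rightarrow> 'b::real_normed_vector"
  assumes S: "half_space_open S" "x \<in> S"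
    and f: "(f has_derivative f') (at x within S)" "(f has_derivative f'') (at x within S)"
  shows "f' = f''"
proof (rule frechet_derivative_unique_within[OF f])
  fix b :: "real^'n" and e :: real assume b: "b \<in> Basis" and e: "0 < e"
  obtain i U where U: "open U" "S = {x. 0 \<le> x $ i} \<inter> U"
    using S(1) unfolding half_space_open_def openin_open by blast
  obtain \<delta> where \<delta>: "0 < \<delta>" "ball x \<delta> \<subseteq> U"
    using U S(2) open_contains_ball by blast
  define d where "d = min e \<delta> / 2"
  have d: "0 < d" "d < e" "d < \<delta>" using e \<delta> by (auto simp: d_def)
  have "x + d *\<^sub>R b \<in> ball x \<delta>" using b d by (simp add: dist_norm)
  moreover have "0 \<le> (x + d *\<^sub>R b) $ i"
  proof -
    have "0 \<le> b $ i" using b by (auto simp: Basis_vec_def axis_def)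
    then show ?thesis using S(2) U(2) d by simp
  qed
  ultimately show "\<exists>d. 0 < \<bar>d\<bar> \<and> \<bar>d\<bar> < e \<and> x + d *\<^sub>R b \<in> S"
    using d \<delta>(2) U(2) by (intro exI[of _ d]) auto
qed

lemma frechet_derivative_half_space:
  fixes f :: "real^'n::finite \<Rightarrow> 'b::real_normed_vector"
  assumes S: "half_space_open S" "x \<in> S" and f: "(f has_derivative f') (at x within S)"
  shows "frechet_derivative f (at x within S) = f'"
  by (rule has_derivative_unique_half_space[OF S _ f])
    (use f frechet_derivative_works differentiable_def in blast)

lemma smooth_map_on_differentiable:
  assumes "smooth_map_on S f" "x \<in> S"
  shows "f differentiable (at x within S)"
proof -
  obtain W h where W: "open W" "x \<in> W" "\<And>k. Ck_on k W h" "\<And>y. y \<in> S \<inter> W \<Longrightarrow> h y = f y"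
    using assms unfolding smooth_map_on_def by metis
  obtain d where d: "0 < d" "ball x d \<subseteq> W" using W(1,2) open_contains_ball by blast
  have "(h has_derivative frechet_derivative h (at x)) (at x within S)"
    using Ck_on_Suc_derivative[OF W(3) W(2)] by (rule has_derivative_at_withinI)
  then have "(f has_derivative frechet_derivative h (at x)) (at x within S)"
    by (rule has_derivative_transform_within[OF _ d(1) assms(2)])
      (use d(2) in \<open>auto intro!: W(4) simp: dist_commute\<close>)
  then show ?thesis by (auto simp: differentiable_def)
qed

lemma smooth_map_on_continuous: "smooth_map_on S f \<Longrightarrow> continuous_on S f"
  by (meson differentiable_imp_continuous_within continuous_on_eq_continuous_within smooth_map_on_differentiable)

lemma chart_homeomorphism:
  assumes "is_chart c"
  shows "open (fst c)" "continuous_on (fst c) (snd c)" "continuous_on (chart_image c) (chart_inv c)"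
    "\<And>p. p \<in> fst c \<Longrightarrow> chart_inv c (snd c p) = p"
    "\<And>x. x \<in> chart_image c \<Longrightarrow> snd c (chart_inv c x) = x"
    "\<And>x. x \<in> chart_image c \<Longrightarrow> chart_inv c x \<in> fst c"
    "\<And>p. p \<in> fst c \<Longrightarrow> snd c p \<in> chart_image c"
    "inj_on (snd c) (fst c)"
proof -
  have h: "homeomorphism (fst c) (chart_image c) (snd c) (chart_inv c)" and "open (fst c)"
    using assms by (auto simp: is_chart_def)
  then show "open (fst c)" "continuous_on (fst c) (snd c)" "continuous_on (chart_image c) (chart_inv c)"
    "\<And>p. p \<in> fst c \<Longrightarrow> chart_inv c (snd c p) = p"
    "\<And>x. x \<in> chart_image c \<Longrightarrow> snd c (chart_inv c x) = x"
    "\<And>x. x \<in> chart_image c \<Longrightarrow> chart_inv c x \<in> fst c"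
    "\<And>p. p \<in> fst c \<Longrightarrow> snd c p \<in> chart_image c"
    by (auto simp: homeomorphism_def chart_image_def)
  then show "inj_on (snd c) (fst c)" by (metis inj_onI)
qed

lemma chart_image_half_space_open: "is_chart c \<Longrightarrow> half_space_open (chart_image c)"
  by (simp add: is_chart_def half_space_open_def)

lemma chart_openin:
  assumes "is_chart c" "open U" "U \<subseteq> fst c"
  shows "openin (top_of_set (chart_image c)) (snd c ` U)"
  by (rule homeomorphism_imp_open_map[of "fst c" _ _ "chart_inv c"])
    (use assms in \<open>auto simp: is_chart_def open_subset\<close>)

lemma overlap_openin:
  assumes "is_chart c" "is_chart d"
  shows "openin (top_of_set (chart_image c)) (overlap c d)"
  unfolding overlap_def
  by (rule chart_openin[OF assms(1)])
    (auto intro: open_Int chart_homeomorphism(1)[OF assms(1)] chart_homeomorphism(1)[OF assms(2)])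

lemma overlap_half_space_open:
  assumes "is_chart c" "is_chart d"
  shows "half_space_open (overlap c d)"
  using half_space_open_openin[OF chart_image_half_space_open overlap_openin] assms by blast

lemma overlap_subset: "overlap c d \<subseteq> chart_image c"
  by (auto simp: overlap_def chart_image_def)

lemma mem_overlap_iff:
  assumes "is_chart c"
  shows "x \<in> overlap c d \<longleftrightarrow> x \<in> chart_image c \<and> chart_inv c x \<in> fst d"
  using chart_homeomorphism[OF assms] by (auto simp: overlap_def chart_image_def)

text \<open>Transplantation of a function on coordinate space to the manifold, by zero outside the chart.\<close>

definition chart_lift :: "('a, 'n::finite) chart \<Rightarrow> (real^'n \<Rightarrow> real) \<Rightarrow> 'a \<Rightarrow> real" where
  "chart_lift c f p = (if p \<in> fst c then f (snd c p) else 0)"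

lemma chart_lift_eq_0:
  assumes "is_chart c" "\<And>x. x \<notin> K \<Longrightarrow> f x = 0" "q \<notin> chart_inv c ` (K \<inter> chart_image c)"
  shows "chart_lift c f q = 0"
proof (cases "q \<in> fst c \<and> snd c q \<in> K")
  case True
  then have "chart_inv c (snd c q) \<in> chart_inv c ` (K \<inter> chart_image c)"
    using chart_homeomorphism(7)[OF assms(1)] by blast
  then show ?thesis using assms(3) True chart_homeomorphism(4)[OF assms(1)] by simp
qed (use assms(2) in \<open>auto simp: chart_lift_def\<close>)

text \<open>The set of points of the chart with coordinates in \<open>K\<close> is compact, hence closed in the Hausdorff
  space. Seen in another chart, the lifted function is the given one composed with a transition map
  near points of the first chart, and it vanishes near all other points since these lie off that
  closed set.\<close>

lemma chart_lift_smooth: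
  fixes A :: "('a::t2_space, 'n::finite) chart set"
  assumes A: "smooth_atlas A" and c: "c \<in> A" and f: "\<And>k. Ck_on k UNIV f"
    and K: "compact (K \<inter> chart_image c)" "\<And>x. x \<notin> K \<Longrightarrow> f x = 0"
  shows "chart_lift c f \<in> smooth_functions A"
  unfolding smooth_functions_def smooth_map_on_def
proof safe
  fix d x assume d: "d \<in> A" and x: "x \<in> chart_image d"
  have chc: "is_chart c" and chd: "is_chart d" using A c d by (auto simp: smooth_atlas_def)
  note hc = chart_homeomorphism[OF chc] and hd = chart_homeomorphism[OF chd]
  let ?C = "chart_inv c ` (K \<inter> chart_image c)"
  have "compact ?C"
    by (rule compact_continuous_image[OF _ K(1)]) (rule continuous_on_subset[OF hc(3)], simp)
  then have C: "closed ?C" by (rule compact_imp_closed)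
  show "\<exists>W h. open W \<and> x \<in> W \<and> (\<forall>k. Ck_on k W h) \<and>
      (\<forall>y\<in>chart_image d \<inter> W. h y = (chart_lift c f \<circ> chart_inv d) y)"
  proof (cases "chart_inv d x \<in> fst c")
    case True
    then have xo: "x \<in> overlap d c" using mem_overlap_iff[OF chd] x by blast
    obtain W h where W: "open W" "x \<in> W" "\<And>k. Ck_on k W h"
        "\<And>y. y \<in> overlap d c \<inter> W \<Longrightarrow> h y = transition d c y"
      using A c d xo unfolding smooth_atlas_def smooth_map_on_def by metis
    obtain V where V: "open V" "overlap d c = chart_image d \<inter> V"
      using overlap_openin[OF chd chc] unfolding openin_open by blast
    show ?thesis
    proof (intro exI[of _ "W \<inter> V"] exI[of _ "\<lambda>y. f (h y)"] conjI allI ballI)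
      show "Ck_on k (W \<inter> V) (\<lambda>y. f (h y))" for k
        by (rule Ck_on_compose[OF _ _ f]) (use W V in \<open>auto intro: Ck_on_subset\<close>)
      fix y assume y: "y \<in> chart_image d \<inter> (W \<inter> V)"
      then have "y \<in> overlap d c" using V by auto
      then show "f (h y) = (chart_lift c f \<circ> chart_inv d) y"
        using W(4)[of y] y mem_overlap_iff[OF chd] by (auto simp: chart_lift_def transition_def)
    qed (use W V x xo in auto)
  next
    case False
    have "chart_inv d x \<in> fst d - ?C" using False hd(6)[OF x] hc(6) by auto
    moreover have "open (fst d - ?C)" using hd(1) C by (rule open_Diff)
    then have "openin (top_of_set (chart_image d)) (snd d ` (fst d - ?C))"
      using chart_openin[OF chd] by auto
    then obtain V where V: "open V" "snd d ` (fst d - ?C) = chart_image d \<inter> V"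
      unfolding openin_open by blast
    ultimately have xV: "x \<in> V" using hd(5)[OF x] by (metis IntD2 imageI)
    show ?thesis
    proof (intro exI[of _ V] exI[of _ "\<lambda>y. 0"] conjI allI ballI)
      fix y assume y: "y \<in> chart_image d \<inter> V"
      then obtain q where q: "q \<in> fst d - ?C" "y = snd d q" using V(2) by blast
      then have "chart_lift c f q = 0" using chart_lift_eq_0[of c K f q] chc K(2) by blast
      then show "0 = (chart_lift c f \<circ> chart_inv d) y" using q hd(4) by simp
    qed (use V xV Ck_on_const in auto)
  qed
qed

text \<open>The vector of partial derivatives represents the differential; uniqueness of derivatives on the
  chart image is what makes the choice made by \<^const>\<open>frechet_derivative\<close> harmless.\<close>

lemma partials_inner:
  assumes "is_chart c" "p \<in> fst c"
    and D: "(f \<circ> chart_inv c has_derivative D) (at (snd c p) within chart_image c)"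
  shows "partials c f p \<bullet> v = D v"
proof -
  interpret D: linear D using D by (rule has_derivative_linear)
  have eq: "frechet_derivative (f \<circ> chart_inv c) (at (snd c p) within chart_image c) = D"
    by (rule frechet_derivative_half_space[OF chart_image_half_space_open _ D])
      (use assms chart_homeomorphism(7)[OF assms(1)] in auto)
  have "D v = D (\<Sum>i\<in>UNIV. (v $ i) *\<^sub>R axis i 1)"
    by (simp add: basis_expansion[of v, unfolded scalar_mult_eq_scaleR])
  also have "\<dots> = (\<Sum>i\<in>UNIV. v $ i * D (axis i 1))" by (simp add: D.sum D.scale)
  finally show ?thesis by (simp add: partials_def eq inner_vec_def mult.commute)
qed

lemma positive_definite_invertible:
  fixes G :: "real^'n::finite^'n"
  assumes "\<And>v. v \<noteq> 0 \<Longrightarrow> v \<bullet> (G *v v) > 0"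
  shows "invertible G"
proof -
  have "x = 0" if "G *v x = 0" for x using assms[of x] that by (cases "x = 0") auto
  then show ?thesis unfolding invertible_left_inverse matrix_left_invertible_ker by blast
qed

lemma matrix_inv_mult:
  assumes "invertible G"
  shows "G *v (matrix_inv G *v p) = (p :: real^'n::finite)"
proof -
  have "\<exists>B. G ** B = mat 1 \<and> B ** G = mat 1" using assms by (simp add: invertible_def)
  then have "G ** matrix_inv G = mat 1" unfolding matrix_inv_def by (rule someI2_ex) simp
  then show ?thesis by (simp add: matrix_vector_mul_assoc)
qed

lemma invertible_mult_cancel: "invertible (G :: real^'n::finite^'n) \<Longrightarrow> G *v x = G *v y \<Longrightarrow> x = y"
  by (metis invertible_def matrix_vector_mul_assoc matrix_vector_mul_lid)

text \<open>A covector transforms by \<open>J\<^sup>T\<close> and the metric by \<open>J\<^sup>T G J\<close>, so the vectors dual to the covector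
  correspond under \<open>J\<close> and the pairing is the same.\<close>

lemma dual_norm_transform:
  fixes J Gc Gd :: "real^'n::finite^'n"
  assumes G: "Gc = transpose J ** Gd ** J" and inv: "invertible Gc" "invertible Gd"
    and p: "\<And>v. pc \<bullet> v = pd \<bullet> (J *v v)"
  shows "pc \<bullet> (matrix_inv Gc *v pc) = pd \<bullet> (matrix_inv Gd *v pd)"
proof -
  have "x = 0" if "J *v x = 0" for x
  proof -
    have "Gc *v x = 0" unfolding G by (simp add: matrix_vector_mul_assoc[symmetric] that)
    then show ?thesis using invertible_mult_cancel[OF inv(1), of x 0] by simp
  qed
  then have J: "invertible J" unfolding invertible_left_inverse matrix_left_invertible_ker by blast
  then have Jt: "invertible (transpose J)" by (rule transpose_invertible)
  define w where "w = matrix_inv Gc *v pc"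
  have pc: "pc = transpose J *v pd"
  proof (rule vector_eq_rdot[THEN iffD1], rule allI)
    fix z show "pc \<bullet> z = (transpose J *v pd) \<bullet> z"
      by (simp add: p dot_lmul_matrix[symmetric] vector_transpose_matrix inner_commute)
  qed
  have "transpose J *v (Gd *v (J *v w)) = transpose J *v pd"
  proof -
    have "transpose J *v (Gd *v (J *v w)) = Gc *v w"
      unfolding G by (simp only: matrix_vector_mul_assoc matrix_mul_assoc)
    also have "\<dots> = pc" unfolding w_def by (rule matrix_inv_mult[OF inv(1)])
    finally show ?thesis using pc by (simp only:)
  qed
  then have "Gd *v (J *v w) = pd" by (rule invertible_mult_cancel[OF Jt])
  then have "J *v w = matrix_inv Gd *v pd"
    using invertible_mult_cancel[OF inv(2)] matrix_inv_mult[OF inv(2)] by metis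
  then show ?thesis using p[of w] by (simp add: w_def)
qed

lemma transition_has_derivative:
  assumes "smooth_atlas A" "c \<in> A" "d \<in> A" "x \<in> overlap c d"
  shows "(transition c d has_derivative
      (\<lambda>v. matrix (frechet_derivative (transition c d) (at x within overlap c d)) *v v)) (at x within overlap c d)"
proof -
  have "transition c d differentiable (at x within overlap c d)"
    using assms by (intro smooth_map_on_differentiable) (auto simp: smooth_atlas_def)
  then have h: "(transition c d has_derivative frechet_derivative (transition c d) (at x within overlap c d))
      (at x within overlap c d)"
    by (simp add: frechet_derivative_works)
  then have "linear (frechet_derivative (transition c d) (at x within overlap c d))"
    by (rule has_derivative_linear)
  with h show ?thesis by (simp add: matrix_works linear_matrix_vector_mul_eq[symmetric])
qed

text \<open>The definition of \<open>|df|\<^sup>2\<close> picks an unspecified chart at every point; the transformation law shows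
  that any chart of the atlas may be used instead.\<close>

lemma differential_norm_sq_chart:
  fixes A :: "('a::t2_space, 'n::finite) chart set"
  assumes A: "smooth_atlas A" and g: "riemannian_metric A g" and f: "f \<in> smooth_functions A"
    and c: "c \<in> A" "p \<in> fst c"
  shows "differential_norm_sq A g f p =
    partials c f p \<bullet> (matrix_inv (g c (snd c p)) *v partials c f p)"
proof -
  define d where "d = (SOME c. c \<in> A \<and> p \<in> fst c)"
  have "d \<in> A \<and> p \<in> fst d" unfolding d_def by (rule someI[of _ c]) (use c in auto)
  then have d: "d \<in> A" "p \<in> fst d" by auto
  have chc: "is_chart c" and chd: "is_chart d" using A c d by (auto simp: smooth_atlas_def)
  note hc = chart_homeomorphism[OF chc] and hd = chart_homeomorphism[OF chd]
  let ?x = "snd c p" let ?y = "snd d p" let ?O = "overlap c d"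
  let ?J = "matrix (frechet_derivative (transition c d) (at ?x within ?O))"
  have xO: "?x \<in> ?O" using c d by (auto simp: overlap_def)
  have T: "transition c d ?x = ?y" using hc(4)[OF c(2)] by (simp add: transition_def)
  have G: "g c ?x = transpose ?J ** g d ?y ** ?J"
    using g c d xO T unfolding riemannian_metric_def Let_def by metis
  have inv: "invertible (g c ?x)" "invertible (g d ?y)"
    using g c d hc(7) hd(7) by (auto intro!: positive_definite_invertible simp: riemannian_metric_def)
  have der: "\<exists>D. (f \<circ> chart_inv e has_derivative D) (at (snd e p) within chart_image e)"
    if "e \<in> A" "p \<in> fst e" for e
  proof -
    have "smooth_map_on (chart_image e) (f \<circ> chart_inv e)" using f that by (auto simp: smooth_functions_def)
    then show ?thesis
      using smooth_map_on_differentiable that by (fastforce simp: chart_image_def differentiable_def)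
  qed
  obtain Dc where Dc: "(f \<circ> chart_inv c has_derivative Dc) (at ?x within chart_image c)" using der c by blast
  obtain Dd where Dd: "(f \<circ> chart_inv d has_derivative Dd) (at ?y within chart_image d)" using der d by blast
  have "(f \<circ> chart_inv c has_derivative Dc) (at ?x within ?O)"
    using Dc overlap_subset by (rule has_derivative_subset)
  moreover have "((f \<circ> chart_inv d) \<circ> transition c d has_derivative (\<lambda>v. Dd (?J *v v))) (at ?x within ?O)"
  proof -
    have "transition c d ` ?O \<subseteq> chart_image d"
      using hc hd by (auto simp: overlap_def transition_def)
    then have "(f \<circ> chart_inv d has_derivative Dd) (at (transition c d ?x) within transition c d ` ?O)"
      using Dd T has_derivative_subset by metis
    from has_derivative_in_compose[OF transition_has_derivative[OF A c(1) d(1) xO] this]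
    show ?thesis by (simp add: o_def)
  qed
  then have "(f \<circ> chart_inv c has_derivative (\<lambda>v. Dd (?J *v v))) (at ?x within ?O)"
    by (rule has_derivative_transform[OF xO, rotated])
      (use hc hd in \<open>auto simp: overlap_def transition_def\<close>)
  ultimately have "Dc = (\<lambda>v. Dd (?J *v v))"
    by (rule has_derivative_unique_half_space[OF overlap_half_space_open[OF chc chd] xO])
  then have "partials c f p \<bullet> v = partials d f p \<bullet> (?J *v v)" for v
    using partials_inner[OF chc c(2) Dc] partials_inner[OF chd d(2) Dd] by simp
  from dual_norm_transform[OF G inv this]
  show ?thesis by (simp add: differential_norm_sq_def Let_def d_def[symmetric])
qed

lemma dual_norm_le:
  fixes G :: "real^'n::finite^'n"
  assumes "invertible G" "0 < l" "\<And>v. l * (norm v)\<^sup>2 \<le> v \<bullet> (G *v v)"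
  shows "p \<bullet> (matrix_inv G *v p) \<le> (norm p)\<^sup>2 / l"
proof -
  define w where "w = matrix_inv G *v p"
  have "l * (norm w)\<^sup>2 \<le> w \<bullet> p" using assms(3)[of w] matrix_inv_mult[OF assms(1)] by (simp add: w_def)
  also have "w \<bullet> p \<le> norm w * norm p" by (rule norm_cauchy_schwarz)
  finally have *: "l * norm w \<le> norm p"
    by (cases "w = 0") (simp_all add: power2_eq_square)
  have "p \<bullet> w \<le> norm p * norm w" by (rule norm_cauchy_schwarz)
  also have "\<dots> \<le> norm p * (norm p / l)"
    using * assms(2) by (intro mult_left_mono) (simp_all add: field_simps)
  finally show ?thesis by (simp add: w_def power2_eq_square)
qed

text \<open>The quadratic form attains a positive minimum on the compact product of \<open>K\<close> with the unit sphere.\<close>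

lemma metric_lower_bound:
  fixes A :: "('a::t2_space, 'n::finite) chart set"
  assumes g: "riemannian_metric A g" and c: "c \<in> A" and K: "compact K" "K \<subseteq> chart_image c"
  obtains l where "0 < l" "\<And>x v. x \<in> K \<Longrightarrow> l * (norm v)\<^sup>2 \<le> v \<bullet> (g c x *v v)"
proof -
  let ?S = "K \<times> sphere (0::real^'n) 1"
  let ?q = "\<lambda>(x, v). v \<bullet> (g c x *v v)"
  have gcont: "continuous_on K (g c)"
    using g c K(2) by (auto intro!: continuous_on_subset[OF smooth_map_on_continuous] simp: riemannian_metric_def)
  have cont: "continuous_on ?S ?q"
  proof -
    have 1: "continuous_on ?S (\<lambda>z. g c (fst z))"
      by (rule continuous_on_compose2[OF gcont]) (auto intro: continuous_intros)
    have "continuous_on ?S (\<lambda>z. snd z \<bullet> (g c (fst z) *v snd z))"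
      unfolding matrix_vector_mult_def by (intro continuous_intros 1)
    then show ?thesis by (simp add: case_prod_beta')
  qed
  have pos: "0 < v \<bullet> (g c x *v v)" if "x \<in> K" "v \<noteq> 0" for x v
    using that g c K(2) by (auto simp: riemannian_metric_def)
  show ?thesis
  proof (cases "?S = {}")
    case True
    have "axis undefined 1 \<in> sphere (0::real^'n) 1" by (simp add: norm_axis_1)
    then have "K = {}" using True by blast
    then show ?thesis using that[of 1] by auto
  next
    case False
    obtain z where z: "z \<in> ?S" "\<And>y. y \<in> ?S \<Longrightarrow> ?q z \<le> ?q y"
      using continuous_attains_inf[OF compact_Times[OF K(1) compact_sphere] False cont] by blast
    let ?l = "?q z"
    have "fst z \<in> K" "snd z \<noteq> 0" using z(1) by (auto simp: mem_Times_iff)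
    then have "0 < ?l" using pos by (simp add: case_prod_beta)
    moreover have "?l * (norm v)\<^sup>2 \<le> v \<bullet> (g c x *v v)" if "x \<in> K" for x v
    proof (cases "v = 0")
      case False
      let ?u = "v /\<^sub>R norm v"
      have "?l \<le> ?q (x, ?u)" using that False by (intro z(2)) simp
      also have "\<dots> = (v \<bullet> (g c x *v v)) / (norm v)\<^sup>2"
        by (simp add: matrix_vector_mult_scaleR power2_eq_square divide_inverse)
      finally show ?thesis using False by (simp add: field_simps)
    qed simp
    ultimately show ?thesis by (rule that)
  qed
qed

text \<open>The majorant \<open>\<beta>\<close> of the gradient is carried along because energies of linear combinations are
  estimated through it.\<close>

definition test_function ::
    "'b::real_normed_vector set \<Rightarrow> ('b \<Rightarrow> real) \<Rightarrow> ('b \<Rightarrow> real) \<Rightarrow> bool" where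
  "test_function K \<beta> f \<longleftrightarrow> (\<forall>k. Ck_on k UNIV f) \<and> (\<forall>x. x \<notin> K \<longrightarrow> f x = 0) \<and>
     (\<forall>x v. \<bar>frechet_derivative f (at x) v\<bar> \<le> \<beta> x * norm v)"

text \<open>Over the compact set of relevant coordinates the metric dominates a multiple of the Euclidean one, so
  the dual norm of the differential is at most a constant times the Euclidean norm of the gradient.
  At all other points the function vanishes in a neighbourhood.\<close>

lemma chart_lift_energy_density:
  fixes A :: "('a::t2_space, 'n::finite) chart set"
  assumes A: "smooth_atlas A" and g: "riemannian_metric A g" and c: "c \<in> A"
    and K: "compact (K \<inter> chart_image c)"
  obtains \<Lambda> where "0 < \<Lambda>" "\<And>f \<beta> p. test_function K \<beta> f \<Longrightarrow>
      differential_norm_sq A g (chart_lift c f) p \<le>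
        (if p \<in> fst c \<and> snd c p \<in> K then \<Lambda> * (\<beta> (snd c p))\<^sup>2 else 0)"
proof -
  have chc: "is_chart c" using A c by (auto simp: smooth_atlas_def)
  note hc = chart_homeomorphism[OF chc]
  obtain l where l: "0 < l" "\<And>x v. x \<in> K \<inter> chart_image c \<Longrightarrow> l * (norm v)\<^sup>2 \<le> v \<bullet> (g c x *v v)"
    using metric_lower_bound[OF g c K] by auto
  have "differential_norm_sq A g (chart_lift c f) p \<le>
        (if p \<in> fst c \<and> snd c p \<in> K then 1 / l * (\<beta> (snd c p))\<^sup>2 else 0)"
    if "test_function K \<beta> f" for f \<beta> p
  proof -
    have f: "\<And>k. Ck_on k UNIV f" "\<And>x. x \<notin> K \<Longrightarrow> f x = 0"
      and \<beta>: "\<And>x v. \<bar>frechet_derivative f (at x) v\<bar> \<le> \<beta> x * norm v"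
      using that unfolding test_function_def by blast+
    have sm: "chart_lift c f \<in> smooth_functions A" by (rule chart_lift_smooth[OF A c f(1) K f(2)])
    show ?thesis
    proof (cases "p \<in> fst c \<and> snd c p \<in> K")
      case True
      let ?x = "snd c p" let ?P = "partials c (chart_lift c f) p"
      have xK: "?x \<in> K \<inter> chart_image c" using True hc(7) by auto
      have "(f has_derivative frechet_derivative f (at ?x)) (at ?x within chart_image c)"
        by (rule has_derivative_at_withinI, rule Ck_on_Suc_derivative[OF f(1)]) simp
      then have "(chart_lift c f \<circ> chart_inv c has_derivative frechet_derivative f (at ?x)) (at ?x within chart_image c)"
        by (rule has_derivative_transform[rotated 2]) (use xK hc in \<open>auto simp: chart_lift_def\<close>)
      then have P: "?P \<bullet> v = frechet_derivative f (at ?x) v" for v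
        using partials_inner[OF chc] True by blast
      have "norm ?P * norm ?P \<le> \<beta> ?x * norm ?P"
        using P[of ?P] \<beta>[of ?x ?P] by (simp add: power2_norm_eq_inner[symmetric] power2_eq_square)
      moreover have "0 \<le> \<beta> ?x"
      proof -
        have "0 \<le> \<beta> ?x * norm (axis undefined 1 :: real^'n)" using \<beta>[of ?x] abs_ge_zero order_trans by blast
        then show ?thesis by simp
      qed
      ultimately have nP: "norm ?P \<le> \<beta> ?x" by (cases "?P = 0") simp_all
      have "differential_norm_sq A g (chart_lift c f) p = ?P \<bullet> (matrix_inv (g c ?x) *v ?P)"
        using differential_norm_sq_chart[OF A g sm c] True by blast
      also have "\<dots> \<le> (norm ?P)\<^sup>2 / l"
      proof (rule dual_norm_le[OF _ l(1)])
        show "invertible (g c ?x)"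
          using g c xK by (auto intro!: positive_definite_invertible simp: riemannian_metric_def)
      qed (use l(2) xK in auto)
      also have "\<dots> \<le> (\<beta> ?x)\<^sup>2 / l" using nP l(1) by (intro divide_right_mono power_mono) auto
      finally show ?thesis using True by simp
    next
      case False
      let ?C = "chart_inv c ` (K \<inter> chart_image c)"
      have "compact ?C"
        by (rule compact_continuous_image[OF _ K]) (rule continuous_on_subset[OF hc(3)], simp)
      then have C: "closed ?C" by (rule compact_imp_closed)
      have z: "chart_lift c f q = 0" if "q \<notin> ?C" for q
        using chart_lift_eq_0[of c K f q] chc f(2) that by blast
      have pC: "p \<notin> ?C" using False hc(5,6) by auto
      have "p \<in> (\<Union>c\<in>A. fst c)" using A by (simp add: smooth_atlas_def)
      then obtain d where d: "d \<in> A" "p \<in> fst d" by blast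
      have chd: "is_chart d" using A d by (auto simp: smooth_atlas_def)
      note hd = chart_homeomorphism[OF chd]
      have "open (fst d - ?C)" using hd(1) C by (rule open_Diff)
      then have "openin (top_of_set (chart_image d)) (snd d ` (fst d - ?C))"
        using chart_openin[OF chd] by auto
      then obtain V where V: "open V" "snd d ` (fst d - ?C) = chart_image d \<inter> V"
        unfolding openin_open by blast
      have "snd d p \<in> V" using V(2) d(2) pC by blast
      then obtain e where e: "0 < e" "ball (snd d p) e \<subseteq> V" using V(1) open_contains_ball by blast
      have "((\<lambda>_. 0::real) has_derivative (\<lambda>v. 0)) (at (snd d p) within chart_image d)" by simp
      then have "(chart_lift c f \<circ> chart_inv d has_derivative (\<lambda>v. 0)) (at (snd d p) within chart_image d)"
      proof (rule has_derivative_transform_within[OF _ e(1)])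
        fix y assume y: "y \<in> chart_image d" "dist y (snd d p) < e"
        then have "y \<in> chart_image d \<inter> V" using e(2) by (auto simp: dist_commute)
        then obtain q where "q \<in> fst d - ?C" "y = snd d q" using V(2) by blast
        then show "0 = (chart_lift c f \<circ> chart_inv d) y" using z hd(4) by auto
      qed (use d hd in auto)
      then have "partials d (chart_lift c f) p \<bullet> v = 0" for v
        using partials_inner[OF chd d(2)] by blast
      then have "partials d (chart_lift c f) p = 0" by (metis inner_eq_zero_iff)
      then have "differential_norm_sq A g (chart_lift c f) p = 0"
        using differential_norm_sq_chart[OF A g sm d] by simp
      then show ?thesis using False by (simp only: if_False order_refl)
    qed
  qed
  note bound = this
  show ?thesis
  proof (rule that[of "1 / l"])
    show "0 < 1 / l" using l(1) by simp
  qed (rule bound; assumption)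
qed

section \<open>The Riemannian volume measure\<close>

text \<open>Lebesgue measure of the coordinates, transported to the manifold. Working with measures on the
  manifold turns changes of charts into identities between densities.\<close>

definition chart_lebesgue :: "('a::topological_space, 'n::finite) chart \<Rightarrow> 'a measure" where
  "chart_lebesgue c = distr (restrict_space lborel (chart_image c)) borel (chart_inv c)"

definition volume_density ::
    "(('a, 'n::finite) chart \<Rightarrow> real^'n \<Rightarrow> real^'n^'n) \<Rightarrow> ('a, 'n) chart \<Rightarrow> 'a \<Rightarrow> real" where
  "volume_density g c p = indicator (fst c) p * sqrt (det (g c (snd c p)))"

definition chart_volume ::
    "(('a::topological_space, 'n::finite) chart \<Rightarrow> real^'n \<Rightarrow> real^'n^'n) \<Rightarrow> ('a, 'n) chart \<Rightarrow> 'a measure" where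
  "chart_volume g c = density (chart_lebesgue c) (\<lambda>p. ennreal (volume_density g c p))"

lemma continuous_on_det:
  fixes f :: "'b::topological_space \<Rightarrow> real^'n::finite^'n"
  assumes "continuous_on S f"
  shows "continuous_on S (\<lambda>x. det (f x))"
  unfolding det_def by (intro continuous_intros assms)

lemma sets_chart_lebesgue [simp]: "sets (chart_lebesgue c) = sets borel"
  and space_chart_lebesgue [simp]: "space (chart_lebesgue c) = UNIV"
  by (simp_all add: chart_lebesgue_def)

lemma chart_inv_measurable:
  assumes "is_chart c"
  shows "chart_inv c \<in> restrict_space lborel (chart_image c) \<rightarrow>\<^sub>M borel"
proof -
  have "chart_inv c \<in> borel_measurable (restrict_space borel (chart_image c))"
    by (rule borel_measurable_continuous_on_restrict) (rule chart_homeomorphism(3)[OF assms])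
  moreover have "sets (restrict_space lborel (chart_image c)) = sets (restrict_space borel (chart_image c))"
    by (rule sets_restrict_space_cong) simp
  ultimately show ?thesis by (simp cong: measurable_cong_sets)
qed

lemma chart_image_borel: "is_chart c \<Longrightarrow> chart_image c \<in> sets borel"
  by (intro half_space_open_imp_borel chart_image_half_space_open)

lemma nn_integral_chart_lebesgue:
  assumes c: "is_chart c" and h: "h \<in> borel_measurable borel"
  shows "(\<integral>\<^sup>+p. h p \<partial>chart_lebesgue c) = (\<integral>\<^sup>+x\<in>chart_image c. h (chart_inv c x) \<partial>lborel)"
  unfolding chart_lebesgue_def
  using chart_inv_measurable[OF c] chart_image_borel[OF c] h
  by (simp add: nn_integral_distr nn_integral_restrict_space)

lemma chart_coordinates_image:
  assumes c: "is_chart c" and B: "B \<subseteq> fst c"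
  shows "snd c ` B = {x \<in> chart_image c. chart_inv c x \<in> B}"
  using chart_homeomorphism[OF c] B by (auto simp: chart_image_def image_iff)

lemma chart_coordinates_image_borel:
  assumes c: "is_chart c" and B: "B \<in> sets borel" "B \<subseteq> fst c"
  shows "snd c ` B \<in> sets borel"
proof -
  have "chart_inv c -` B \<inter> space (restrict_space lborel (chart_image c)) \<in> sets (restrict_space lborel (chart_image c))"
    by (rule measurable_sets[OF chart_inv_measurable[OF c] B(1)])
  moreover have "chart_inv c -` B \<inter> space (restrict_space lborel (chart_image c)) = snd c ` B"
    by (auto simp: chart_coordinates_image[OF c B(2)] space_restrict_space)
  ultimately show ?thesis
    using chart_image_borel[OF c] by (simp add: sets_restrict_space_iff)
qed

lemma emeasure_chart_lebesgue:
  assumes c: "is_chart c" and B: "B \<in> sets borel" "B \<subseteq> fst c"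
  shows "emeasure (chart_lebesgue c) B = emeasure lborel (snd c ` B)"
proof -
  have "emeasure (chart_lebesgue c) B = (\<integral>\<^sup>+p. indicator B p \<partial>chart_lebesgue c)"
    using B(1) by simp
  also have "\<dots> = (\<integral>\<^sup>+x\<in>chart_image c. indicator B (chart_inv c x) \<partial>lborel)"
    by (rule nn_integral_chart_lebesgue[OF c]) (use B(1) in simp)
  also have "\<dots> = (\<integral>\<^sup>+x. indicator (snd c ` B) x \<partial>lborel)"
    by (rule nn_integral_cong) (auto simp: chart_coordinates_image[OF c B(2)] indicator_def)
  finally show ?thesis using chart_coordinates_image_borel[OF c B] by simp
qed

lemma volume_density_measurable:
  fixes A :: "('a::t2_space, 'n::finite) chart set"
  assumes A: "smooth_atlas A" and g: "riemannian_metric A g" and c: "c \<in> A"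
  shows "volume_density g c \<in> borel_measurable borel"
proof -
  have chc: "is_chart c" using A c by (auto simp: smooth_atlas_def)
  note hc = chart_homeomorphism[OF chc]
  have "continuous_on (chart_image c) (g c)"
    using g c by (auto intro!: smooth_map_on_continuous simp: riemannian_metric_def)
  then have "continuous_on (fst c) (\<lambda>p. g c (snd c p))"
    by (rule continuous_on_compose2[OF _ hc(2)]) (use hc(7) in auto)
  then have "continuous_on (fst c) (\<lambda>p. sqrt (det (g c (snd c p))))"
    by (intro continuous_on_real_sqrt continuous_on_det)
  from borel_measurable_continuous_on_indicator[OF _ this]
  have "(\<lambda>p. indicator (fst c) p *\<^sub>R sqrt (det (g c (snd c p)))) \<in> borel_measurable borel"
    using hc(1) by simp
  then show ?thesis by (simp add: volume_density_def[abs_def])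
qed

lemma nn_integral_chart_volume:
  fixes A :: "('a::t2_space, 'n::finite) chart set"
  assumes A: "smooth_atlas A" and g: "riemannian_metric A g" and c: "c \<in> A"
    and h: "h \<in> borel_measurable borel"
  shows "(\<integral>\<^sup>+p. h p \<partial>chart_volume g c) =
    (\<integral>\<^sup>+x\<in>chart_image c. ennreal (sqrt (det (g c x))) * h (chart_inv c x) \<partial>lborel)"
proof -
  have chc: "is_chart c" using A c by (auto simp: smooth_atlas_def)
  note hc = chart_homeomorphism[OF chc]
  have m: "volume_density g c \<in> borel_measurable borel" by (rule volume_density_measurable[OF A g c])
  have "(\<integral>\<^sup>+p. h p \<partial>chart_volume g c) = (\<integral>\<^sup>+p. ennreal (volume_density g c p) * h p \<partial>chart_lebesgue c)"
    unfolding chart_volume_def using m h by (subst nn_integral_density) (simp_all cong: measurable_cong_sets)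
  also have "\<dots> = (\<integral>\<^sup>+x\<in>chart_image c. ennreal (volume_density g c (chart_inv c x)) * h (chart_inv c x) \<partial>lborel)"
    by (rule nn_integral_chart_lebesgue[OF chc]) (use m h in measurable)
  also have "\<dots> = (\<integral>\<^sup>+x\<in>chart_image c. ennreal (sqrt (det (g c x))) * h (chart_inv c x) \<partial>lborel)"
    by (rule nn_integral_cong) (use hc(5,6) in \<open>auto simp: volume_density_def indicator_def\<close>)
  finally show ?thesis .
qed

lemma emeasure_chart_volume:
  fixes A :: "('a::t2_space, 'n::finite) chart set"
  assumes A: "smooth_atlas A" and g: "riemannian_metric A g" and c: "c \<in> A"
    and B: "B \<in> sets borel" "B \<subseteq> fst c"
  shows "emeasure (chart_volume g c) B = (\<integral>\<^sup>+x\<in>snd c ` B. ennreal (sqrt (det (g c x))) \<partial>lborel)"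
proof -
  have chc: "is_chart c" using A c by (auto simp: smooth_atlas_def)
  have "emeasure (chart_volume g c) B = (\<integral>\<^sup>+p. indicator B p \<partial>chart_volume g c)"
    using B(1) by (simp add: chart_volume_def)
  also have "\<dots> = (\<integral>\<^sup>+x\<in>chart_image c. ennreal (sqrt (det (g c x))) * indicator B (chart_inv c x) \<partial>lborel)"
    by (rule nn_integral_chart_volume[OF A g c]) (use B(1) in simp)
  also have "\<dots> = (\<integral>\<^sup>+x\<in>snd c ` B. ennreal (sqrt (det (g c x))) \<partial>lborel)"
    by (rule nn_integral_cong) (auto simp: chart_coordinates_image[OF chc B(2)] indicator_def)
  finally show ?thesis .
qed

text \<open>Taking determinants in the transformation law of the metric shows that the Jacobian of a transition
  map is the quotient of the two volume densities. In particular it is a measurable function.\<close>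

lemma abs_det_transition:
  fixes A :: "('a::t2_space, 'n::finite) chart set"
  assumes A: "smooth_atlas A" and g: "riemannian_metric A g" and c: "c \<in> A" and d: "d \<in> A"
    and p: "p \<in> fst c" "p \<in> fst d"
  shows "\<bar>det (matrix (frechet_derivative (transition c d) (at (snd c p) within overlap c d)))\<bar> =
      volume_density g c p / volume_density g d p" (is "\<bar>det ?J\<bar> = _")
    and "volume_density g d p \<noteq> 0"
proof -
  have chc: "is_chart c" and chd: "is_chart d" using A c d by (auto simp: smooth_atlas_def)
  note hc = chart_homeomorphism[OF chc] and hd = chart_homeomorphism[OF chd]
  have xO: "snd c p \<in> overlap c d" using p by (auto simp: overlap_def)
  have T: "transition c d (snd c p) = snd d p" using hc(4)[OF p(1)] by (simp add: transition_def)
  have "g c (snd c p) = transpose ?J ** g d (snd d p) ** ?J"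
    using g c d xO T unfolding riemannian_metric_def Let_def by metis
  then have "det (g c (snd c p)) = (det ?J)\<^sup>2 * det (g d (snd d p))"
    by (simp add: det_mul power2_eq_square)
  then have eq: "sqrt (det (g c (snd c p))) = \<bar>det ?J\<bar> * sqrt (det (g d (snd d p)))"
    by (simp add: real_sqrt_mult)
  have "invertible (g d (snd d p))"
    using g d hd(7)[OF p(2)] by (auto intro!: positive_definite_invertible simp: riemannian_metric_def)
  then have nz: "det (g d (snd d p)) \<noteq> 0" by (simp add: invertible_det_nz)
  then show "volume_density g d p \<noteq> 0" using p by (simp add: volume_density_def)
  show "\<bar>det ?J\<bar> = volume_density g c p / volume_density g d p"
    using eq nz p by (simp add: volume_density_def)
qed

lemma chart_lebesgue_transition:
  fixes A :: "('a::t2_space, 'n::finite) chart set"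
  assumes A: "smooth_atlas A" and g: "riemannian_metric A g" and c: "c \<in> A" and d: "d \<in> A"
    and B: "B \<in> sets borel" "B \<subseteq> fst c \<inter> fst d"
  shows "emeasure (chart_lebesgue d) B =
    (\<integral>\<^sup>+p\<in>B. ennreal (volume_density g c p / volume_density g d p) \<partial>chart_lebesgue c)"
proof -
  have chc: "is_chart c" and chd: "is_chart d" using A c d by (auto simp: smooth_atlas_def)
  note hc = chart_homeomorphism[OF chc] and hd = chart_homeomorphism[OF chd]
  let ?u = "\<lambda>p. volume_density g c p / volume_density g d p"
  let ?w = "\<lambda>x. indicator (chart_image c) x * ?u (chart_inv c x)"
  have um: "?u \<in> borel_measurable borel"
    using volume_density_measurable[OF A g c] volume_density_measurable[OF A g d] by measurable
  have Bc: "B \<subseteq> fst c" and Bd: "B \<subseteq> fst d" using B by auto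
  have im: "transition c d ` (snd c ` B) = snd d ` B"
    unfolding image_image by (rule image_cong[OF refl]) (use Bc hc(4) in \<open>auto simp: transition_def\<close>)
  have "emeasure (chart_lebesgue d) B = emeasure lborel (snd d ` B)"
    by (rule emeasure_chart_lebesgue[OF chd B(1) Bd])
  also have "\<dots> = (\<integral>\<^sup>+x\<in>snd c ` B. ennreal (?w x) \<partial>lborel)"
    unfolding im[symmetric]
  proof (rule emeasure_injective_image[where
        f' = "\<lambda>x v. matrix (frechet_derivative (transition c d) (at x within overlap c d)) *v v"])
    show "snd c ` B \<in> sets borel" by (rule chart_coordinates_image_borel[OF chc B(1) Bc])
    show "transition c d ` snd c ` B \<in> sets borel"
      unfolding im by (rule chart_coordinates_image_borel[OF chd B(1) Bd])
    show "inj_on (transition c d) (snd c ` B)"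
    proof (rule inj_onI, clarify)
      fix p q assume pq: "p \<in> B" "q \<in> B" "transition c d (snd c p) = transition c d (snd c q)"
      then have "snd d p = snd d q" using Bc hc(4) by (auto simp: transition_def subset_iff)
      then show "snd c p = snd c q" using inj_onD[OF hd(8)] pq Bd by blast
    qed
    have "?u \<circ> chart_inv c \<in> borel_measurable (restrict_space lborel (chart_image c))"
      by (rule measurable_comp[OF chart_inv_measurable[OF chc] um])
    then have "(\<lambda>x. ?u (chart_inv c x)) \<in> borel_measurable (restrict_space borel (chart_image c))"
      by (simp add: o_def cong: measurable_cong_sets sets_restrict_space_cong)
    then show "?w \<in> borel_measurable borel"
      using chart_image_borel[OF chc] by (simp add: borel_measurable_restrict_space_iff)
    fix x assume "x \<in> snd c ` B"
    then obtain p where p: "p \<in> B" "x = snd c p" by blast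
    then have pf: "p \<in> fst c" "p \<in> fst d" using Bc Bd by auto
    have xO: "x \<in> overlap c d" using p pf by (auto simp: overlap_def)
    show "(transition c d has_derivative
        (*v) (matrix (frechet_derivative (transition c d) (at x within overlap c d)))) (at x within snd c ` B)"
      by (rule has_derivative_subset[OF transition_has_derivative[OF A c d xO]])
        (use B(2) in \<open>auto simp: overlap_def\<close>)
    have "matrix ((*v) (matrix (frechet_derivative (transition c d) (at x within overlap c d)))) =
        matrix (frechet_derivative (transition c d) (at x within overlap c d))"
      by (rule matrix_of_matrix_vector_mul)
    then show "\<bar>det (matrix ((*v) (matrix (frechet_derivative (transition c d) (at x within overlap c d)))))\<bar> = ?w x"
      using abs_det_transition(1)[OF A g c d pf] hc(4,7)[OF pf(1)] p(2) by simp
  qed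
  also have "\<dots> = (\<integral>\<^sup>+x\<in>chart_image c. ennreal (?u (chart_inv c x)) * indicator B (chart_inv c x) \<partial>lborel)"
    by (rule nn_integral_cong) (auto simp: chart_coordinates_image[OF chc Bc] indicator_def)
  also have "\<dots> = (\<integral>\<^sup>+p\<in>B. ennreal (?u p) \<partial>chart_lebesgue c)"
    by (rule nn_integral_chart_lebesgue[OF chc, symmetric]) (use um B(1) in measurable)
  finally show ?thesis .
qed

text \<open>The density of one chart measure with respect to the other is the quotient of the volume densities,
  and it cancels in the product with the volume density.\<close>

lemma chart_volume_independent:
  fixes A :: "('a::t2_space, 'n::finite) chart set"
  assumes A: "smooth_atlas A" and g: "riemannian_metric A g" and c: "c \<in> A" and d: "d \<in> A"
    and B: "B \<in> sets borel" "B \<subseteq> fst c \<inter> fst d"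
  shows "emeasure (chart_volume g d) B = emeasure (chart_volume g c) B"
proof -
  have chc: "is_chart c" and chd: "is_chart d" using A c d by (auto simp: smooth_atlas_def)
  let ?vc = "volume_density g c" and ?vd = "volume_density g d" and ?O = "fst c \<inter> fst d"
  have m: "?vc \<in> borel_measurable borel" "?vd \<in> borel_measurable borel"
    using volume_density_measurable[OF A g] c d by auto
  have O: "?O \<in> sets borel" using chart_homeomorphism(1)[OF chc] chart_homeomorphism(1)[OF chd] by auto
  have mL: "h \<in> borel_measurable (chart_lebesgue e)" if "h \<in> borel_measurable borel"
    for h :: "'a \<Rightarrow> ennreal" and e :: "('a, 'n) chart"
    using that by (simp cong: measurable_cong_sets)
  have u: "(\<lambda>p. ennreal (?vc p / ?vd p) * indicator ?O p) \<in> borel_measurable borel"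
    using m O by measurable
  have eq: "density (chart_lebesgue d) (indicator ?O) =
      density (chart_lebesgue c) (\<lambda>p. ennreal (?vc p / ?vd p) * indicator ?O p)"
  proof (rule measure_eqI)
    fix X assume "X \<in> sets (density (chart_lebesgue d) (indicator ?O))"
    then have X: "X \<in> sets borel" by simp
    have "emeasure (density (chart_lebesgue d) (indicator ?O)) X = emeasure (chart_lebesgue d) (?O \<inter> X)"
      using X O by (subst emeasure_density) (auto simp: indicator_inter_arith[symmetric] cong: measurable_cong_sets)
    also have "\<dots> = (\<integral>\<^sup>+p\<in>?O \<inter> X. ennreal (?vc p / ?vd p) \<partial>chart_lebesgue c)"
      by (rule chart_lebesgue_transition[OF A g c d]) (use X O in auto)
    also have "\<dots> = emeasure (density (chart_lebesgue c) (\<lambda>p. ennreal (?vc p / ?vd p) * indicator ?O p)) X"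
      using X mL[OF u] by (subst emeasure_density) (simp_all add: indicator_inter_arith mult.assoc)
    finally show "emeasure (density (chart_lebesgue d) (indicator ?O)) X =
        emeasure (density (chart_lebesgue c) (\<lambda>p. ennreal (?vc p / ?vd p) * indicator ?O p)) X" .
  qed simp
  have "emeasure (chart_volume g d) B = (\<integral>\<^sup>+p\<in>B. ennreal (?vd p) \<partial>chart_lebesgue d)"
    unfolding chart_volume_def using B(1) m by (subst emeasure_density) (auto cong: measurable_cong_sets)
  also have "\<dots> = (\<integral>\<^sup>+p. ennreal (?vd p) * indicator B p \<partial>density (chart_lebesgue d) (indicator ?O))"
  proof -
    have "(\<lambda>p. ennreal (?vd p) * indicator B p) \<in> borel_measurable borel" using m B(1) by measurable
    moreover have "indicator ?O \<in> borel_measurable (borel :: 'a measure)" using O by simp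
    ultimately have "(\<integral>\<^sup>+p. ennreal (?vd p) * indicator B p \<partial>density (chart_lebesgue d) (indicator ?O)) =
        (\<integral>\<^sup>+p. indicator ?O p * (ennreal (?vd p) * indicator B p) \<partial>chart_lebesgue d)"
      using mL by (intro nn_integral_density) blast+
    also have "\<dots> = (\<integral>\<^sup>+p\<in>B. ennreal (?vd p) \<partial>chart_lebesgue d)"
      by (rule nn_integral_cong) (use B(2) in \<open>auto simp: indicator_def\<close>)
    finally show ?thesis by (rule sym)
  qed
  also have "\<dots> = (\<integral>\<^sup>+p. (ennreal (?vc p / ?vd p) * indicator ?O p) * (ennreal (?vd p) * indicator B p) \<partial>chart_lebesgue c)"
  proof -
    have "(\<lambda>p. ennreal (?vd p) * indicator B p) \<in> borel_measurable borel" using m B(1) by measurable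
    then show ?thesis unfolding eq by (intro nn_integral_density mL u)
  qed
  also have "\<dots> = (\<integral>\<^sup>+p\<in>B. ennreal (?vc p) \<partial>chart_lebesgue c)"
  proof (rule nn_integral_cong)
    fix p
    show "(ennreal (?vc p / ?vd p) * indicator ?O p) * (ennreal (?vd p) * indicator B p) = ennreal (?vc p) * indicator B p"
    proof (cases "p \<in> B")
      case True
      then have p: "p \<in> fst c" "p \<in> fst d" using B by auto
      have "0 \<le> ?vc p / ?vd p" using abs_det_transition(1)[OF A g c d p] by (metis abs_ge_zero)
      then have "ennreal (?vc p / ?vd p) * ennreal (?vd p) = ennreal (?vc p / ?vd p * ?vd p)"
        by (rule ennreal_mult'[symmetric])
      then show ?thesis using True p abs_det_transition(2)[OF A g c d p] by simp
    qed simp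
  qed
  also have "\<dots> = emeasure (chart_volume g c) B"
    unfolding chart_volume_def using B(1) m by (subst emeasure_density) (auto cong: measurable_cong_sets)
  finally show ?thesis .
qed

lemma finite_subatlas:
  fixes A :: "('a::t2_space, 'n::finite) chart set"
  assumes A: "smooth_atlas A" and K: "compact (UNIV :: 'a set)"
  obtains e :: "nat \<Rightarrow> ('a, 'n) chart" and N where "\<And>i. i < N \<Longrightarrow> e i \<in> A" "(\<Union>i<N. fst (e i)) = UNIV"
proof -
  have op: "open (fst c)" if "c \<in> A" for c
    by (rule chart_homeomorphism(1)) (use A that in \<open>simp add: smooth_atlas_def\<close>)
  have "(\<Union>c\<in>A. fst c) = UNIV" using A unfolding smooth_atlas_def by (elim conjE)
  then have cov: "UNIV \<subseteq> (\<Union>c\<in>A. fst c)" by (rule equalityD2)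
  obtain C where C: "C \<subseteq> A" "finite C" "UNIV \<subseteq> (\<Union>c\<in>C. fst c)"
    by (rule compactE_image[OF K, of A fst, OF op cov]) (assumption, rule that)
  obtain e where "bij_betw e {0..<card C} C" using ex_bij_betw_nat_finite[OF C(2)] by (elim exE)
  then have im: "e ` {..<card C} = C" by (simp add: bij_betw_def atLeast0LessThan)
  have eC: "e i \<in> C" if "i < card C" for i
    by (rule subsetD[OF equalityD1[OF im]], rule imageI) (simp add: that)
  show ?thesis
  proof (rule that)
    show "e i \<in> A" if "i < card C" for i using eC[OF that] C(1) by (rule subsetD[rotated])
    have "(\<Union>i<card C. fst (e i)) = (\<Union>c\<in>e ` {..<card C}. fst c)" by (simp only: image_image)
    also have "\<dots> = UNIV" unfolding im by (rule equalityI[OF subset_UNIV C(3)])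
    finally show "(\<Union>i<card C. fst (e i)) = UNIV" .
  qed
qed

text \<open>The property by which the Riemannian volume is defined through a definite description.\<close>

definition volume_characterization ::
    "('a::topological_space, 'n::finite) chart set \<Rightarrow> (('a, 'n) chart \<Rightarrow> real^'n \<Rightarrow> real^'n^'n) \<Rightarrow>
     'a measure \<Rightarrow> bool" where
  "volume_characterization A g \<nu> \<longleftrightarrow> sets \<nu> = sets borel \<and>
     (\<forall>c\<in>A. \<forall>B\<in>sets borel. B \<subseteq> fst c \<longrightarrow>
        emeasure \<nu> B = (\<integral>\<^sup>+x\<in>snd c ` B. ennreal (sqrt (det (g c x))) \<partial>lborel))"

lemma volume_characterizationD:
  assumes "volume_characterization A g \<nu>" "c \<in> A" "B \<in> sets borel" "B \<subseteq> fst c"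
  shows "emeasure \<nu> B = (\<integral>\<^sup>+x\<in>snd c ` B. ennreal (sqrt (det (g c x))) \<partial>lborel)"
  using assms unfolding volume_characterization_def by blast

text \<open>Finitely many charts cover the compact manifold. Cutting it into disjoint Borel pieces, each inside
  one chart, a measure with the prescribed values on chart domains is determined by the pieces; and
  summing the chart volumes of the pieces defines one, since two charts give the same volume on their
  overlap. Without this existence and uniqueness, nothing could be said about the value of the
  definite description.\<close>

lemma volume_characterization_ex1:
  fixes A :: "('a::t2_space, 'n::finite) chart set"
  assumes A: "smooth_atlas A" and g: "riemannian_metric A g" and K: "compact (UNIV :: 'a set)"
  shows "\<exists>!\<nu>. volume_characterization A g \<nu>"
proof -
  obtain e :: "nat \<Rightarrow> ('a, 'n) chart" and N where e: "\<And>i. i < N \<Longrightarrow> e i \<in> A" "(\<Union>i<N. fst (e i)) = UNIV"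
    by (rule finite_subatlas[OF A K]) (rule that)
  \<comment> \<open>disjoint pieces, each inside one chart domain\<close>
  define P where "P i = fst (e i) - (\<Union>j<i. fst (e j))" for i
  have chart: "is_chart c" if "c \<in> A" for c using that A by (auto simp: smooth_atlas_def)
  have op: "open (fst (e i))" if "i < N" for i using chart_homeomorphism(1)[OF chart[OF e(1)[OF that]]] .
  have Pb: "P i \<in> sets borel" if "i < N" for i
    unfolding P_def using op that by (intro sets.Diff sets.finite_UN) auto
  have Psub: "P i \<subseteq> fst (e i)" for i by (auto simp: P_def)
  have Pdis: "disjoint_family_on P {..<N}"
    unfolding disjoint_family_on_def
  proof (intro ballI impI)
    fix i j :: nat assume "i \<noteq> j"
    then show "P i \<inter> P j = {}" by (cases "i < j") (auto simp: P_def)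
  qed
  have Pcov: "(\<Union>i<N. P i) = UNIV"
  proof -
    have "\<exists>i<N. p \<in> P i" for p
    proof -
      define i where "i = (LEAST i. p \<in> fst (e i))"
      have "p \<in> (\<Union>i<N. fst (e i))" unfolding e(2) by (rule UNIV_I)
      then obtain j where j: "j < N" "p \<in> fst (e j)" by auto
      have 1: "p \<in> fst (e i)" unfolding i_def by (rule LeastI[of _ j]) (rule j(2))
      have "i \<le> j" unfolding i_def by (rule Least_le) (rule j(2))
      then have "i < N" using j(1) by simp
      moreover have "p \<notin> fst (e l)" if "l < i" for l using not_less_Least[OF that[unfolded i_def]] .
      then have "p \<in> P i" using 1 by (simp add: P_def)
      ultimately show ?thesis by blast
    qed
    then show ?thesis by auto
  qed
  have split: "emeasure M B = (\<Sum>i<N. emeasure M (B \<inter> P i))"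
    if "sets M = sets borel" "B \<in> sets borel" for M :: "'a measure" and B
    by (rule sum_emeasure_cover) (use that Pb Pdis Pcov in auto)
  define \<nu>f where "\<nu>f B = (\<Sum>i<N. emeasure (chart_volume g (e i)) (B \<inter> P i))" for B
  define \<nu> where "\<nu> = measure_of UNIV (sets (borel :: 'a measure)) \<nu>f"
  have s\<nu>: "sets \<nu> = sets borel"
    unfolding \<nu>_def using sets.sigma_sets_eq[of "borel :: 'a measure"] by simp
  have em\<nu>: "emeasure \<nu> B = \<nu>f B" if "B \<in> sets borel" for B
    unfolding \<nu>_def
  proof (rule emeasure_measure_of_sigma[OF _ _ _ that])
    show "sigma_algebra UNIV (sets (borel :: 'a measure))"
      using sets.sigma_algebra_axioms[of "borel :: 'a measure"] by simp
    show "positive (sets borel) \<nu>f" by (simp add: positive_def \<nu>f_def)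
    show "countably_additive (sets borel) \<nu>f"
    proof (rule countably_additiveI)
      fix F :: "nat \<Rightarrow> 'a set" assume F: "range F \<subseteq> sets borel" "disjoint_family F"
      have "(\<Sum>n. \<nu>f (F n)) = (\<Sum>i<N. \<Sum>n. emeasure (chart_volume g (e i)) (F n \<inter> P i))"
        unfolding \<nu>f_def by (rule suminf_sum) simp
      also have "\<dots> = (\<Sum>i<N. emeasure (chart_volume g (e i)) (\<Union>n. F n \<inter> P i))"
      proof (rule sum.cong[OF refl], rule suminf_emeasure)
        fix i assume "i \<in> {..<N}"
        then show "range (\<lambda>n. F n \<inter> P i) \<subseteq> sets (chart_volume g (e i))"
          using F(1) Pb by (auto simp: chart_volume_def)
        show "disjoint_family (\<lambda>n. F n \<inter> P i)"
          using F(2) unfolding disjoint_family_on_def by blast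
      qed
      also have "\<dots> = \<nu>f (\<Union>n. F n)" by (simp add: \<nu>f_def)
      finally show "(\<Sum>n. \<nu>f (F n)) = \<nu>f (\<Union>n. F n)" .
    qed
  qed
  have "volume_characterization A g \<nu>"
    unfolding volume_characterization_def
  proof (intro conjI s\<nu> ballI impI)
    fix c B assume c: "c \<in> A" and B: "B \<in> sets borel" "B \<subseteq> fst c"
    have "emeasure \<nu> B = (\<Sum>i<N. emeasure (chart_volume g c) (B \<inter> P i))"
      unfolding em\<nu>[OF B(1)] \<nu>f_def
    proof (rule sum.cong[OF refl])
      fix i assume i: "i \<in> {..<N}"
      show "emeasure (chart_volume g (e i)) (B \<inter> P i) = emeasure (chart_volume g c) (B \<inter> P i)"
        by (rule chart_volume_independent[OF A g c e(1)]) (use i B Pb Psub in auto)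
    qed
    also have "\<dots> = emeasure (chart_volume g c) B"
      by (rule split[symmetric]) (use B in \<open>auto simp: chart_volume_def\<close>)
    also have "\<dots> = (\<integral>\<^sup>+x\<in>snd c ` B. ennreal (sqrt (det (g c x))) \<partial>lborel)"
      by (rule emeasure_chart_volume[OF A g c B])
    finally show "emeasure \<nu> B = (\<integral>\<^sup>+x\<in>snd c ` B. ennreal (sqrt (det (g c x))) \<partial>lborel)" .
  qed
  moreover have "\<nu>1 = \<nu>2" if 1: "volume_characterization A g \<nu>1" and 2: "volume_characterization A g \<nu>2"
    for \<nu>1 \<nu>2 :: "'a measure"
  proof (rule measure_eqI)
    have s: "sets \<nu>1 = sets borel" "sets \<nu>2 = sets borel" using 1 2 by (auto simp: volume_characterization_def)
    then show "sets \<nu>1 = sets \<nu>2" by simp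
    fix B assume "B \<in> sets \<nu>1"
    then have B: "B \<in> sets borel" using s by simp
    have "emeasure \<nu>1 (B \<inter> P i) = emeasure \<nu>2 (B \<inter> P i)" if i: "i < N" for i
    proof -
      have "B \<inter> P i \<in> sets borel" "B \<inter> P i \<subseteq> fst (e i)" using B Pb[OF i] Psub by auto
      then show ?thesis
        using volume_characterizationD[OF 1 e(1)[OF i]] volume_characterizationD[OF 2 e(1)[OF i]]
        by (simp only:)
    qed
    then show "emeasure \<nu>1 B = emeasure \<nu>2 B" unfolding split[OF s(1) B] split[OF s(2) B]
      by (intro sum.cong[OF refl]) simp
  qed
  ultimately show ?thesis by blast
qed

lemma riemannian_volume_characterization:
  fixes A :: "('a::t2_space, 'n::finite) chart set"
  assumes "smooth_atlas A" "riemannian_metric A g" "compact (UNIV :: 'a set)"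
  shows "volume_characterization A g (riemannian_volume A g)"
  unfolding riemannian_volume_def volume_characterization_def[symmetric]
  by (rule theI'[OF volume_characterization_ex1[OF assms]])

lemma nn_integral_riemannian_volume_chart:
  fixes A :: "('a::t2_space, 'n::finite) chart set"
  assumes A: "smooth_atlas A" and g: "riemannian_metric A g" and K: "compact (UNIV :: 'a set)"
    and c: "c \<in> A" and h: "h \<in> borel_measurable borel" "\<And>p. p \<notin> fst c \<Longrightarrow> h p = 0"
  shows "(\<integral>\<^sup>+p. h p \<partial>riemannian_volume A g) =
    (\<integral>\<^sup>+x\<in>chart_image c. ennreal (sqrt (det (g c x))) * h (chart_inv c x) \<partial>lborel)"
proof -
  have chc: "is_chart c" using A c by (auto simp: smooth_atlas_def)
  let ?V = "riemannian_volume A g"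
  note vc = riemannian_volume_characterization[OF A g K]
  have sV: "sets ?V = sets borel" using vc by (simp add: volume_characterization_def)
  have O: "fst c \<in> sets borel" using chart_homeomorphism(1)[OF chc] by simp
  have eq: "density ?V (indicator (fst c)) = density (chart_volume g c) (indicator (fst c))"
  proof (rule measure_eqI)
    show "sets (density ?V (indicator (fst c))) = sets (density (chart_volume g c) (indicator (fst c)))"
      by (simp add: sV chart_volume_def)
    fix X assume "X \<in> sets (density ?V (indicator (fst c)))"
    then have X: "X \<in> sets borel" using sV by simp
    have *: "emeasure (density M (indicator (fst c))) X = emeasure M (fst c \<inter> X)"
      if "sets M = sets borel" for M :: "'a measure"
      using X O that by (subst emeasure_density)
        (auto simp: indicator_inter_arith[symmetric] cong: measurable_cong_sets)
    have "emeasure ?V (fst c \<inter> X) = emeasure (chart_volume g c) (fst c \<inter> X)"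
      using X O volume_characterizationD[OF vc c, of "fst c \<inter> X"] emeasure_chart_volume[OF A g c, of "fst c \<inter> X"]
      by simp
    then show "emeasure (density ?V (indicator (fst c))) X = emeasure (density (chart_volume g c) (indicator (fst c))) X"
      using *[OF sV] *[of "chart_volume g c"] by (simp add: chart_volume_def)
  qed
  have restr: "(\<integral>\<^sup>+p. h p \<partial>M) = (\<integral>\<^sup>+p. h p \<partial>density M (indicator (fst c)))"
    if "sets M = sets borel" for M :: "'a measure"
  proof -
    have "indicator (fst c) \<in> borel_measurable M" "h \<in> borel_measurable M"
      using O h(1) that by (simp_all cong: measurable_cong_sets)
    then have "(\<integral>\<^sup>+p. h p \<partial>density M (indicator (fst c))) = (\<integral>\<^sup>+p. indicator (fst c) p * h p \<partial>M)"
      by (rule nn_integral_density)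
    also have "\<dots> = (\<integral>\<^sup>+p. h p \<partial>M)"
      by (rule nn_integral_cong) (use h(2) in \<open>auto simp: indicator_def\<close>)
    finally show ?thesis by (rule sym)
  qed
  have "(\<integral>\<^sup>+p. h p \<partial>?V) = (\<integral>\<^sup>+p. h p \<partial>chart_volume g c)"
    using restr[OF sV] restr[of "chart_volume g c"] eq by (simp add: chart_volume_def)
  then show ?thesis using nn_integral_chart_volume[OF A g c h(1)] by simp
qed

section \<open>Balls sharing the mass of an atomless measure\<close>

text \<open>By compactness for the ball of radius 4, and by scaling for all others.\<close>

lemma ball_covering_number:
  obtains K :: nat where "\<And>(x::'b::euclidean_space) r. 0 < r \<Longrightarrow>
     \<exists>F. finite F \<and> card F \<le> K \<and> ball x (4 * r) \<subseteq> (\<Union>y\<in>F. ball y (r / 2))"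
proof -
  obtain T :: "'b set" where T: "finite T" "cball 0 4 \<subseteq> (\<Union>y\<in>T. ball y (1/2))"
  proof (rule compactE_image[of "cball (0::'b) 4" UNIV "\<lambda>y. ball y (1/2)"])
    show "cball (0::'b) 4 \<subseteq> (\<Union>y\<in>UNIV. ball y (1/2))"
    proof
      fix x :: 'b show "x \<in> (\<Union>y\<in>UNIV. ball y (1/2))" by (rule UN_I[of x]) auto
    qed
  qed (use that in auto)
  have "\<exists>F. finite F \<and> card F \<le> card T \<and> ball x (4 * r) \<subseteq> (\<Union>y\<in>F. ball y (r / 2))"
    if r: "0 < r" for x :: 'b and r
  proof (intro exI conjI subsetI)
    let ?F = "(\<lambda>y. x + r *\<^sub>R y) ` T"
    show "finite ?F" "card ?F \<le> card T" using T(1) by (auto intro: card_image_le)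
    fix z assume z: "z \<in> ball x (4 * r)"
    define u where "u = (z - x) /\<^sub>R r"
    have zu: "z = x + r *\<^sub>R u" using r by (simp add: u_def)
    have "norm u \<le> 4" using z r by (simp add: zu dist_norm)
    then have "u \<in> cball 0 4" by simp
    then obtain y where y: "y \<in> T" "u \<in> ball y (1/2)" using T(2) by (meson UN_E subsetD)
    have "dist (x + r *\<^sub>R y) z = r * dist y u"
      using r by (simp add: zu dist_norm scaleR_diff_right[symmetric])
    also have "\<dots> < r * (1/2)" using y(2) r by (intro mult_strict_left_mono) auto
    finally have "z \<in> ball (x + r *\<^sub>R y) (r / 2)" by simp
    then show "z \<in> (\<Union>y\<in>?F. ball y (r / 2))" using y(1) by (intro UN_I[of "x + r *\<^sub>R y"]) auto
  qed
  then show ?thesis by (rule that)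
qed

text \<open>Otherwise balls with radii tending to zero would each carry mass \<open>\<delta>\<close>. Their centres stay bounded and
  accumulate at a point, and this point would be an atom.\<close>

lemma atomless_small_balls:
  fixes M :: "'b::euclidean_space measure"
  assumes M: "finite_measure M" "sets M = sets borel"
    and atomless: "\<And>x. measure M {x} = 0"
    and conc: "measure M (- ball x0 R) = 0" and R: "0 < R" and \<delta>: "0 < \<delta>"
  shows "\<exists>l. \<forall>x. measure M (ball x (R / 2 ^ l)) < \<delta>"
proof (rule ccontr)
  assume "\<not> ?thesis"
  then have ex: "\<exists>x. \<delta> \<le> measure M (ball x (R / 2 ^ l))" for l by (simp add: not_less)
  define x where "x l = (SOME x. \<delta> \<le> measure M (ball x (R / 2 ^ l)))" for l
  have x: "\<delta> \<le> measure M (ball (x l) (R / 2 ^ l))" for l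
    unfolding x_def by (rule someI_ex[OF ex])
  interpret finite_measure M by (rule M(1))
  have sM[simp]: "S \<in> sets M" if "S \<in> sets borel" for S using that M(2) by simp
  have Rl: "R / 2 ^ l \<le> R" for l using R by (simp add: divide_le_eq)
  have xb: "x l \<in> cball x0 (2 * R)" for l
  proof (rule ccontr)
    assume far: "x l \<notin> cball x0 (2 * R)"
    have "ball (x l) (R / 2 ^ l) \<subseteq> - ball x0 R"
    proof
      fix z assume z: "z \<in> ball (x l) (R / 2 ^ l)"
      have "dist x0 (x l) \<le> dist x0 z + dist z (x l)" by (rule dist_triangle)
      then show "z \<in> - ball x0 R" using z far Rl[of l] by (simp add: dist_commute)
    qed
    then have "measure M (ball (x l) (R / 2 ^ l)) \<le> measure M (- ball x0 R)"
      by (intro finite_measure_mono) auto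
    then show False using x[of l] \<delta> conc by simp
  qed
  obtain y s where s: "strict_mono s" "(x \<circ> s) \<longlonglongrightarrow> y"
  proof -
    have "\<exists>l\<in>cball x0 (2 * R). \<exists>s. strict_mono s \<and> (x \<circ> s) \<longlonglongrightarrow> l"
      using compact_cball[of x0 "2 * R"] xb unfolding compact_def by simp
    then show ?thesis by (elim bexE exE conjE) (rule that)
  qed
  have big: "\<delta> \<le> measure M (cball y \<rho>)" if \<rho>: "0 < \<rho>" for \<rho>
  proof -
    have "\<forall>\<^sub>F n in sequentially. dist ((x \<circ> s) n) y < \<rho> / 2" by (rule tendstoD[OF s(2)]) (use \<rho> in simp)
    moreover have "(\<lambda>n. R / 2 ^ s n) \<longlonglongrightarrow> 0"
    proof -
      have "(\<lambda>n. R * (1 / 2) ^ n) \<longlonglongrightarrow> R * 0" by (intro tendsto_intros LIMSEQ_power_zero) simp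
      then have "(\<lambda>n. R / 2 ^ n) \<longlonglongrightarrow> 0" by (simp add: power_one_over)
      from LIMSEQ_subseq_LIMSEQ[OF this s(1)] show ?thesis by (simp add: o_def)
    qed
    then have "\<forall>\<^sub>F n in sequentially. R / 2 ^ s n < \<rho> / 2" by (rule order_tendstoD(2)) (use \<rho> in simp)
    ultimately have "\<forall>\<^sub>F n in sequentially. dist ((x \<circ> s) n) y < \<rho> / 2 \<and> R / 2 ^ s n < \<rho> / 2"
      by (rule eventually_conj)
    then obtain n where n: "dist (x (s n)) y < \<rho> / 2" "R / 2 ^ s n < \<rho> / 2"
      by (auto simp: eventually_sequentially)
    have "ball (x (s n)) (R / 2 ^ s n) \<subseteq> cball y \<rho>"
    proof
      fix z assume "z \<in> ball (x (s n)) (R / 2 ^ s n)"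
      then have "dist (x (s n)) z < \<rho> / 2" using n(2) by (simp only: mem_ball)
      then have "dist y z \<le> \<rho>"
        using n(1) dist_triangle[of y z "x (s n)"] unfolding dist_commute[of "x (s n)" y] by linarith
      then show "z \<in> cball y \<rho>" by simp
    qed
    then have "measure M (ball (x (s n)) (R / 2 ^ s n)) \<le> measure M (cball y \<rho>)"
      by (intro finite_measure_mono) auto
    then show ?thesis using x[of "s n"] by linarith
  qed
  have "(\<lambda>n. measure M (cball y (1 / Suc n))) \<longlonglongrightarrow> measure M (\<Inter>n. cball y (1 / Suc n))"
  proof (rule finite_Lim_measure_decseq)
    show "decseq (\<lambda>n. cball y (1 / real (Suc n)))"
      unfolding decseq_def by (intro allI impI subset_cball) (simp add: frac_le)
  qed auto
  moreover have "(\<Inter>n. cball y (1 / Suc n)) = {y}"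
  proof -
    have "z = y" if "\<And>n. dist y z \<le> 1 / real (Suc n)" for z
    proof (rule ccontr)
      assume "z \<noteq> y"
      then obtain n where "1 / real (Suc n) < dist y z" using nat_approx_posE[of "dist y z"] by auto
      then show False using that[of n] by simp
    qed
    then show ?thesis by auto
  qed
  ultimately have "(\<lambda>n. measure M (cball y (1 / Suc n))) \<longlonglongrightarrow> 0" using atomless by simp
  moreover have "\<forall>n. \<delta> \<le> measure M (cball y (1 / Suc n))" using big by simp
  ultimately have "\<delta> \<le> 0" by (intro LIMSEQ_le_const[of _ 0]) auto
  then show False using \<delta> by simp
qed

text \<open>Choose the smallest radius \<open>R/2\<^sup>m\<close> for which some ball carries mass \<open>\<delta>\<close>. No ball of half that radius
  does, and the ball of four times the radius is covered by \<open>K\<close> such balls.\<close>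

lemma select_ball:
  fixes M :: "'b::euclidean_space measure"
  assumes M: "finite_measure M" "sets M = sets borel"
    and atomless: "\<And>x. measure M {x} = 0"
    and conc: "measure M (- ball x0 R) = 0" and R: "0 < R" and \<delta>: "0 < \<delta>" "\<delta> \<le> measure M (ball x0 R)"
    and K: "\<And>(x::'b) r. 0 < r \<Longrightarrow>
     \<exists>F. finite F \<and> card F \<le> K \<and> ball x (4 * r) \<subseteq> (\<Union>y\<in>F. ball y (r / 2))"
  obtains x r where "0 < r" "r \<le> R" "\<delta> \<le> measure M (ball x r)" "measure M (ball x (4 * r)) \<le> K * \<delta>"
proof -
  interpret finite_measure M by (rule M(1))
  have sM[simp]: "S \<in> sets M" if "S \<in> sets borel" for S using that M(2) by simp
  let ?P = "\<lambda>l. \<forall>x. measure M (ball x (R / 2 ^ l)) < \<delta>"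
  \<comment> \<open>the first dyadic radius at which all balls carry less than \<open>\<delta>\<close>; one step before, some ball does not\<close>
  define l where "l = (LEAST l. ?P l)"
  obtain l0 where l0: "?P l0" using atomless_small_balls[OF M atomless conc R \<delta>(1)] by (elim exE)
  have Pl: "?P l" unfolding l_def by (rule LeastI[of ?P, OF l0])
  have "l \<noteq> 0"
  proof
    assume "l = 0"
    then have "measure M (ball x0 R) < \<delta>" using spec[OF Pl, of x0] by simp
    then show False using \<delta>(2) by simp
  qed
  then obtain m where m: "l = Suc m" by (cases l) auto
  have "\<not> ?P m" by (rule not_less_Least) (simp only: l_def[symmetric] m lessI)
  then obtain x where x: "\<delta> \<le> measure M (ball x (R / 2 ^ m))" by (auto simp: not_less)
  let ?r = "R / 2 ^ m"
  have r: "0 < ?r" "?r \<le> R" using R by (simp_all add: divide_le_eq)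
  obtain F where F: "finite F" "card F \<le> K" "ball x (4 * ?r) \<subseteq> (\<Union>y\<in>F. ball y (?r / 2))"
    using K[OF r(1), of x] by (elim exE conjE)
  have "measure M (ball x (4 * ?r)) \<le> measure M (\<Union>y\<in>F. ball y (?r / 2))"
    by (intro finite_measure_mono F(3)) (use F(1) in auto)
  also have "\<dots> \<le> (\<Sum>y\<in>F. measure M (ball y (?r / 2)))"
    by (rule finite_measure_subadditive_finite[OF F(1)]) auto
  also have "\<dots> \<le> (\<Sum>y\<in>F. \<delta>)"
  proof (rule sum_mono)
    fix y
    have "measure M (ball y (R / 2 ^ l)) < \<delta>" using spec[OF Pl] .
    then show "measure M (ball y (?r / 2)) \<le> \<delta>" by (simp add: m mult.commute)
  qed
  also have "\<dots> \<le> K * \<delta>" using F(2) \<delta>(1) by (simp add: mult_right_mono)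
  finally show ?thesis by (rule that[OF r x])
qed

text \<open>Each step selects a ball for the part of the measure outside the enlarged balls found before. The
  enlarged balls together contain only a controlled amount of mass, so enough is left for the next
  step.\<close>

lemma select_balls:
  fixes M :: "'b::euclidean_space measure"
  assumes M: "finite_measure M" "sets M = sets borel"
    and atomless: "\<And>x. measure M {x} = 0"
    and conc: "measure M (- ball x0 R) = 0" and R: "0 < R" and \<delta>: "0 < \<delta>"
    and K: "\<And>(x::'b) r. 0 < r \<Longrightarrow>
     \<exists>F. finite F \<and> card F \<le> K \<and> ball x (4 * r) \<subseteq> (\<Union>y\<in>F. ball y (r / 2))"
    and total: "real N * K * \<delta> + \<delta> \<le> measure M (ball x0 R)"
  shows "\<exists>x r. (\<forall>j<N. 0 < r j \<and> r j \<le> R \<and> \<delta> \<le> measure M (ball (x j) (r j) - (\<Union>i<j. ball (x i) (4 * r i)))) \<and>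
     measure M (\<Union>i<N. ball (x i) (4 * r i)) \<le> real N * K * \<delta>"
  using total
proof (induction N)
  case 0
  then show ?case by simp
next
  case (Suc N)
  interpret finite_measure M by (rule M(1))
  have sM[simp]: "S \<in> sets M" if "S \<in> sets borel" for S using that M(2) by simp
  have spM: "space M = UNIV" using M(2) sets_eq_imp_space_eq by fastforce
  have "real N * K * \<delta> + \<delta> \<le> measure M (ball x0 R)"
  proof -
    have "real N * K * \<delta> \<le> real (Suc N) * K * \<delta>" using \<delta> by (intro mult_right_mono) auto
    then show ?thesis using Suc.prems by linarith
  qed
  from Suc.IH[OF this] obtain x r where
    xr': "\<forall>j<N. 0 < r j \<and> r j \<le> R \<and> \<delta> \<le> measure M (ball (x j) (r j) - (\<Union>i<j. ball (x i) (4 * r i)))"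
      and Uxr: "measure M (\<Union>i<N. ball (x i) (4 * r i)) \<le> real N * K * \<delta>"
    by (elim exE conjE) (rule that)
  have xr: "0 < r j \<and> r j \<le> R \<and> \<delta> \<le> measure M (ball (x j) (r j) - (\<Union>i<j. ball (x i) (4 * r i)))"
    if "j < N" for j using xr' that by simp
  let ?U = "\<Union>i<N. ball (x i) (4 * r i)"
  have U: "?U \<in> sets borel" by auto
  \<comment> \<open>the mass that is left outside the enlarged balls\<close>
  let ?M = "density M (indicator (- ?U))"
  have mM: "emeasure ?M S = emeasure M (S - ?U)" if "S \<in> sets borel" for S
  proof -
    have "emeasure ?M S = (\<integral>\<^sup>+x. indicator (- ?U) x * indicator S x \<partial>M)"
    proof (rule emeasure_density)
      have "- ?U \<in> sets borel" using U by (rule borel_comp)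
      then show "indicator (- ?U) \<in> borel_measurable M" by (intro borel_measurable_indicator sM)
      show "S \<in> sets M" using that by (rule sM)
    qed
    also have "\<dots> = (\<integral>\<^sup>+x. indicator (S - ?U) x \<partial>M)"
      by (rule nn_integral_cong) (auto simp: indicator_def)
    also have "\<dots> = emeasure M (S - ?U)" using that U by (intro nn_integral_indicator) auto
    finally show ?thesis .
  qed
  then have mM': "measure ?M S = measure M (S - ?U)" if "S \<in> sets borel" for S
    using that by (simp add: measure_def)
  have fin: "finite_measure ?M"
    by (rule finite_measureI) (use mM[of UNIV] spM in simp)
  obtain y s where ys: "0 < s" "s \<le> R" "\<delta> \<le> measure ?M (ball y s)" "measure ?M (ball y (4 * s)) \<le> K * \<delta>"
  proof (rule select_ball[of ?M x0 R \<delta> K, OF fin _ _ _ R \<delta> _ K])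
    show "sets ?M = sets borel" using M(2) by simp
    show "measure ?M {z} = 0" for z
    proof -
      have "measure M ({z} - ?U) \<le> measure M {z}" by (intro finite_measure_mono) auto
      then show ?thesis using mM'[of "{z}"] atomless[of z] by (simp add: measure_le_0_iff)
    qed
    have "measure M (- ball x0 R - ?U) \<le> measure M (- ball x0 R)"
      by (intro finite_measure_mono) auto
    then show "measure ?M (- ball x0 R) = 0" using mM'[of "- ball x0 R"] conc by (simp add: measure_le_0_iff)
    have "measure M (ball x0 R) \<le> measure M ((ball x0 R - ?U) \<union> ?U)"
      using U by (intro finite_measure_mono) auto
    also have "\<dots> \<le> measure M (ball x0 R - ?U) + measure M ?U"
      using U by (intro measure_Un_le) auto
    finally have "measure M (ball x0 R) - real N * K * \<delta> \<le> measure ?M (ball x0 R)"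
      using Uxr mM'[of "ball x0 R"] by simp
    moreover have "real (Suc N) * K * \<delta> = real N * K * \<delta> + K * \<delta>" by (simp add: algebra_simps)
    moreover have "0 \<le> K * \<delta>" using \<delta> by simp
    ultimately show "\<delta> \<le> measure ?M (ball x0 R)" using Suc.prems by linarith
  qed (assumption | rule that)+
  let ?x = "x(N := y)" and ?r = "r(N := s)"
  have Ueq: "(\<Union>i<j. ball (?x i) (4 * ?r i)) = (\<Union>i<j. ball (x i) (4 * r i))" if "j \<le> N" for j
    using that by (intro SUP_cong) auto
  show ?case
  proof (intro exI[of _ ?x] exI[of _ ?r] conjI allI impI)
    fix j assume j: "j < Suc N"
    show "0 < ?r j" "?r j \<le> R" using xr[of j] ys j by (auto simp: less_Suc_eq)
    show "\<delta> \<le> measure M (ball (?x j) (?r j) - (\<Union>i<j. ball (?x i) (4 * ?r i)))"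
    proof (cases "j = N")
      case True
      then show ?thesis using Ueq[of N] ys(3) mM'[of "ball y s"] by simp
    next
      case False
      then have "j < N" using j by simp
      then show ?thesis using Ueq[of j] xr[of j] by simp
    qed
  next
    have "(\<Union>i<Suc N. ball (?x i) (4 * ?r i)) = (ball y (4 * s) - ?U) \<union> ?U"
      using Ueq[of N] by (auto simp: lessThan_Suc)
    then have "measure M (\<Union>i<Suc N. ball (?x i) (4 * ?r i)) \<le> measure M (ball y (4 * s) - ?U) + measure M ?U"
      using U by (simp only:) (intro measure_Un_le, auto)
    also have "\<dots> \<le> K * \<delta> + real N * K * \<delta>"
      using Uxr ys(4) mM'[of "ball y (4 * s)"] by simp
    finally show "measure M (\<Union>i<Suc N. ball (?x i) (4 * ?r i)) \<le> real (Suc N) * K * \<delta>"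
      by (simp add: algebra_simps)
  qed
qed

section \<open>Test functions with pairwise disjoint supports\<close>

definition scaled_bump :: "('b::real_normed_vector \<Rightarrow> real) \<Rightarrow> 'b \<Rightarrow> real \<Rightarrow> 'b \<Rightarrow> real" where
  "scaled_bump \<eta> y s x = \<eta> ((x - y) /\<^sub>R s)"

lemma Ck_on_scaled_bump:
  fixes \<eta> :: "'b::euclidean_space \<Rightarrow> real"
  assumes "\<And>k. Ck_on k UNIV \<eta>"
  shows "Ck_on k UNIV (scaled_bump \<eta> y s)"
proof -
  have "Ck_on k UNIV (\<lambda>x::'b. inverse s *\<^sub>R x + (- (inverse s *\<^sub>R y)))"
    by (intro Ck_on_add Ck_on_const Ck_on_bounded_linear bounded_linear_scaleR_right open_UNIV)
  then have "Ck_on k UNIV (\<lambda>x::'b. (x - y) /\<^sub>R s)" by (simp add: scaleR_diff_right)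
  from Ck_on_compose[OF open_UNIV this assms] show ?thesis by (simp add: scaled_bump_def[abs_def])
qed

lemma norm_rescaled: "0 < s \<Longrightarrow> norm ((x - y) /\<^sub>R s) = dist y x / s"
  by (simp only: norm_scaleR) (simp add: dist_norm norm_minus_commute divide_inverse)

lemma scaled_bump_derivative_le:
  fixes \<eta> :: "'b::euclidean_space \<Rightarrow> real"
  assumes \<eta>: "\<And>k. Ck_on k UNIV \<eta>" "\<And>x v. \<bar>frechet_derivative \<eta> (at x) v\<bar> \<le> L * norm v"
    "\<And>x. norm x > 2 \<Longrightarrow> frechet_derivative \<eta> (at x) = (\<lambda>v. 0)" and s: "0 < s"
  shows "\<bar>frechet_derivative (scaled_bump \<eta> y s) (at x) v\<bar> \<le> (if x \<in> cball y (2 * s) then L / s else 0) * norm v"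
proof -
  let ?z = "(x - y) /\<^sub>R s"
  have "((\<lambda>x. (x - y) /\<^sub>R s) has_derivative (\<lambda>v. v /\<^sub>R s)) (at x)"
    by (auto intro!: derivative_eq_intros)
  moreover have "(\<eta> has_derivative frechet_derivative \<eta> (at ?z)) (at ?z)"
    by (rule Ck_on_Suc_derivative[OF \<eta>(1)]) simp
  ultimately have "(scaled_bump \<eta> y s has_derivative (\<lambda>v. frechet_derivative \<eta> (at ?z) (v /\<^sub>R s))) (at x)"
    unfolding scaled_bump_def[abs_def] by (rule has_derivative_compose)
  then have eq: "frechet_derivative (scaled_bump \<eta> y s) (at x) v = frechet_derivative \<eta> (at ?z) (v /\<^sub>R s)"
    by (simp add: frechet_derivative_eqI)
  show ?thesis
  proof (cases "x \<in> cball y (2 * s)")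
    case True
    have "\<bar>frechet_derivative \<eta> (at ?z) (v /\<^sub>R s)\<bar> \<le> L * norm (v /\<^sub>R s)" by (rule \<eta>(2))
    also have "\<dots> = L / s * norm v" using s by (simp add: divide_inverse)
    finally show ?thesis using True eq by simp
  next
    case False
    then have "norm ?z > 2" using s by (simp only: norm_rescaled[OF s]) (simp add: field_simps)
    then show ?thesis using False eq \<eta>(3) by simp
  qed
qed

lemma prod_derivative_le:
  fixes u :: "'i \<Rightarrow> 'b::real_normed_vector \<Rightarrow> real"
  assumes "finite I" "\<And>i k. i \<in> I \<Longrightarrow> Ck_on k UNIV (u i)" "\<And>i x. i \<in> I \<Longrightarrow> \<bar>u i x\<bar> \<le> 1"
    "\<And>i x v. i \<in> I \<Longrightarrow> \<bar>frechet_derivative (u i) (at x) v\<bar> \<le> \<beta> i x * norm v"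
  shows "\<bar>frechet_derivative (\<lambda>x. \<Prod>i\<in>I. u i x) (at x) v\<bar> \<le> (\<Sum>i\<in>I. \<beta> i x) * norm v"
  using assms
proof (induction I)
  case empty
  then show ?case by (simp add: frechet_derivative_const)
next
  case (insert j I)
  let ?w = "\<lambda>x. \<Prod>i\<in>I. u i x"
  have Cw: "Ck_on k UNIV ?w" for k by (rule Ck_on_prod) (use insert in auto)
  have w1: "\<bar>?w x\<bar> \<le> 1"
    unfolding abs_prod by (rule prod_le_1) (use insert.prems(2) in auto)
  have dw: "\<bar>frechet_derivative ?w (at x) v\<bar> \<le> (\<Sum>i\<in>I. \<beta> i x) * norm v"
    by (rule insert.IH) (use insert.prems in auto)
  have dj: "\<bar>frechet_derivative (u j) (at x) v\<bar> \<le> \<beta> j x * norm v" and uj: "\<bar>u j x\<bar> \<le> 1"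
    using insert.prems by auto
  have Cj: "Ck_on (Suc 0) UNIV (u j)" using insert.prems(1)[of j] by blast
  have "((\<lambda>x. u j x * ?w x) has_derivative
      (\<lambda>v. u j x * frechet_derivative ?w (at x) v + frechet_derivative (u j) (at x) v * ?w x)) (at x)"
    by (rule has_derivative_mult)
      (rule Ck_on_Suc_derivative[OF Cj UNIV_I], rule Ck_on_Suc_derivative[OF Cw UNIV_I])
  then have "frechet_derivative (\<lambda>x. u j x * ?w x) (at x) v =
      u j x * frechet_derivative ?w (at x) v + frechet_derivative (u j) (at x) v * ?w x"
    by (simp add: frechet_derivative_eqI)
  moreover have "(\<lambda>x. \<Prod>i\<in>insert j I. u i x) = (\<lambda>x. u j x * ?w x)" using insert.hyps by simp
  moreover have "\<bar>u j x * frechet_derivative ?w (at x) v + frechet_derivative (u j) (at x) v * ?w x\<bar> \<le>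
      1 * \<bar>frechet_derivative ?w (at x) v\<bar> + \<bar>frechet_derivative (u j) (at x) v\<bar> * 1"
    unfolding abs_mult[symmetric]
    by (rule order_trans[OF abs_triangle_ineq], unfold abs_mult, intro add_mono mult_mono)
      (use uj w1 in auto)
  ultimately have "\<bar>frechet_derivative (\<lambda>x. \<Prod>i\<in>insert j I. u i x) (at x) v\<bar> \<le>
      (\<Sum>i\<in>I. \<beta> i x) * norm v + \<beta> j x * norm v"
    using dw dj by simp
  then show ?case using insert.hyps by (simp add: algebra_simps)
qed

definition test_family ::
    "nat \<Rightarrow> 'b::euclidean_space set \<Rightarrow> (nat \<Rightarrow> 'b \<Rightarrow> real) \<Rightarrow> ('b \<Rightarrow> real) \<Rightarrow> bool" where
  "test_family N S \<phi> \<beta> \<longleftrightarrow> \<beta> \<in> borel_measurable borel \<and>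
     (\<forall>j<N. test_function S \<beta> (\<phi> j) \<and> (\<forall>i<j. \<forall>x. \<phi> i x * \<phi> j x = 0))"

text \<open>The function \<open>\<phi>\<^sub>j\<close> is a bump at the \<open>j\<close>-th ball, multiplied by cutoffs that vanish on the balls
  \<open>B(x\<^sub>i, 2r\<^sub>i)\<close> and equal 1 outside \<open>B(x\<^sub>i, 4r\<^sub>i)\<close> for \<open>i < j\<close>. As \<open>\<phi>\<^sub>i\<close> lives on \<open>B(x\<^sub>i, 2r\<^sub>i)\<close>, the products
  \<open>\<phi>\<^sub>i \<phi>\<^sub>j\<close> vanish, and \<open>\<phi>\<^sub>j\<close> is still 1 on the share of mass of its ball.\<close>

lemma test_family_from_balls:
  fixes x :: "nat \<Rightarrow> 'b::euclidean_space"
  assumes \<eta>: "\<And>k. Ck_on k UNIV \<eta>" "\<And>x::'b. 0 \<le> \<eta> x" "\<And>x. \<eta> x \<le> 1"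
    "\<And>x. norm x \<le> 1 \<Longrightarrow> \<eta> x = 1" "\<And>x. norm x \<ge> 2 \<Longrightarrow> \<eta> x = 0"
    "0 < L" "\<And>x v. \<bar>frechet_derivative \<eta> (at x) v\<bar> \<le> L * norm v"
    "\<And>x. norm x > 2 \<Longrightarrow> frechet_derivative \<eta> (at x) = (\<lambda>v. 0)"
    and r: "\<And>j. j < N \<Longrightarrow> 0 < r j"
    and S: "\<And>j. j < N \<Longrightarrow> cball (x j) (2 * r j) \<subseteq> S"
  defines "\<beta> \<equiv> \<lambda>z. \<Sum>i<N. if z \<in> cball (x i) (4 * r i) then L / r i else 0"
  shows "\<exists>\<phi>. test_family N S \<phi> \<beta> \<and>
    (\<forall>j<N. \<forall>z \<in> ball (x j) (r j) - (\<Union>i<j. ball (x i) (4 * r i)). \<phi> j z = 1)"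
proof -
  define u where "u j i = (if i = j then scaled_bump \<eta> (x j) (r j)
      else (\<lambda>z. 1 + (-1) * scaled_bump \<eta> (x i) (2 * r i) z))" for i j
  define \<phi> where "\<phi> j = (\<lambda>z. \<Prod>i\<in>{..j}. u j i z)" for j
  have Cu: "Ck_on k UNIV (u j i)" for i j k
  proof -
    have "Ck_on k UNIV (\<lambda>z. 1 + (-1) * scaled_bump \<eta> (x i) (2 * r i) z)"
      by (intro Ck_on_add Ck_on_mult Ck_on_const Ck_on_scaled_bump \<eta>(1) open_UNIV)
    then show ?thesis unfolding u_def using Ck_on_scaled_bump[OF \<eta>(1)] by simp
  qed
  have sb: "0 \<le> scaled_bump \<eta> y s z" "scaled_bump \<eta> y s z \<le> 1" for y s z
    by (auto simp: scaled_bump_def \<eta>)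
  have u1: "\<bar>u j i z\<bar> \<le> 1" for i j z
    using sb[of "x j" "r j" z] sb[of "x i" "2 * r i" z] by (auto simp: u_def)
  have one: "scaled_bump \<eta> y s z = 1" if "dist y z \<le> s" "0 < s" for y s z
    unfolding scaled_bump_def
    by (rule \<eta>(4)) (simp only: norm_rescaled[OF that(2)], use that in \<open>simp add: field_simps\<close>)
  have zero: "scaled_bump \<eta> y s z = 0" if "2 * s \<le> dist y z" "0 < s" for y s z
    unfolding scaled_bump_def
    by (rule \<eta>(5)) (simp only: norm_rescaled[OF that(2)], use that in \<open>simp add: field_simps\<close>)
  \<comment> \<open>a common bound for the gradients of both kinds of factors at the \<open>i\<close>-th ball\<close>
  let ?b = "\<lambda>i z. if z \<in> cball (x i) (4 * r i) then L / r i else 0"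
  have b0: "0 \<le> ?b i z" if "i < N" for i z using r[OF that] \<eta>(6) by simp
  have du: "\<bar>frechet_derivative (u j i) (at z) v\<bar> \<le> ?b i z * norm v" if i: "i < N" for i j z v
  proof (cases "i = j")
    case True
    have "\<bar>frechet_derivative (scaled_bump \<eta> (x i) (r i)) (at z) v\<bar> \<le>
        (if z \<in> cball (x i) (2 * r i) then L / r i else 0) * norm v"
      by (rule scaled_bump_derivative_le[OF \<eta>(1,7,8) r[OF i]])
    also have "\<dots> \<le> ?b i z * norm v"
      by (rule mult_right_mono) (use r[OF i] \<eta>(6) in auto)
    finally show ?thesis using True by (simp add: u_def)
  next
    case False
    let ?s = "scaled_bump \<eta> (x i) (2 * r i)"
    have r2: "0 < 2 * r i" using r[OF i] by simp
    have "(?s has_derivative frechet_derivative ?s (at z)) (at z)"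
      by (rule Ck_on_Suc_derivative[OF Ck_on_scaled_bump[OF \<eta>(1)] UNIV_I])
    then have "((\<lambda>z. 1 + (-1) * ?s z) has_derivative (\<lambda>v. (-1) * frechet_derivative ?s (at z) v)) (at z)"
      by (auto intro!: derivative_eq_intros)
    then have "frechet_derivative (u j i) (at z) v = - frechet_derivative ?s (at z) v"
      using False by (simp add: u_def frechet_derivative_eqI)
    moreover have "\<bar>frechet_derivative ?s (at z) v\<bar> \<le>
        (if z \<in> cball (x i) (2 * (2 * r i)) then L / (2 * r i) else 0) * norm v"
      by (rule scaled_bump_derivative_le[OF \<eta>(1,7,8) r2])
    moreover have "(if z \<in> cball (x i) (2 * (2 * r i)) then L / (2 * r i) else 0) * norm v \<le> ?b i z * norm v"
      by (rule mult_right_mono) (use r[OF i] \<eta>(6) in \<open>auto simp: field_simps\<close>)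
    ultimately show ?thesis by simp
  qed
  have supp: "\<phi> j z = 0" if "2 * r j \<le> dist (x j) z" "j < N" for j z
  proof -
    have "u j j z = 0" using zero[OF that(1) r[OF that(2)]] by (simp add: u_def)
    then show ?thesis unfolding \<phi>_def by (intro prod_zero) auto
  qed
  have "test_family N S \<phi> \<beta>"
    unfolding test_family_def test_function_def
  proof (intro conjI allI impI)
    show "\<beta> \<in> borel_measurable borel" unfolding \<beta>_def
      by (intro borel_measurable_sum measurable_If_set borel_measurable_const) simp
    fix j assume j: "j < N"
    show "Ck_on k UNIV (\<phi> j)" for k
      unfolding \<phi>_def by (rule Ck_on_prod) (use Cu in auto)
    show "\<phi> j z = 0" if "z \<notin> S" for z
    proof (rule supp[OF _ j])
      show "2 * r j \<le> dist (x j) z" using S[OF j] that by (auto simp: subset_iff) (meson linear)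
    qed
    show "\<bar>frechet_derivative (\<phi> j) (at z) v\<bar> \<le> \<beta> z * norm v" for z v
    proof -
      have "\<bar>frechet_derivative (\<phi> j) (at z) v\<bar> \<le> (\<Sum>i\<in>{..j}. ?b i z) * norm v"
        unfolding \<phi>_def by (rule prod_derivative_le[OF finite_atMost Cu u1 du]) (use j in auto)
      also have "\<dots> \<le> \<beta> z * norm v"
        unfolding \<beta>_def by (intro mult_right_mono sum_mono2) (use j b0 in auto)
      finally show ?thesis .
    qed
    show "\<phi> i z * \<phi> j z = 0" if i: "i < j" for i z
    proof (cases "2 * r i \<le> dist (x i) z")
      case True
      then show ?thesis using supp[of i z] i j by simp
    next
      case False
      then have "u j i z = 0" using one[of "x i" z "2 * r i"] r[of i] i j by (simp add: u_def)
      then have "\<phi> j z = 0" unfolding \<phi>_def using i by (intro prod_zero) auto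
      then show ?thesis by simp
    qed
  qed
  moreover have "\<phi> j z = 1" if j: "j < N" and z: "z \<in> ball (x j) (r j) - (\<Union>i<j. ball (x i) (4 * r i))" for j z
    unfolding \<phi>_def
  proof (rule prod.neutral, rule ballI)
    fix i assume i: "i \<in> {..j}"
    show "u j i z = 1"
    proof (cases "i = j")
      case True
      then show ?thesis using one[of "x j" z "r j"] z r[OF j] by (simp add: u_def)
    next
      case False
      then have "i < j" using i by simp
      then have "z \<notin> ball (x i) (4 * r i)" "0 < r i" using z r[of i] j by auto
      then have "2 * (2 * r i) \<le> dist (x i) z" "0 < 2 * r i" by auto
      then show ?thesis using False zero[of "2 * r i" "x i" z] by (simp add: u_def)
    qed
  qed
  ultimately show ?thesis by blast
qed

text \<open>A cutoff at scale \<open>r\<close> has gradient of size \<open>1/r\<close> on a set of volume \<open>r\<^sup>n\<close>, hence energy of size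
  \<open>r\<^sup>n\<^sup>-\<^sup>2\<close>. This is where dimension at least 3 enters: the energy is at most a multiple of \<open>R\<close>, however
  small the radii are.\<close>

lemma gradient_bound_energy:
  fixes x :: "nat \<Rightarrow> 'b::euclidean_space"
  assumes n: "3 \<le> DIM('b)" and r: "\<And>i. i < N \<Longrightarrow> 0 < r i \<and> r i \<le> R" and R: "R \<le> 1"
  shows "(\<integral>\<^sup>+z. ennreal ((\<Sum>i<N. if z \<in> cball (x i) (4 * r i) then L / r i else 0)\<^sup>2) \<partial>lborel)
    \<le> ennreal (real N * real N * (L\<^sup>2 * 4 ^ DIM('b) * unit_ball_vol (DIM('b))) * R)"
proof -
  let ?b = "\<lambda>i z. if z \<in> cball (x i) (4 * r i) then L / r i else 0"
  let ?C = "L\<^sup>2 * 4 ^ DIM('b) * unit_ball_vol (DIM('b))"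
  have C0: "0 \<le> ?C" by simp
  have one: "(\<integral>\<^sup>+z. ennreal ((?b i z)\<^sup>2) \<partial>lborel) \<le> ennreal (?C * R)" if i: "i < N" for i
  proof -
    have ri: "0 < r i" "r i \<le> R" using r[OF i] by auto
    have "(\<integral>\<^sup>+z. ennreal ((?b i z)\<^sup>2) \<partial>lborel) = (\<integral>\<^sup>+z. ennreal ((L / r i)\<^sup>2) * indicator (cball (x i) (4 * r i)) z \<partial>lborel)"
      by (rule nn_integral_cong) (auto simp: indicator_def)
    also have "\<dots> = ennreal ((L / r i)\<^sup>2) * emeasure lborel (cball (x i) (4 * r i))"
      by (rule nn_integral_cmult_indicator) simp
    also have "\<dots> = ennreal ((L / r i)\<^sup>2 * (unit_ball_vol (DIM('b)) * (4 * r i) ^ DIM('b)))"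
      using ri by (simp add: emeasure_cball ennreal_mult')
    also have "\<dots> \<le> ennreal (?C * R)"
    proof (rule ennreal_leI)
      \<comment> \<open>splitting off three dimensions leaves one spare factor \<open>r\<close> after division by \<open>r\<^sup>2\<close>\<close>
      obtain m where m: "DIM('b) = m + 3" using n le_Suc_ex[of 3] by (auto simp: add.commute)
      have "(L / r i)\<^sup>2 * (unit_ball_vol (DIM('b)) * (4 * r i) ^ DIM('b)) = ?C * (r i ^ DIM('b) / (r i)\<^sup>2)"
        by (simp add: power_divide power_mult_distrib)
      also have "r i ^ DIM('b) / (r i)\<^sup>2 = r i * r i ^ m"
        using ri by (simp add: m power_add power2_eq_square power3_eq_cube)
      also have "r i * r i ^ m \<le> R * 1"
        using ri R by (intro mult_mono power_le_one) auto
      finally show "(L / r i)\<^sup>2 * (unit_ball_vol (DIM('b)) * (4 * r i) ^ DIM('b)) \<le> ?C * R"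
        using C0 by (simp add: mult_left_mono)
    qed
    finally show ?thesis .
  qed
  have "(\<integral>\<^sup>+z. ennreal ((\<Sum>i<N. ?b i z)\<^sup>2) \<partial>lborel) \<le> (\<integral>\<^sup>+z. (\<Sum>i<N. ennreal N * ennreal ((?b i z)\<^sup>2)) \<partial>lborel)"
  proof (rule nn_integral_mono)
    fix z
    have "ennreal ((\<Sum>i<N. ?b i z)\<^sup>2) \<le> ennreal (real N * (\<Sum>i<N. (?b i z)\<^sup>2))"
      using sum_squared_le_sum_of_squares[of "\<lambda>i. ?b i z" "{..<N}"]
      by (intro ennreal_leI) (simp add: mult.commute)
    also have "\<dots> = (\<Sum>i<N. ennreal N * ennreal ((?b i z)\<^sup>2))"
      by (subst sum_ennreal[symmetric] ennreal_mult)
        (auto simp: sum_distrib_left ennreal_mult[symmetric] sum_nonneg)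
    finally show "ennreal ((\<Sum>i<N. ?b i z)\<^sup>2) \<le> (\<Sum>i<N. ennreal N * ennreal ((?b i z)\<^sup>2))" .
  qed
  also have "\<dots> = (\<Sum>i<N. ennreal N * (\<integral>\<^sup>+z. ennreal ((?b i z)\<^sup>2) \<partial>lborel))"
    by (subst nn_integral_sum) (auto intro!: sum.cong nn_integral_cmult)
  also have "\<dots> \<le> (\<Sum>i<N. ennreal N * ennreal (?C * R))"
    by (intro sum_mono mult_left_mono one) auto
  also have "\<dots> = ennreal (real N * real N * ?C * R)"
  proof (cases "N = 0")
    case False
    then have "0 \<le> ?C * R" using C0 r[of 0] by (intro mult_nonneg_nonneg) auto
    then show ?thesis by (simp add: ennreal_of_nat_eq_real_of_nat ennreal_mult[symmetric] mult.assoc)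
  qed simp
  finally show ?thesis by simp
qed

text \<open>The constants do not depend on the measure, on the centre or on the scale \<open>R\<close>. The fraction
  \<open>\<theta> = 1/(NK + 1)\<close> leaves one share of mass after \<open>N\<close> selections that use up \<open>K\<close> shares each.\<close>

lemma concentrated_test_family:
  assumes "3 \<le> DIM('b::euclidean_space)"
  obtains \<theta> C :: real where "0 < \<theta>" "0 \<le> C"
    "\<And>(M :: 'b measure) x0 R. finite_measure M \<Longrightarrow> sets M = sets borel \<Longrightarrow> (\<forall>x. measure M {x} = 0) \<Longrightarrow>
      measure M (- ball x0 R) = 0 \<Longrightarrow> 0 < R \<Longrightarrow> R \<le> 1 \<Longrightarrow> 0 < measure M (ball x0 R) \<Longrightarrow>
      \<exists>\<phi> \<beta>. test_family N (cball x0 (4 * R)) \<phi> \<beta> \<and>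
        (\<integral>\<^sup>+z. ennreal ((\<beta> z)\<^sup>2) \<partial>lborel) \<le> ennreal (C * R) \<and>
        (\<forall>j<N. \<exists>B\<in>sets borel. (\<forall>z\<in>B. \<phi> j z = 1) \<and> \<theta> * measure M (ball x0 R) \<le> measure M B)"
proof -
  obtain \<eta> :: "'b \<Rightarrow> real" and L where \<eta>:
    "\<And>k. Ck_on k UNIV \<eta>" "\<And>x::'b. 0 \<le> \<eta> x" "\<And>x. \<eta> x \<le> 1"
    "\<And>x. norm x \<le> 1 \<Longrightarrow> \<eta> x = 1" "\<And>x. norm x \<ge> 2 \<Longrightarrow> \<eta> x = 0"
    "0 < L" "\<And>x v. \<bar>frechet_derivative \<eta> (at x) v\<bar> \<le> L * norm v"
    "\<And>x. norm x > 2 \<Longrightarrow> frechet_derivative \<eta> (at x) = (\<lambda>v. 0)"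
    by (rule exists_smooth_bump) (rule that)
  obtain K :: nat where K: "\<And>(x::'b) r. 0 < r \<Longrightarrow>
     \<exists>F. finite F \<and> card F \<le> K \<and> ball x (4 * r) \<subseteq> (\<Union>y\<in>F. ball y (r / 2))"
    by (rule ball_covering_number) (rule that)
  define \<theta> where "\<theta> = 1 / (real N * K + 1)"
  define C where "C = real N * real N * (L\<^sup>2 * 4 ^ DIM('b) * unit_ball_vol (DIM('b)))"
  have \<theta>: "0 < \<theta>" unfolding \<theta>_def by (simp add: add_nonneg_pos)
  have C: "0 \<le> C" unfolding C_def by simp
  show ?thesis
  proof (rule that[OF \<theta> C])
    fix M :: "'b measure" and x0 R
    assume M: "finite_measure M" "sets M = sets borel" and "\<forall>x. measure M {x} = 0"
      and conc: "measure M (- ball x0 R) = 0" and R: "0 < R" "R \<le> 1" and pos: "0 < measure M (ball x0 R)"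
    then have atomless: "measure M {x} = 0" for x by simp
    interpret finite_measure M by (rule M(1))
    let ?\<delta> = "\<theta> * measure M (ball x0 R)"
    have \<delta>: "0 < ?\<delta>" using \<theta> pos by simp
    have "real N * K * ?\<delta> + ?\<delta> = ((real N * K + 1) * \<theta>) * measure M (ball x0 R)" by (simp add: algebra_simps)
    moreover have "(real N * K + 1) * \<theta> = 1"
    proof -
      have "0 < real N * K + 1" by (simp add: add_nonneg_pos)
      then show ?thesis unfolding \<theta>_def by simp
    qed
    ultimately have total: "real N * K * ?\<delta> + ?\<delta> \<le> measure M (ball x0 R)" by simp
    have "\<exists>x r. (\<forall>j<N. 0 < r j \<and> r j \<le> R \<and>
        ?\<delta> \<le> measure M (ball (x j) (r j) - (\<Union>i<j. ball (x i) (4 * r i)))) \<and>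
        measure M (\<Union>i<N. ball (x i) (4 * r i)) \<le> real N * K * ?\<delta>"
      by (rule select_balls[OF M atomless conc R(1) \<delta> _ total]) (rule K)
    then obtain x r where xr: "\<forall>j<N. 0 < r j \<and> r j \<le> R \<and>
        ?\<delta> \<le> measure M (ball (x j) (r j) - (\<Union>i<j. ball (x i) (4 * r i)))"
      by (elim exE conjE) (rule that)
    have r: "0 < r j" "r j \<le> R" if "j < N" for j using xr that by auto
    have S: "cball (x j) (2 * r j) \<subseteq> cball x0 (4 * R)" if j: "j < N" for j
    proof -
      have "ball (x j) (r j) \<inter> ball x0 R \<noteq> {}"
      proof
        assume "ball (x j) (r j) \<inter> ball x0 R = {}"
        then have "ball (x j) (r j) - (\<Union>i<j. ball (x i) (4 * r i)) \<subseteq> - ball x0 R" by blast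
        then have "measure M (ball (x j) (r j) - (\<Union>i<j. ball (x i) (4 * r i))) \<le> measure M (- ball x0 R)"
          by (intro finite_measure_mono) (simp_all add: M(2) borel_comp)
        moreover have "?\<delta> \<le> measure M (ball (x j) (r j) - (\<Union>i<j. ball (x i) (4 * r i)))" using xr j by simp
        ultimately show False using \<delta> conc by linarith
      qed
      then obtain z where z: "dist (x j) z < r j" "dist x0 z < R" by auto
      show ?thesis
      proof
        fix w assume "w \<in> cball (x j) (2 * r j)"
        then have "dist (x j) w \<le> 2 * r j" by simp
        moreover have "dist x0 w \<le> dist x0 z + dist z (x j) + dist (x j) w"
          using dist_triangle[of x0 w "x j"] dist_triangle[of x0 "x j" z] by linarith
        ultimately have "dist x0 w \<le> 4 * R" using z r(2)[OF j] by (simp add: dist_commute)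
        then show "w \<in> cball x0 (4 * R)" by simp
      qed
    qed
    let ?\<beta> = "\<lambda>z. \<Sum>i<N. if z \<in> cball (x i) (4 * r i) then L / r i else 0"
    have "\<exists>\<phi>. test_family N (cball x0 (4 * R)) \<phi> ?\<beta> \<and>
        (\<forall>j<N. \<forall>z \<in> ball (x j) (r j) - (\<Union>i<j. ball (x i) (4 * r i)). \<phi> j z = 1)"
      by (rule test_family_from_balls) (fact \<eta> r(1) S)+
    then obtain \<phi> where \<phi>: "test_family N (cball x0 (4 * R)) \<phi> ?\<beta>"
      "\<forall>j<N. \<forall>z \<in> ball (x j) (r j) - (\<Union>i<j. ball (x i) (4 * r i)). \<phi> j z = 1"
      by (elim exE conjE) (rule that)
    have "(\<integral>\<^sup>+z. ennreal ((?\<beta> z)\<^sup>2) \<partial>lborel) \<le> ennreal (C * R)"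
      unfolding C_def by (rule gradient_bound_energy[OF assms _ R(2)]) (use r in blast)
    moreover have "\<exists>B\<in>sets borel. (\<forall>z\<in>B. \<phi> j z = 1) \<and> ?\<delta> \<le> measure M B" if j: "j < N" for j
    proof (rule bexI, intro conjI)
      show "\<forall>z\<in>ball (x j) (r j) - (\<Union>i<j. ball (x i) (4 * r i)). \<phi> j z = 1"
        "?\<delta> \<le> measure M (ball (x j) (r j) - (\<Union>i<j. ball (x i) (4 * r i)))"
        using \<phi>(2) xr j by blast+
    qed auto
    ultimately show "\<exists>\<phi> \<beta>. test_family N (cball x0 (4 * R)) \<phi> \<beta> \<and>
        (\<integral>\<^sup>+z. ennreal ((\<beta> z)\<^sup>2) \<partial>lborel) \<le> ennreal (C * R) \<and>
        (\<forall>j<N. \<exists>B\<in>sets borel. (\<forall>z\<in>B. \<phi> j z = 1) \<and> ?\<delta> \<le> measure M B)"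
      using \<phi>(1) by (intro exI[of _ \<phi>] exI[of _ ?\<beta>] conjI allI impI)
  qed
qed

section \<open>From test functions to eigenvalues\<close>

lemma sum_fun_apply: "(\<Sum>i\<in>I. f i) x = (\<Sum>i\<in>I. f i x)" for f :: "'i \<Rightarrow> 'a \<Rightarrow> real"
  by (induction I rule: infinite_finite_induct) auto

text \<open>Functions with disjoint supports span a space of the right dimension, and both the mass and the bound
  for the energy of a linear combination are quadratic in the coefficients.\<close>

lemma measure_eigenvalue_le:
  fixes A :: "('a::topological_space, 'n::finite) chart set" and F :: "nat \<Rightarrow> 'a \<Rightarrow> real"
  assumes smooth: "\<And>a. (\<lambda>p. \<Sum>j<k + 1. a j * F j p) \<in> smooth_functions A"
    and disj: "\<And>i j p. i < j \<Longrightarrow> j < k + 1 \<Longrightarrow> F i p * F j p = 0"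
    and B: "\<And>j. j < k + 1 \<Longrightarrow> B j \<in> sets \<mu>" "\<And>j p. j < k + 1 \<Longrightarrow> p \<in> B j \<Longrightarrow> F j p = 1"
      "\<And>j. j < k + 1 \<Longrightarrow> ennreal b \<le> emeasure \<mu> (B j)"
    and b: "0 < b" and e: "0 \<le> e"
    and energy: "\<And>a. (\<integral>\<^sup>+p. ennreal (differential_norm_sq A g (\<lambda>p. \<Sum>j<k + 1. a j * F j p) p) \<partial>riemannian_volume A g)
        \<le> ennreal (e * (\<Sum>j<k + 1. (a j)\<^sup>2))"
  shows "measure_eigenvalue A g k \<mu> \<le> ennreal (e / b)"
proof -
  let ?J = "{..<k + 1}"
  have disj': "F i p * F j p = 0" if "i \<noteq> j" "i \<in> ?J" "j \<in> ?J" for i j p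
    using disj[of i j p] disj[of j i p] that by (cases "i < j") (auto simp: mult.commute)
  have "\<exists>p. p \<in> B j" if "j \<in> ?J" for j
  proof (rule ccontr)
    assume "\<not> ?thesis"
    then have "B j = {}" by blast
    then show False using B(3)[of j] that b by simp
  qed
  then have "\<forall>j. \<exists>p. j \<in> ?J \<longrightarrow> p \<in> B j" by blast
  then obtain q where q0: "\<forall>j. j \<in> ?J \<longrightarrow> q j \<in> B j" by (elim choice[THEN exE]) (rule that)
  have q: "F j (q j) = 1" if "j \<in> ?J" for j using B(2)[of j "q j"] q0 that by simp
  have q': "F i (q j) = 0" if "i \<noteq> j" "i \<in> ?J" "j \<in> ?J" for i j
    using disj'[OF that, of "q j"] q[OF that(3)] by simp
  have inj: "inj_on F ?J"
  proof (rule inj_onI, rule ccontr)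
    fix i j assume "i \<in> ?J" "j \<in> ?J" "F i = F j" "i \<noteq> j"
    then show False using q'[of i j] q[of j] by simp
  qed
  have comb: "(\<Sum>v\<in>F ` ?J. (\<lambda>x. u v * v x)) = (\<lambda>p. \<Sum>j<k + 1. u (F j) * F j p)" for u
  proof
    fix p
    have "(\<Sum>v\<in>F ` ?J. (\<lambda>x. u v * v x)) p = (\<Sum>v\<in>F ` ?J. u v * v p)" by (rule sum_fun_apply)
    also have "\<dots> = (\<Sum>j\<in>?J. u (F j) * F j p)" by (subst sum.reindex[OF inj]) (simp only: o_def)
    finally show "(\<Sum>v\<in>F ` ?J. (\<lambda>x. u v * v x)) p = (\<Sum>j<k + 1. u (F j) * F j p)" .
  qed
  have indep: "real_fun.independent (F ` ?J)"
  proof (rule real_fun.independent_if_scalars_zero)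
    fix u v assume z: "(\<Sum>v\<in>F ` ?J. (\<lambda>x. u v * v x)) = 0" and "v \<in> F ` ?J"
    then obtain j where j: "j \<in> ?J" "v = F j" by blast
    have "0 = (\<Sum>i\<in>?J. u (F i) * F i (q j))" using z unfolding comb by (metis zero_fun_def)
    also have "\<dots> = u (F j) * F j (q j) + (\<Sum>i\<in>?J - {j}. u (F i) * F i (q j))"
      using j by (intro sum.remove) auto
    also have "(\<Sum>i\<in>?J - {j}. u (F i) * F i (q j)) = 0" using q' j by (intro sum.neutral) auto
    finally show "u v = 0" using q j by simp
  qed simp
  let ?W = "real_fun.span (F ` ?J)"
  have dim: "real_fun.dim ?W = k + 1"
    using real_fun.dim_span_eq_card_independent[OF indep] card_image[OF inj] by simp
  have W: "f \<in> ?W \<Longrightarrow> \<exists>a. f = (\<lambda>p. \<Sum>j<k + 1. a j * F j p)" for f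
    using real_fun.span_finite[of "F ` ?J"] comb by auto
  have "measure_eigenvalue A g k \<mu> \<le> (SUP f\<in>?W - {0}. rayleigh_quotient A g \<mu> f)"
    unfolding measure_eigenvalue_def
  proof (rule INF_lower, rule CollectI, intro conjI)
    show "real_fun.subspace ?W" by (rule real_fun.subspace_span)
    show "?W \<subseteq> smooth_functions A" using W smooth by blast
    show "real_fun.dim ?W = k + 1" by (rule dim)
  qed
  also have "\<dots> \<le> ennreal (e / b)"
  proof (rule SUP_least)
    fix f assume f: "f \<in> ?W - {0}"
    then obtain a where a: "f = (\<lambda>p. \<Sum>j<k + 1. a j * F j p)" using W by blast
    let ?s = "\<Sum>j<k + 1. (a j)\<^sup>2"
    have s: "0 < ?s"
    proof (rule ccontr)
      assume "\<not> 0 < ?s"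
      then have "?s = 0" by (simp add: sum_nonneg order_antisym not_less)
      then have "\<forall>j\<in>?J. (a j)\<^sup>2 = 0" by (subst (asm) sum_nonneg_eq_0_iff) auto
      then have "f = 0" unfolding a by (auto simp: fun_eq_iff)
      then show False using f by simp
    qed
    let ?E = "\<integral>\<^sup>+p. ennreal (differential_norm_sq A g f p) \<partial>riemannian_volume A g"
    let ?N = "\<integral>\<^sup>+p. ennreal ((f p)\<^sup>2) \<partial>\<mu>"
    have E: "?E \<le> ennreal (e * ?s)" unfolding a by (rule energy)
    have "(\<Sum>j\<in>?J. ennreal ((a j)\<^sup>2) * indicator (B j) p) \<le> ennreal ((f p)\<^sup>2)" for p
    proof (cases "\<exists>j\<in>?J. F j p \<noteq> 0")
      case False
      then have "indicator (B j) p = (0 :: ennreal)" if "j \<in> ?J" for j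
        using B(2)[of j p] that by (auto simp: indicator_def)
      then have "(\<Sum>j\<in>?J. ennreal ((a j)\<^sup>2) * indicator (B j) p) = 0" by (intro sum.neutral) simp
      then show ?thesis by (simp only: zero_le)
    next
      case True
      then obtain j where j: "j \<in> ?J" "F j p \<noteq> 0" by blast
      have z: "F i p = 0" if "i \<in> ?J - {j}" for i using disj'[of i j p] j that by auto
      have "f p = a j * F j p + (\<Sum>i\<in>?J - {j}. a i * F i p)"
        unfolding a using j by (intro sum.remove) auto
      then have fp: "f p = a j * F j p" using z by simp
      have "(\<Sum>i\<in>?J. ennreal ((a i)\<^sup>2) * indicator (B i) p) =
          ennreal ((a j)\<^sup>2) * indicator (B j) p + (\<Sum>i\<in>?J - {j}. ennreal ((a i)\<^sup>2) * indicator (B i) p)"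
        using j by (intro sum.remove) auto
      also have "(\<Sum>i\<in>?J - {j}. ennreal ((a i)\<^sup>2) * indicator (B i) p) = 0"
      proof (rule sum.neutral, rule ballI)
        fix i assume i: "i \<in> ?J - {j}"
        then have "p \<notin> B i" using z[OF i] B(2)[of i p] by auto
        then show "ennreal ((a i)\<^sup>2) * indicator (B i) p = 0" by simp
      qed
      also have "ennreal ((a j)\<^sup>2) * indicator (B j) p + 0 \<le> ennreal ((f p)\<^sup>2)"
        using B(2)[of j p] j by (cases "p \<in> B j") (auto simp: fp)
      finally show ?thesis .
    qed
    then have "(\<integral>\<^sup>+p. (\<Sum>j\<in>?J. ennreal ((a j)\<^sup>2) * indicator (B j) p) \<partial>\<mu>) \<le> ?N"
      by (intro nn_integral_mono)
    moreover have "(\<integral>\<^sup>+p. (\<Sum>j\<in>?J. ennreal ((a j)\<^sup>2) * indicator (B j) p) \<partial>\<mu>) =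
        (\<Sum>j\<in>?J. ennreal ((a j)\<^sup>2) * emeasure \<mu> (B j))"
    proof (subst nn_integral_sum)
      show "(\<Sum>j\<in>?J. \<integral>\<^sup>+p. ennreal ((a j)\<^sup>2) * indicator (B j) p \<partial>\<mu>) =
          (\<Sum>j\<in>?J. ennreal ((a j)\<^sup>2) * emeasure \<mu> (B j))"
        by (intro sum.cong[OF refl] nn_integral_cmult_indicator B(1)) auto
    qed (use B(1) in auto)
    moreover have "(\<Sum>j\<in>?J. ennreal ((a j)\<^sup>2) * ennreal b) \<le> (\<Sum>j\<in>?J. ennreal ((a j)\<^sup>2) * emeasure \<mu> (B j))"
      by (intro sum_mono mult_left_mono B(3)) auto
    moreover have "(\<Sum>j\<in>?J. ennreal ((a j)\<^sup>2) * ennreal b) = ennreal (?s * b)"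
    proof -
      have "(\<Sum>j\<in>?J. ennreal ((a j)\<^sup>2) * ennreal b) = (\<Sum>j\<in>?J. ennreal ((a j)\<^sup>2 * b))"
        by (intro sum.cong[OF refl] ennreal_mult[symmetric]) (use b in simp_all)
      also have "\<dots> = ennreal (\<Sum>j\<in>?J. (a j)\<^sup>2 * b)" by (rule sum_ennreal) (use b in simp)
      finally show ?thesis by (simp only: sum_distrib_right)
    qed
    ultimately have N: "ennreal (?s * b) \<le> ?N" by (simp only:)
    have "0 < ennreal (?s * b)" by (subst ennreal_less_zero_iff) (rule mult_pos_pos[OF s b])
    then have N0: "0 < ?N" using N by (rule order_less_le_trans)
    have "?E \<le> ennreal (e / b) * ennreal (?s * b)"
    proof -
      have "ennreal (e / b) * ennreal (t * b) = ennreal (e * t)" if "0 < t" for t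
        using e b that by (simp add: ennreal_mult[symmetric])
      from this[OF s] show ?thesis using E by (simp only:)
    qed
    also have "\<dots> \<le> ennreal (e / b) * ?N" by (intro mult_left_mono N) simp
    finally have "?E \<le> ?N * ennreal (e / b)" by (simp only: mult.commute)
    then have "?E / ?N \<le> ennreal (e / b)" by (rule divide_le_posI_ennreal[OF N0])
    then show "rayleigh_quotient A g \<mu> f \<le> ennreal (e / b)"
      unfolding rayleigh_quotient_def Let_def using N0[THEN gr_implies_not_zero] by (simp only: if_False)
  qed
  finally show ?thesis .
qed

lemma smooth_function_continuous:
  fixes A :: "('a::topological_space, 'n::finite) chart set"
  assumes A: "smooth_atlas A" and f: "f \<in> smooth_functions A"
  shows "continuous_on UNIV f"
proof -
  have "continuous_on (\<Union>c\<in>A. fst c) f"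
  proof (rule continuous_on_open_UN)
    fix c assume c: "c \<in> A"
    then have chc: "is_chart c" using A by (simp add: smooth_atlas_def)
    note hc = chart_homeomorphism[OF chc]
    show "open (fst c)" by (rule hc(1))
    have "continuous_on (chart_image c) (f \<circ> chart_inv c)"
      by (rule smooth_map_on_continuous) (use f c in \<open>auto simp: smooth_functions_def\<close>)
    then have "continuous_on (fst c) (\<lambda>p. (f \<circ> chart_inv c) (snd c p))"
      by (rule continuous_on_compose2[OF _ hc(2)]) (use hc(7) in blast)
    then show "continuous_on (fst c) f"
      by (rule continuous_on_eq) (simp add: hc(4))
  qed
  then show ?thesis using A by (simp add: smooth_atlas_def)
qed

lemma chart_coordinates_measurable:
  fixes c :: "('a::topological_space, 'n::finite) chart"
  assumes "is_chart c"
  shows "(\<lambda>p. indicator (fst c) p *\<^sub>R snd c p) \<in> borel_measurable borel"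
  using chart_homeomorphism(1,2)[OF assms] by (intro borel_measurable_continuous_on_indicator) auto

text \<open>In the chart, the volume is Lebesgue measure with a density that is bounded over the compact set of
  relevant coordinates.\<close>

lemma chart_lift_energy:
  fixes A :: "('a::t2_space, 'n::finite) chart set"
  assumes A: "smooth_atlas A" and g: "riemannian_metric A g" and M: "compact (UNIV :: 'a set)"
    and c: "c \<in> A" and K: "closed K" "compact (K \<inter> chart_image c)"
  obtains E :: real where "0 \<le> E"
    "\<And>f \<beta>. test_function K \<beta> f \<Longrightarrow> \<beta> \<in> borel_measurable borel \<Longrightarrow>
      (\<integral>\<^sup>+p. ennreal (differential_norm_sq A g (chart_lift c f) p) \<partial>riemannian_volume A g) \<le>
        ennreal E * (\<integral>\<^sup>+x. ennreal ((\<beta> x)\<^sup>2) \<partial>lborel)"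
proof -
  have chc: "is_chart c" using A c by (simp add: smooth_atlas_def)
  note hc = chart_homeomorphism[OF chc]
  obtain \<Lambda> where \<Lambda>: "0 < \<Lambda>" "\<And>f \<beta> p. test_function K \<beta> f \<Longrightarrow>
      differential_norm_sq A g (chart_lift c f) p \<le>
        (if p \<in> fst c \<and> snd c p \<in> K then \<Lambda> * (\<beta> (snd c p))\<^sup>2 else 0)"
    by (rule chart_lift_energy_density[OF A g c K(2)]) (rule that)
  have "continuous_on (K \<inter> chart_image c) (\<lambda>x. sqrt (det (g c x)))"
  proof (intro continuous_on_real_sqrt continuous_on_det)
    show "continuous_on (K \<inter> chart_image c) (g c)"
      by (rule continuous_on_subset[OF smooth_map_on_continuous[of "chart_image c"]])
        (use g c in \<open>auto simp: riemannian_metric_def\<close>)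
  qed
  then have "bounded ((\<lambda>x. sqrt (det (g c x))) ` (K \<inter> chart_image c))"
    by (intro compact_imp_bounded compact_continuous_image K(2))
  then obtain D where D: "0 < D" "\<forall>y\<in>(\<lambda>x. sqrt (det (g c x))) ` (K \<inter> chart_image c). norm y \<le> D"
    unfolding bounded_pos by (elim exE conjE) (rule that)
  have Dx: "sqrt (det (g c x)) \<le> D" if "x \<in> K \<inter> chart_image c" for x
    using D(2) that by (auto simp: abs_le_iff)
  show ?thesis
  proof (rule that[of "D * \<Lambda>"])
    show "0 \<le> D * \<Lambda>" using D \<Lambda> by simp
    fix f \<beta> assume f: "test_function K \<beta> f" and \<beta>: "\<beta> \<in> borel_measurable borel"
    let ?s = "\<lambda>p. indicator (fst c) p *\<^sub>R snd c p"
    define h where "h p = ennreal (\<Lambda> * (\<beta> (?s p))\<^sup>2) * indicator (fst c) p * indicator K (?s p)" for p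
    have hm: "h \<in> borel_measurable borel"
    proof -
      note [measurable] = chart_coordinates_measurable[OF chc] \<beta>
      have [measurable]: "K \<in> sets borel" "fst c \<in> sets borel" using K(1) hc(1) by auto
      show ?thesis unfolding h_def by measurable
    qed
    have "(\<integral>\<^sup>+p. ennreal (differential_norm_sq A g (chart_lift c f) p) \<partial>riemannian_volume A g) \<le>
        (\<integral>\<^sup>+p. h p \<partial>riemannian_volume A g)"
    proof (rule nn_integral_mono)
      fix p
      have "differential_norm_sq A g (chart_lift c f) p \<le>
        (if p \<in> fst c \<and> snd c p \<in> K then \<Lambda> * (\<beta> (snd c p))\<^sup>2 else 0)" by (rule \<Lambda>(2)[OF f])
      then show "ennreal (differential_norm_sq A g (chart_lift c f) p) \<le> h p"
        by (auto simp: h_def indicator_def ennreal_neg intro: ennreal_leI split: if_splits)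
    qed
    also have "\<dots> = (\<integral>\<^sup>+x\<in>chart_image c. ennreal (sqrt (det (g c x))) * h (chart_inv c x) \<partial>lborel)"
      by (rule nn_integral_riemannian_volume_chart[OF A g M c hm]) (simp add: h_def)
    also have "\<dots> \<le> (\<integral>\<^sup>+x. ennreal (D * \<Lambda>) * ennreal ((\<beta> x)\<^sup>2) \<partial>lborel)"
    proof (rule nn_integral_mono)
      fix x
      show "ennreal (sqrt (det (g c x))) * h (chart_inv c x) * indicator (chart_image c) x \<le>
          ennreal (D * \<Lambda>) * ennreal ((\<beta> x)\<^sup>2)"
      proof (cases "x \<in> chart_image c \<and> x \<in> K")
        case True
        then have "h (chart_inv c x) = ennreal (\<Lambda> * (\<beta> x)\<^sup>2)"
          using hc(5,6)[of x] by (simp add: h_def)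
        moreover have "ennreal (sqrt (det (g c x))) * ennreal (\<Lambda> * (\<beta> x)\<^sup>2) \<le> ennreal D * ennreal (\<Lambda> * (\<beta> x)\<^sup>2)"
          using Dx[of x] True by (intro mult_right_mono ennreal_leI) auto
        moreover have "ennreal D * ennreal (\<Lambda> * (\<beta> x)\<^sup>2) = ennreal (D * \<Lambda>) * ennreal ((\<beta> x)\<^sup>2)"
          using D \<Lambda>(1) by (simp add: ennreal_mult[symmetric] mult.assoc)
        ultimately show ?thesis using True by simp
      next
        case False
        then show ?thesis using hc(5,6)[of x] by (auto simp: h_def indicator_def)
      qed
    qed
    also have "\<dots> = ennreal (D * \<Lambda>) * (\<integral>\<^sup>+x. ennreal ((\<beta> x)\<^sup>2) \<partial>lborel)"
      by (rule nn_integral_cmult) (use \<beta> in measurable)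
    finally show "(\<integral>\<^sup>+p. ennreal (differential_norm_sq A g (chart_lift c f) p) \<partial>riemannian_volume A g) \<le>
        ennreal (D * \<Lambda>) * (\<integral>\<^sup>+x. ennreal ((\<beta> x)\<^sup>2) \<partial>lborel)" .
  qed
qed

section \<open>Atomless measures concentrated near a point\<close>

lemma test_function_sum:
  fixes \<phi> :: "nat \<Rightarrow> 'b::real_normed_vector \<Rightarrow> real"
  assumes \<phi>: "\<And>j. j < N \<Longrightarrow> test_function K \<beta> (\<phi> j)"
  shows "test_function K (\<lambda>x. (\<Sum>j<N. \<bar>a j\<bar>) * \<beta> x) (\<lambda>x. \<Sum>j<N. a j * \<phi> j x)"
  unfolding test_function_def
proof (intro conjI allI impI)
  have C: "Ck_on k UNIV (\<phi> j)" if "j < N" for j k using \<phi>[OF that] by (simp add: test_function_def)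
  show "Ck_on k UNIV (\<lambda>x. \<Sum>j<N. a j * \<phi> j x)" for k
    by (intro Ck_on_sum Ck_on_mult Ck_on_const) (use C in auto)
  show "(\<Sum>j<N. a j * \<phi> j x) = 0" if "x \<notin> K" for x
    using \<phi> that by (intro sum.neutral) (simp add: test_function_def)
  fix x v
  have "((\<lambda>x. \<Sum>j<N. a j * \<phi> j x) has_derivative (\<lambda>v. \<Sum>j<N. a j * frechet_derivative (\<phi> j) (at x) v)) (at x)"
  proof (rule has_derivative_sum)
    fix j assume "j \<in> {..<N}"
    then have "(\<phi> j has_derivative frechet_derivative (\<phi> j) (at x)) (at x)"
      using Ck_on_Suc_derivative[OF C UNIV_I] by simp
    then show "((\<lambda>x. a j * \<phi> j x) has_derivative (\<lambda>v. a j * frechet_derivative (\<phi> j) (at x) v)) (at x)"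
      by (rule has_derivative_mult_right)
  qed
  then have "frechet_derivative (\<lambda>x. \<Sum>j<N. a j * \<phi> j x) (at x) v = (\<Sum>j<N. a j * frechet_derivative (\<phi> j) (at x) v)"
    by (simp add: frechet_derivative_eqI)
  also have "\<bar>\<dots>\<bar> \<le> (\<Sum>j<N. \<bar>a j\<bar> * (\<beta> x * norm v))"
  proof (rule order_trans[OF sum_abs sum_mono])
    fix j assume "j \<in> {..<N}"
    then have "\<bar>frechet_derivative (\<phi> j) (at x) v\<bar> \<le> \<beta> x * norm v"
      using \<phi>[of j] by (simp add: test_function_def)
    then show "\<bar>a j * frechet_derivative (\<phi> j) (at x) v\<bar> \<le> \<bar>a j\<bar> * (\<beta> x * norm v)"
      unfolding abs_mult by (rule mult_left_mono) simp
  qed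
  also have "\<dots> = (\<Sum>j<N. \<bar>a j\<bar>) * \<beta> x * norm v"
    by (simp only: sum_distrib_right[symmetric] mult.assoc)
  finally show "\<bar>frechet_derivative (\<lambda>x. \<Sum>j<N. a j * \<phi> j x) (at x) v\<bar> \<le> (\<Sum>j<N. \<bar>a j\<bar>) * \<beta> x * norm v" .
qed

lemma test_function_mono: "test_function K \<beta> f \<Longrightarrow> K \<subseteq> K' \<Longrightarrow> test_function K' \<beta> f"
  unfolding test_function_def by blast

lemma chart_lift_sum:
  "(\<lambda>p. \<Sum>j<N. a j * chart_lift c (\<phi> j) p) = chart_lift c (\<lambda>x. \<Sum>j<N. a j * \<phi> j x)"
  by (auto simp: chart_lift_def fun_eq_iff)

text \<open>All functions share the gradient bound \<open>\<beta>\<close>, so a combination has gradient at most \<open>(\<Sum>|a\<^sub>j|) \<beta>\<close>; the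
  factor \<open>N\<close> comes from the Cauchy-Schwarz inequality.\<close>

lemma chart_lift_family_energy:
  assumes energy: "\<And>f \<beta>. test_function K \<beta> f \<Longrightarrow> \<beta> \<in> borel_measurable borel \<Longrightarrow>
      (\<integral>\<^sup>+p. ennreal (differential_norm_sq A g (chart_lift c f) p) \<partial>riemannian_volume A g) \<le>
        ennreal E * (\<integral>\<^sup>+x. ennreal ((\<beta> x)\<^sup>2) \<partial>lborel)"
    and E: "0 \<le> E" and \<beta>: "\<beta> \<in> borel_measurable borel" and G: "0 \<le> G"
    and \<phi>: "\<And>j. j < N \<Longrightarrow> test_function K \<beta> (\<phi> j)"
    and int: "(\<integral>\<^sup>+x. ennreal ((\<beta> x)\<^sup>2) \<partial>lborel) \<le> ennreal G"
  shows "(\<integral>\<^sup>+p. ennreal (differential_norm_sq A g (\<lambda>p. \<Sum>j<N. a j * chart_lift c (\<phi> j) p) p) \<partial>riemannian_volume A g)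
    \<le> ennreal (E * real N * G * (\<Sum>j<N. (a j)\<^sup>2))"
proof -
  let ?s = "\<Sum>j<N. \<bar>a j\<bar>"
  have "(\<integral>\<^sup>+p. ennreal (differential_norm_sq A g (\<lambda>p. \<Sum>j<N. a j * chart_lift c (\<phi> j) p) p) \<partial>riemannian_volume A g)
      \<le> ennreal E * (\<integral>\<^sup>+x. ennreal ((?s * \<beta> x)\<^sup>2) \<partial>lborel)"
    unfolding chart_lift_sum
    by (rule energy[OF test_function_sum[OF \<phi>]]) (use \<beta> in simp_all)
  also have "(\<integral>\<^sup>+x. ennreal ((?s * \<beta> x)\<^sup>2) \<partial>lborel) = (\<integral>\<^sup>+x. ennreal (?s\<^sup>2) * ennreal ((\<beta> x)\<^sup>2) \<partial>lborel)"
    by (rule nn_integral_cong) (simp add: power_mult_distrib ennreal_mult)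
  also have "\<dots> = ennreal (?s\<^sup>2) * (\<integral>\<^sup>+x. ennreal ((\<beta> x)\<^sup>2) \<partial>lborel)"
    by (rule nn_integral_cmult) (use \<beta> in simp)
  also have "ennreal E * \<dots> \<le> ennreal E * (ennreal (?s\<^sup>2) * ennreal G)"
    by (intro mult_left_mono int) auto
  also have "\<dots> = ennreal (E * (?s\<^sup>2 * G))" using E G by (simp add: ennreal_mult)
  also have "\<dots> \<le> ennreal (E * real N * G * (\<Sum>j<N. (a j)\<^sup>2))"
  proof (rule ennreal_leI)
    have "?s\<^sup>2 \<le> (\<Sum>j<N. \<bar>a j\<bar>\<^sup>2) * card {..<N}" by (rule sum_squared_le_sum_of_squares)
    then have "?s\<^sup>2 \<le> (\<Sum>j<N. (a j)\<^sup>2) * real N" by simp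
    then have "E * (?s\<^sup>2 * G) \<le> E * (((\<Sum>j<N. (a j)\<^sup>2) * real N) * G)"
      using E G by (intro mult_left_mono mult_right_mono) auto
    then show "E * (?s\<^sup>2 * G) \<le> E * real N * G * (\<Sum>j<N. (a j)\<^sup>2)" by (simp add: mult_ac)
  qed
  finally show ?thesis .
qed

lemma radon_measure_compact_space:
  fixes \<nu> :: "'a::t2_space measure"
  assumes "radon_measure \<nu>" "compact (UNIV :: 'a set)"
  shows "finite_measure \<nu>" "sets \<nu> = sets borel" "space \<nu> = UNIV"
proof -
  show s: "sets \<nu> = sets borel" using assms(1) by (simp add: radon_measure_def)
  then show sp: "space \<nu> = UNIV" using sets_eq_imp_space_eq by fastforce
  have "\<forall>K. compact K \<longrightarrow> emeasure \<nu> K < \<infinity>"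
    using assms(1) unfolding radon_measure_def by (elim conjE)
  then have "emeasure \<nu> UNIV < \<infinity>" using assms(2) by blast
  then show "finite_measure \<nu>" by (intro finite_measureI) (simp add: sp less_top)
qed

lemma integrable_continuous_compact:
  fixes f :: "'a::t2_space \<Rightarrow> real"
  assumes \<nu>: "radon_measure \<nu>" and K: "compact (UNIV :: 'a set)" and f: "continuous_on UNIV f"
  shows "integrable \<nu> f"
proof -
  note fin = radon_measure_compact_space[OF \<nu> K]
  interpret finite_measure \<nu> by (rule fin(1))
  have "bounded (range f)" by (intro compact_imp_bounded compact_continuous_image f K)
  then obtain D where D: "\<forall>y\<in>range f. norm y \<le> D" unfolding bounded_iff by (elim exE) (rule that)
  have "f \<in> borel_measurable \<nu>"
    using borel_measurable_continuous_onI[OF f] by (simp add: fin(2) cong: measurable_cong_sets)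
  then show ?thesis by (rule integrable_const_bound[rotated, of _ D]) (use D in simp)
qed

text \<open>A quantitative form of the theorem: an atomless measure that puts mass \<open>m\<close> into a sufficiently small
  coordinate ball around \<open>p\<close> has a small eigenvalue. The cutoff function makes this mass visible to
  weak* convergence, and the size of the ball does not depend on the measure.\<close>

lemma cutoff_detecting_concentration:
  fixes A :: "('a::t2_space, 'n::finite) chart set"
  assumes A: "smooth_atlas A" and g: "riemannian_metric A g" and M: "compact (UNIV :: 'a set)"
    and n: "3 \<le> CARD('n)" and m: "0 < m" and c: "0 < c"
  obtains \<psi> :: "'a \<Rightarrow> real" where "continuous_on UNIV \<psi>" "\<And>q. 0 \<le> \<psi> q" "\<psi> p = 1"
    "\<And>\<nu>. \<nu> \<in> continuous_radon_measures \<Longrightarrow> m \<le> integral\<^sup>L \<nu> \<psi> \<Longrightarrow> measure_eigenvalue A g k \<nu> \<le> ennreal c"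
proof -
  have "p \<in> (\<Union>d\<in>A. fst d)" using A by (simp add: smooth_atlas_def)
  then obtain d where d: "d \<in> A" "p \<in> fst d" by (elim UN_E) (rule that)
  have chd: "is_chart d" using A d by (simp add: smooth_atlas_def)
  note hd = chart_homeomorphism[OF chd]
  define x0 where "x0 = snd d p"
  have "half_space_open (chart_image d)" by (rule chart_image_half_space_open[OF chd])
  then obtain i U where U: "open U" "chart_image d = {x. 0 \<le> x $ i} \<inter> U"
    unfolding half_space_open_def openin_open by (elim exE conjE) (rule that)
  have "x0 \<in> U" using hd(7)[OF d(2)] unfolding x0_def U(2) by simp
  then obtain \<rho> where \<rho>: "0 < \<rho>" "ball x0 \<rho> \<subseteq> U" using U(1) by (auto elim: openE)
  \<comment> \<open>the supports reach out to four times the scale and have to stay inside the ball of radius \<open>\<rho>\<close>\<close>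
  define \<rho>0 where "\<rho>0 = min 1 (\<rho> / 8)"
  have \<rho>0: "0 < \<rho>0" "\<rho>0 \<le> 1" "4 * \<rho>0 < \<rho>" using \<rho>(1) by (auto simp: \<rho>0_def)
  let ?K = "cball x0 (4 * \<rho>0)"
  have K: "compact (?K \<inter> chart_image d)"
  proof -
    have "?K \<subseteq> U" using \<rho>0(3) \<rho>(2) by (auto simp: subset_iff)
    then have "?K \<inter> chart_image d = ?K \<inter> {x. 0 \<le> x $ i}" unfolding U(2) by blast
    moreover have "closed {x::real^'n. 0 \<le> x $ i}" by (intro closed_Collect_le continuous_intros)
    ultimately show ?thesis by (simp add: compact_Int_closed)
  qed
  obtain E :: real where E: "0 \<le> E"
    "\<And>f \<beta>. test_function ?K \<beta> f \<Longrightarrow> \<beta> \<in> borel_measurable borel \<Longrightarrow>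
      (\<integral>\<^sup>+p. ennreal (differential_norm_sq A g (chart_lift d f) p) \<partial>riemannian_volume A g) \<le>
        ennreal E * (\<integral>\<^sup>+x. ennreal ((\<beta> x)\<^sup>2) \<partial>lborel)"
    by (rule chart_lift_energy[OF A g M d(1) closed_cball K]) (rule that)
  have dim: "3 \<le> DIM(real^'n)" using n by simp
  obtain \<theta> C :: real where \<theta>: "0 < \<theta>" and C: "0 \<le> C"
    and family: "\<And>(M :: (real^'n) measure) x0 R. finite_measure M \<Longrightarrow> sets M = sets borel \<Longrightarrow>
      (\<forall>x. measure M {x} = 0) \<Longrightarrow> measure M (- ball x0 R) = 0 \<Longrightarrow> 0 < R \<Longrightarrow> R \<le> 1 \<Longrightarrow> 0 < measure M (ball x0 R) \<Longrightarrow>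
      \<exists>\<phi> \<beta>. test_family (k + 1) (cball x0 (4 * R)) \<phi> \<beta> \<and>
        (\<integral>\<^sup>+z. ennreal ((\<beta> z)\<^sup>2) \<partial>lborel) \<le> ennreal (C * R) \<and>
        (\<forall>j<k + 1. \<exists>B\<in>sets borel. (\<forall>z\<in>B. \<phi> j z = 1) \<and> \<theta> * measure M (ball x0 R) \<le> measure M B)"
    by (rule concentrated_test_family[OF dim, of "k + 1"]) (rule that)
  define Q where "Q = E * real (k + 1) * C"
  have Q: "0 \<le> Q" unfolding Q_def using E(1) C by simp
  \<comment> \<open>the scale at which the energy bound \<open>Q R\<close> falls below \<open>c\<close> times the guaranteed mass \<open>\<theta> m\<close>\<close>
  define R where "R = min \<rho>0 (c * \<theta> * m / (Q + 1))"
  have R: "0 < R" "R \<le> \<rho>0" "R \<le> 1" using \<rho>0 c \<theta> m Q by (auto simp: R_def min.coboundedI1)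
  have QR: "Q * R / (\<theta> * m) \<le> c"
  proof -
    have "Q * R \<le> Q * (c * \<theta> * m / (Q + 1))" using Q by (intro mult_left_mono) (simp_all add: R_def)
    also have "\<dots> = (Q / (Q + 1)) * (c * \<theta> * m)" by simp
    also have "\<dots> \<le> 1 * (c * \<theta> * m)" using Q c \<theta> m by (intro mult_right_mono) auto
    finally show ?thesis using \<theta> m by (simp add: divide_le_eq mult.assoc)
  qed
  obtain \<eta> :: "real^'n \<Rightarrow> real" and L where \<eta>:
    "\<And>k. Ck_on k UNIV \<eta>" "\<And>x. 0 \<le> \<eta> x" "\<And>x. \<eta> x \<le> 1"
    "\<And>x. norm x \<le> 1 \<Longrightarrow> \<eta> x = 1" "\<And>x. norm x \<ge> 2 \<Longrightarrow> \<eta> x = 0"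
    "0 < L" "\<And>x v. \<bar>frechet_derivative \<eta> (at x) v\<bar> \<le> L * norm v"
    "\<And>x. norm x > 2 \<Longrightarrow> frechet_derivative \<eta> (at x) = (\<lambda>v. 0)"
    by (rule exists_smooth_bump) (rule that)
  let ?b = "scaled_bump \<eta> x0 (R / 2)"
  have R2: "0 < R / 2" using R(1) by simp
  have b0: "?b x = 0" if "R \<le> dist x0 x" for x
    unfolding scaled_bump_def
    by (rule \<eta>(5), simp only: norm_rescaled[OF R2]) (use that R(1) in \<open>simp add: field_simps\<close>)
  define \<psi> where "\<psi> = chart_lift d ?b"
  have \<psi>s: "\<psi> \<in> smooth_functions A"
    unfolding \<psi>_def
  proof (rule chart_lift_smooth[OF A d(1) Ck_on_scaled_bump[OF \<eta>(1)] K])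
    fix x assume "x \<notin> ?K"
    then have "R \<le> dist x0 x" using R(1,2) by simp
    then show "?b x = 0" by (rule b0)
  qed
  have \<psi>c: "continuous_on UNIV \<psi>" by (rule smooth_function_continuous[OF A \<psi>s])
  have \<psi>0: "0 \<le> \<psi> q" for q by (simp add: \<psi>_def chart_lift_def scaled_bump_def \<eta>(2))
  have \<psi>p: "\<psi> p = 1" using d(2) by (simp add: \<psi>_def chart_lift_def scaled_bump_def x0_def \<eta>(4))
  show ?thesis
  proof (rule that[OF \<psi>c \<psi>0 \<psi>p])
    fix \<nu> :: "'a measure" assume \<nu>: "\<nu> \<in> continuous_radon_measures" and big: "m \<le> integral\<^sup>L \<nu> \<psi>"
    have rad: "radon_measure \<nu>" and atom: "\<And>q. emeasure \<nu> {q} = 0"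
      using \<nu> by (auto simp: continuous_radon_measures_def)
    note fin = radon_measure_compact_space[OF rad M]
    interpret finite_measure \<nu> by (rule fin(1))
    let ?s = "\<lambda>q. indicator (fst d) q *\<^sub>R snd d q"
    have sm: "?s \<in> borel_measurable borel" by (rule chart_coordinates_measurable[OF chd])
    define V where "V = fst d \<inter> ?s -` ball x0 R"
    have sb: "?s -` S \<in> sets borel" if "S \<in> sets borel" for S
      using measurable_sets[OF sm that] by simp
    have V: "V \<in> sets borel" unfolding V_def using hd(1) by (intro sets.Int sb) auto
    \<comment> \<open>the part of the measure over the small coordinate ball, in coordinates; the function \<open>?s\<close> sends the rest of the manifold to 0\<close>
    define P where "P = distr (density \<nu> (indicator V)) borel ?s"
    have emP: "emeasure P S = emeasure \<nu> (V \<inter> ?s -` S)" if S: "S \<in> sets borel" for S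
    proof -
      have "emeasure P S = emeasure (density \<nu> (indicator V)) (?s -` S)"
        unfolding P_def using sm S by (subst emeasure_distr) (simp_all add: fin cong: measurable_cong_sets)
      also have "\<dots> = (\<integral>\<^sup>+q. indicator V q * indicator (?s -` S) q \<partial>\<nu>)"
        by (intro emeasure_density borel_measurable_indicator) (use V sb[OF S] in \<open>simp_all only: fin(2)\<close>)
      also have "\<dots> = (\<integral>\<^sup>+q. indicator (V \<inter> ?s -` S) q \<partial>\<nu>)"
        by (simp only: indicator_inter_arith)
      also have "\<dots> = emeasure \<nu> (V \<inter> ?s -` S)"
        by (rule nn_integral_indicator) (use V sb[OF S] in \<open>simp add: fin(2)\<close>)
      finally show ?thesis .
    qed
    have mP: "measure P S = measure \<nu> (V \<inter> ?s -` S)" if "S \<in> sets borel" for S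
      using emP[OF that] by (simp add: measure_def)
    have P: "finite_measure P" "sets P = sets borel"
    proof -
      show "sets P = sets borel" by (simp add: P_def)
      show "finite_measure P"
        by (rule finite_measureI) (simp add: P_def[THEN arg_cong, of space] emP)
    qed
    have atomP: "measure P {x} = 0" for x
    proof -
      have "V \<inter> ?s -` {x} \<subseteq> {chart_inv d x}" unfolding V_def using hd(4) by auto
      then have "emeasure \<nu> (V \<inter> ?s -` {x}) \<le> emeasure \<nu> {chart_inv d x}"
        by (rule emeasure_mono) (simp add: fin(2))
      then show ?thesis using mP[of "{x}"] atom by (simp add: measure_def)
    qed
    have concP: "measure P (- ball x0 R) = 0"
    proof -
      have "V \<inter> ?s -` (- ball x0 R) = {}" unfolding V_def by blast
      moreover have "- ball x0 R \<in> sets borel" by (rule borel_comp) simp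
      ultimately show ?thesis using mP[of "- ball x0 R"] by simp
    qed
    have massP: "m \<le> measure P (ball x0 R)"
    proof -
      have "integral\<^sup>L \<nu> \<psi> \<le> integral\<^sup>L \<nu> (indicator V)"
      proof (rule integral_mono)
        show "integrable \<nu> \<psi>" by (rule integrable_continuous_compact[OF rad M \<psi>c])
        show "integrable \<nu> (indicator V :: 'a \<Rightarrow> real)"
          using V by (intro integrable_real_indicator) (simp_all add: fin(2) emeasure_eq_measure)
        fix q
        show "\<psi> q \<le> indicator V q"
        proof (cases "q \<in> V")
          case True
          then show ?thesis by (simp add: \<psi>_def chart_lift_def scaled_bump_def \<eta>(3))
        next
          case False
          then have "\<psi> q = 0" using b0[of "snd d q"] by (auto simp: \<psi>_def chart_lift_def V_def)
          then show ?thesis by simp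
        qed
      qed
      also have "integral\<^sup>L \<nu> (indicator V :: 'a \<Rightarrow> real) = measure \<nu> V" by (simp add: fin(3))
      also have "V = V \<inter> ?s -` ball x0 R" unfolding V_def by blast
      finally show ?thesis using big mP[of "ball x0 R"] by simp
    qed
    have "\<exists>\<phi> \<beta>. test_family (k + 1) (cball x0 (4 * R)) \<phi> \<beta> \<and>
        (\<integral>\<^sup>+z. ennreal ((\<beta> z)\<^sup>2) \<partial>lborel) \<le> ennreal (C * R) \<and>
        (\<forall>j<k + 1. \<exists>B\<in>sets borel. (\<forall>z\<in>B. \<phi> j z = 1) \<and> \<theta> * measure P (ball x0 R) \<le> measure P B)"
      by (rule family[OF P allI[OF atomP] concP R(1,3)]) (use massP m in linarith)
    then obtain \<phi> \<beta> where \<phi>: "test_family (k + 1) (cball x0 (4 * R)) \<phi> \<beta>"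
      and int: "(\<integral>\<^sup>+z. ennreal ((\<beta> z)\<^sup>2) \<partial>lborel) \<le> ennreal (C * R)"
      and exB: "\<forall>j<k + 1. \<exists>B\<in>sets borel. (\<forall>z\<in>B. \<phi> j z = 1) \<and> \<theta> * measure P (ball x0 R) \<le> measure P B"
      by (elim exE conjE) (rule that)
    define B where "B j = (SOME B. B \<in> sets borel \<and> (\<forall>z\<in>B. \<phi> j z = 1) \<and> \<theta> * measure P (ball x0 R) \<le> measure P B)" for j
    have "B j \<in> sets borel \<and> (\<forall>z\<in>B j. \<phi> j z = 1) \<and> \<theta> * measure P (ball x0 R) \<le> measure P (B j)"
      if "j < k + 1" for j
      unfolding B_def by (rule someI_ex) (use exB that in \<open>simp add: Bex_def\<close>)
    then have B: "B j \<in> sets borel" "\<forall>z\<in>B j. \<phi> j z = 1" "\<theta> * measure P (ball x0 R) \<le> measure P (B j)"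
      if "j < k + 1" for j using that by simp_all
    have \<phi>K: "test_function ?K \<beta> (\<phi> j)" if "j < k + 1" for j
    proof (rule test_function_mono)
      show "test_function (cball x0 (4 * R)) \<beta> (\<phi> j)" using \<phi> that by (simp add: test_family_def)
      show "cball x0 (4 * R) \<subseteq> ?K" using R(2) by (intro subset_cball) simp
    qed
    have \<beta>m: "\<beta> \<in> borel_measurable borel" using \<phi> by (simp add: test_family_def)
    have "measure_eigenvalue A g k \<nu> \<le> ennreal ((E * real (k + 1) * (C * R)) / (\<theta> * m))"
    proof (rule measure_eigenvalue_le[where F = "\<lambda>j. chart_lift d (\<phi> j)" and B = "\<lambda>j. V \<inter> ?s -` B j"])
      show "(\<lambda>p. \<Sum>j<k + 1. a j * chart_lift d (\<phi> j) p) \<in> smooth_functions A" for a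
      proof -
        have tf: "test_function ?K (\<lambda>x. (\<Sum>j<k + 1. \<bar>a j\<bar>) * \<beta> x) (\<lambda>x. \<Sum>j<k + 1. a j * \<phi> j x)"
          by (rule test_function_sum[OF \<phi>K])
        show ?thesis
          unfolding chart_lift_sum
          by (rule chart_lift_smooth[OF A d(1) _ K]) (use tf in \<open>simp_all add: test_function_def\<close>)
      qed
      show "chart_lift d (\<phi> i) q * chart_lift d (\<phi> j) q = 0" if "i < j" "j < k + 1" for i j q
        using \<phi> that by (simp add: test_family_def chart_lift_def)
      show "V \<inter> ?s -` B j \<in> sets \<nu>" if "j < k + 1" for j
        unfolding fin(2) by (intro sets.Int V sb B(1) that)
      show "chart_lift d (\<phi> j) q = 1" if "j < k + 1" "q \<in> V \<inter> ?s -` B j" for j q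
        using B(2)[OF that(1)] that(2) by (auto simp: V_def chart_lift_def)
      show "ennreal (\<theta> * m) \<le> emeasure \<nu> (V \<inter> ?s -` B j)" if "j < k + 1" for j
      proof -
        have "\<theta> * m \<le> \<theta> * measure P (ball x0 R)" using massP \<theta> by (intro mult_left_mono) auto
        also have "\<dots> \<le> measure \<nu> (V \<inter> ?s -` B j)" using B(3)[OF that] mP[OF B(1)[OF that]] by simp
        finally show ?thesis unfolding emeasure_eq_measure by (rule ennreal_leI)
      qed
      show "0 < \<theta> * m" using \<theta> m by simp
      show "0 \<le> E * real (k + 1) * (C * R)" using E(1) C R(1) by simp
      show "(\<integral>\<^sup>+p. ennreal (differential_norm_sq A g (\<lambda>p. \<Sum>j<k + 1. a j * chart_lift d (\<phi> j) p) p) \<partial>riemannian_volume A g)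
          \<le> ennreal (E * real (k + 1) * (C * R) * (\<Sum>j<k + 1. (a j)\<^sup>2))" for a
        by (rule chart_lift_family_energy[OF E(2) E(1) \<beta>m _ \<phi>K int]) (use C R(1) in simp_all)
    qed
    also have "\<dots> \<le> ennreal c"
      using QR by (intro ennreal_leI) (simp add: Q_def mult.assoc)
    finally show "measure_eigenvalue A g k \<nu> \<le> ennreal c" .
  qed
qed

theorem proposition4p6:
  fixes A :: "('a::{t2_space, second_countable_topology}, 'n::finite) chart set"
    and g :: "('a, 'n) chart \<Rightarrow> real^'n \<Rightarrow> real^'n^'n"
    and \<mu>s :: "nat \<Rightarrow> 'a measure" and \<mu> :: "'a measure" and k :: nat and c :: real
  assumes "riemannian_manifold A g"
    and "compact (UNIV :: 'a set)"
    and "CARD('n) \<ge> 3"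
    and "\<And>n. \<mu>s n \<in> continuous_radon_measures"
    and "radon_measure \<mu>"
    and "weak_star_conv \<mu>s \<mu>"
    and "c > 0"
    and "\<And>n. measure_eigenvalue A g k (\<mu>s n) \<ge> ennreal c"
  shows "\<mu> \<in> continuous_radon_measures"
proof -
  have A: "smooth_atlas A" and g: "riemannian_metric A g"
    using assms(1) by (simp_all add: riemannian_manifold_def)
  note fin = radon_measure_compact_space[OF assms(5,2)]
  interpret finite_measure \<mu> by (rule fin(1))
  have "emeasure \<mu> {p} = 0" for p
  proof (rule ccontr)
    assume "emeasure \<mu> {p} \<noteq> 0"
    then have m: "0 < measure \<mu> {p}" by (simp add: emeasure_eq_measure zero_less_measure_iff)
    then have m2: "0 < measure \<mu> {p} / 2" by simp
    have c2: "0 < c / 2" using assms(7) by simp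
    obtain \<psi> :: "'a \<Rightarrow> real" where \<psi>: "continuous_on UNIV \<psi>" "\<And>q. 0 \<le> \<psi> q" "\<psi> p = 1"
      and small: "\<And>\<nu>. \<nu> \<in> continuous_radon_measures \<Longrightarrow> measure \<mu> {p} / 2 \<le> integral\<^sup>L \<nu> \<psi> \<Longrightarrow>
        measure_eigenvalue A g k \<nu> \<le> ennreal (c / 2)"
      by (rule cutoff_detecting_concentration[OF A g assms(2,3) m2 c2]) (rule that)
    have "measure \<mu> {p} = integral\<^sup>L \<mu> (indicator {p})" by (simp add: fin(3))
    also have "\<dots> \<le> integral\<^sup>L \<mu> \<psi>"
    proof (rule integral_mono)
      show "integrable \<mu> (indicator {p} :: 'a \<Rightarrow> real)"
        by (intro integrable_real_indicator) (simp_all add: fin(2) emeasure_eq_measure)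
      show "integrable \<mu> \<psi>" by (rule integrable_continuous_compact[OF assms(5,2) \<psi>(1)])
      show "indicator {p} q \<le> \<psi> q" for q using \<psi>(2,3) by (cases "q = p") auto
    qed
    finally have "measure \<mu> {p} / 2 < integral\<^sup>L \<mu> \<psi>" using m by simp
    moreover have "(\<lambda>n. integral\<^sup>L (\<mu>s n) \<psi>) \<longlonglongrightarrow> integral\<^sup>L \<mu> \<psi>"
      using assms(6) \<psi>(1) by (simp add: weak_star_conv_def)
    ultimately have "\<forall>\<^sub>F n in sequentially. measure \<mu> {p} / 2 < integral\<^sup>L (\<mu>s n) \<psi>"
      by (rule order_tendstoD(1)[rotated])
    then obtain n where n: "measure \<mu> {p} / 2 < integral\<^sup>L (\<mu>s n) \<psi>"
      using eventually_happens'[OF sequentially_bot] by blast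
    have "ennreal c \<le> measure_eigenvalue A g k (\<mu>s n)" by (rule assms(8))
    also have "\<dots> \<le> ennreal (c / 2)" by (rule small[OF assms(4)]) (use n in linarith)
    finally show False using assms(7) by (simp add: ennreal_le_iff)
  qed
  then show ?thesis using assms(5) by (simp add: continuous_radon_measures_def)
qed

end
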